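(* Let $d\ge 2$ be an integer, let $\mu$ be a Radon measure on $\mathsf{T}_d$ such that, for some positive $\sigma\le d$, $$|\widehat{\mu}(\boldsymbol{\xi})|\ll (1+\|\boldsymbol{\xi}\|)^{-\sigma}\qquad\text{for all } \boldsymbol{\xi}\in\mathbb{R}^d,$$ and let $\mathbf{a}=(a_n)_{n=1}^\infty$ be a sequence of complex numbers with $a_n=n^{o(1)}$ as $n\to\infty$. Then $$\int_{\mathsf{T}_d}|S_{\mathbf{a},d}(\mathbf{x};N)|^{2s(d)}\,d\mu(\mathbf{x})\le N^{s(d)+s(\ell)+\ell(d-\sigma-\ell)+o(1)},\qquad N\to\infty,$$ where $\ell$ is the nearest integer to $d-\sigma+1/2$, with ties rounded up.
   Context: $\mathsf{T}_d=(\mathbb{R}/\mathbb{Z})^d$ is the unit torus, identified with $[0,1)^d$; a Radon measure $\mu$ on $\mathsf{T}_d$ is a (nonnegative) Borel measure with $\mu(\mathsf{T}_d)<\infty$, regarded also as a measure on $\mathbb{R}^d$. Write $\mathbf{e}(x)=\exp(2\pi i x)$ and $s(q)=q(q+1)/2$. The Fourier transform is $\widehat{\mu}(\boldsymbol{\xi})=\int_{\mathbb{R}^d}\mathbf{e}(-\mathbf{x}\cdot\boldsymbol{\xi})\,d\mu(\mathbf{x})$, and $\|\cdot\|$ is the Euclidean norm. For $\mathbf{x}=(x_1,\dots,x_d)$ and $N\in\mathbb{N}$, $S_{\mathbf{a},d}(\mathbf{x};N)=\sum_{n=1}^N a_n\,\mathbf{e}(x_1n+x_2n^2+\ldots+x_dn^d)$.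 The nearest integer with ties rounded up: it is the nearest integer to $x$ if $x-1/2\notin\mathbb{Z}$, and $x+1/2$ if $x-1/2\in\mathbb{Z}$. $U\ll V$ means $|U|\le cV$ for some constant $c>0$ (independent of $\boldsymbol{\xi}$). $U=V^{o(1)}$ means that for every $\varepsilon>0$, $|U|\le V^{\varepsilon}$ once $V$ is large enough; accordingly $A(N)\le N^{c+o(1)}$ means that for every $\varepsilon>0$, $A(N)\le N^{c+\varepsilon}$ for all sufficiently large $N$. *)

theory Defs
  imports "HOL-Analysis.Analysis"
begin

text \<open>
  A point of \<open>\<real>\<^sup>d\<close> is a function on the index set \<open>{1..d}\<close>, so that its coordinates carry the
  numbers \<open>1, \<dots>, d\<close> that serve as exponents in the Weyl sums.  The torus is identified with
  \<open>[0,1)\<^sup>d\<close>; under this identification its Borel sigma-algebra is the product sigma-algebra.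
\<close>

definition torus_borel :: "nat \<Rightarrow> (nat \<Rightarrow> real) measure" where
  "torus_borel d = (\<Pi>\<^sub>M i\<in>{1..d}. restrict_space borel {0..<1})"

text \<open>
  Only the measurable sets of \<^term>\<open>torus_borel d\<close> matter here.  As the torus is a compact metric
  space, a finite Borel measure on it is automatically regular.
\<close>

definition radon_measure_on_torus :: "nat \<Rightarrow> (nat \<Rightarrow> real) measure \<Rightarrow> bool" where
  "radon_measure_on_torus d \<mu> \<longleftrightarrow>
     sets \<mu> = sets (torus_borel d) \<and> emeasure \<mu> (space \<mu>) < \<infinity>"

definition ee :: "real \<Rightarrow> complex" where
  "ee x = exp (2 * of_real pi * \<i> * of_real x)"

definition ss :: "real \<Rightarrow> real" where
  "ss q = q * (q + 1) / 2"

text \<open>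
  Regarded as a measure on \<open>\<real>\<^sup>d\<close>, \<open>\<mu>\<close> is carried by \<open>[0,1)\<^sup>d\<close>, so the integral over \<open>\<real>\<^sup>d\<close> defining
  the Fourier transform is the integral over the space of \<open>\<mu>\<close>.
\<close>

definition fourier_transform :: "nat \<Rightarrow> (nat \<Rightarrow> real) measure \<Rightarrow> (nat \<Rightarrow> real) \<Rightarrow> complex" where
  "fourier_transform d \<mu> \<xi> = (\<integral>x. ee (- (\<Sum>i=1..d. x i * \<xi> i)) \<partial>\<mu>)"

definition weyl_sum :: "(nat \<Rightarrow> complex) \<Rightarrow> nat \<Rightarrow> (nat \<Rightarrow> real) \<Rightarrow> nat \<Rightarrow> complex" where
  "weyl_sum a d x N = (\<Sum>n=1..N. a n * ee (\<Sum>i=1..d. x i * real n ^ i))"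

end

(* The moment is a sum of Fourier coefficients of mu over the differences h of power sums of two
   s(d)-tuples from {1..N}.  By Vinogradov's mean value theorem each h is attained at most
   N^(s(d)+o(1)) times, and the sum of (1 + |h|)^(-sigma) over the box |h_i| <= s(d) N^i factorizes
   after the decay has been distributed suitably over the coordinates.

   The mean value theorem is proved by a p-adic, finite version of the bilinear decoupling argument of
   Guo, Li, Yung and Zorin-Kranich for the moment curve, which mirrors Wooley's nested efficient
   congruencing.  For two classes xi mod p^a and eta mod p^b that are distinct mod p one studies
   the mixed moment |f_xi|^(2 s(l)) |f_eta|^(2 (s(k) - s(l))).  Around eta the powers of degree
   > k - l give a nondegenerate system of degree l modulo p^((k-l+1) b) on the class of xi, so that
   decoupling in degree l refines a to (k-l+1) b / l.  Hoelder's inequality then bounds the moment by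
   the ones with (k-l, b, a) and (l-1, a, b).  Iterating this yields a gain that grows linearly in the
   number of rounds and so beats any positive exponent. *)
theory Submission
  imports Defs "HOL-Computational_Algebra.Computational_Algebra"
begin

section \<open>Polynomial systems modulo prime powers\<close>

text \<open>Residue classes modulo powers of one fixed prime replace intervals: they are nested and
  disjoint without error terms, and Fourier support becomes the exact vanishing of correlations, so
  that no cut-off functions occur. Two obstacles shape the statements. Once \<open>|f_eta|\<close>
  is part of the weight, the weight is not constant and the system seen on the class of
  \<open>xi\<close> is no longer the exact moment curve; the inequality is therefore proved for all
  nonnegative weights and all systems that agree with the curve up to errors divisible by
  \<open>p\<close>, with constants uniform over them. Moreover, separated classes come only modulo
  \<open>p\<close>, whereas the gain is proportional to a large \<open>b\<close>; passing from
  \<open>p\<close> to \<open>p^b\<close> costs a power of \<open>p^b\<close> with a fixed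
  coefficient, so enough rounds are made for the gain to exceed it. The prime depends on
  \<open>d\<close> only: \<open>p > d\<close> makes the factorials units, and \<open>p >= 64\<close>
  makes the contribution of a single dominant class contract, a factor \<open>4^s\<close> against
  \<open>p^(s-1)\<close> with \<open>s = s(k)\<close>. Powers of \<open>p\<close> with bounded
  exponent are constants, because only the number \<open>A\<close> of levels varies.\<close>

lemma smult_sum_right: "smult c (\<Sum>i\<in>I. f i) = (\<Sum>i\<in>I. smult c (f i))"
  by (induction I rule: infinite_finite_induct) (auto simp: smult_add_right)

lemma pcompose_power: "pcompose (f ^ n) g = pcompose f g ^ n"
  by (induction n) (auto simp: pcompose_mult pcompose_1)

lemma not_dvd_fact:
  fixes p :: int
  assumes "prime p" "int k < p"
  shows "\<not> p dvd fact k"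
  using assms(2)
proof (induction k)
  case 0
  then show ?case using assms(1) by (simp add: not_prime_unit)
next
  case (Suc k)
  have "\<not> p dvd int (Suc k)" using Suc.prems zdvd_imp_le by fastforce
  then show ?case using Suc assms(1) by (simp add: prime_dvd_mult_iff)
qed

lemma poly_split_low:
  fixes E :: "int poly"
  shows "\<exists>E'. E = (\<Sum>j\<le>l. monom (coeff E j) j) + monom 1 (Suc l) * E'"
proof -
  have "E = (\<Sum>j\<le>l. monom (coeff E j) j) + monom 1 (Suc l) * poly_shift (Suc l) E"
  proof (rule poly_eqI)
    fix n
    show "coeff E n = coeff ((\<Sum>j\<le>l. monom (coeff E j) j) + monom 1 (Suc l) * poly_shift (Suc l) E) n"
    proof (cases "n \<le> l")
      case True
      then show ?thesis
        by (simp add: coeff_sum coeff_monom_mult)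
    next
      case False
      then show ?thesis
        by (simp add: coeff_sum coeff_monom_mult coeff_poly_shift)
    qed
  qed
  then show ?thesis by blast
qed

section \<open>Elimination and lifting in modules of integer polynomials\<close>

text \<open>The instance is the set of polynomials \<open>f\<close> whose values
  \<open>f(n - xi)\<close> satisfy the congruences. Constants belong to it because the two lists of
  a correlation have equal length, so only positive degrees have to be solved for.\<close>

locale poly_module =
  fixes W :: "int poly set"
  assumes add_closed: "f \<in> W \<Longrightarrow> g \<in> W \<Longrightarrow> f + g \<in> W"
    and smult_closed: "f \<in> W \<Longrightarrow> smult c f \<in> W"
    and const_mem: "[:c:] \<in> W"
begin

lemma zero_mem: "0 \<in> W"
  using const_mem[of 0] by simp

lemma diff_closed: "f \<in> W \<Longrightarrow> g \<in> W \<Longrightarrow> f - g \<in> W"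
  using add_closed[of f "smult (-1) g"] smult_closed[of g "-1"] by simp

lemma sum_closed: "(\<And>i. i \<in> I \<Longrightarrow> f i \<in> W) \<Longrightarrow> (\<Sum>i\<in>I. f i) \<in> W"
  by (induction I rule: infinite_finite_induct) (auto intro: add_closed zero_mem)

text \<open>Back substitution from \<open>i = l\<close> downwards. Modulo \<open>p\<close> the given
  elements form a triangular system with unit diagonal \<open>v\<close>; the part above degree
  \<open>l\<close> is left to \<open>Q\<close> and everything divisible by \<open>p\<close> to
  \<open>E\<close>.\<close>

lemma triangular_elimination:
  fixes p :: int
  assumes "\<And>i. 1 \<le> i \<Longrightarrow> i \<le> l \<Longrightarrow>
      \<exists>v G E. coprime v p \<and> monom v i + monom 1 (Suc i) * G + smult p E \<in> W"
    and "1 \<le> i" "i \<le> l"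
  shows "\<exists>Q E. monom 1 i + monom 1 (Suc l) * Q + smult p E \<in> W"
  using assms(2,3)
proof (induction "l - i" arbitrary: i rule: less_induct)
  case less
  obtain v G E where v: "coprime v p" and m: "monom v i + monom 1 (Suc i) * G + smult p E \<in> W"
    using assms(1)[of i] less.prems by blast
  \<comment> \<open>\<open>y\<close> inverts \<open>v\<close> modulo \<open>p\<close>; the defect
    \<open>z * p\<close> joins the error.\<close>
  obtain y z where yz: "y * v + z * p = 1"
    using v bezout_int[of v p] by auto
  define H where "H = smult y (monom 1 (Suc i) * G)"
  obtain H' where H': "H = (\<Sum>j\<le>l. monom (coeff H j) j) + monom 1 (Suc l) * H'"
    using poly_split_low by blast
  have low: "coeff H j = 0" if "j \<le> i" for j
    using that by (simp add: H_def coeff_monom_mult)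
  have "\<forall>j\<in>{i<..l}. \<exists>Q E. monom 1 j + monom 1 (Suc l) * Q + smult p E \<in> W"
    using less.hyps less.prems by (auto simp: diff_less_mono2)
  then obtain Q' E' where QE: "\<And>j. j \<in> {i<..l} \<Longrightarrow> monom 1 j + monom 1 (Suc l) * Q' j + smult p (E' j) \<in> W"
    by metis
  have Hs: "(\<Sum>j\<le>l. monom (coeff H j) j) = (\<Sum>j\<in>{i<..l}. monom (coeff H j) j)"
    by (rule sum.mono_neutral_right) (use low in \<open>auto simp: not_less\<close>)
  define S where "S = (\<Sum>j\<in>{i<..l}. smult (coeff H j) (monom 1 j + monom 1 (Suc l) * Q' j + smult p (E' j)))"
  have SW: "S \<in> W"
    unfolding S_def by (intro sum_closed smult_closed QE)
  have S1: "S = (\<Sum>j\<in>{i<..l}. monom (coeff H j) j) + monom 1 (Suc l) * (\<Sum>j\<in>{i<..l}. smult (coeff H j) (Q' j))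
      + smult p (\<Sum>j\<in>{i<..l}. smult (coeff H j) (E' j))"
    unfolding S_def
    by (simp add: smult_add_right sum.distrib sum_distrib_left smult_monom smult_sum_right mult.commute)
  have y1: "y * v = 1 - z * p" using yz by simp
  have "smult y (monom v i + monom 1 (Suc i) * G + smult p E) =
      monom 1 i - smult p (monom z i) + H + smult p (smult y E)"
  proof -
    have "smult y (monom v i) = monom 1 i - smult p (monom z i)"
      using y1 by (simp add: smult_monom diff_monom mult.commute)
    then show ?thesis by (simp add: smult_add_right H_def mult.commute)
  qed
  then have eq: "smult y (monom v i + monom 1 (Suc i) * G + smult p E) - S =
     monom 1 i + monom 1 (Suc l) * (H' - (\<Sum>j\<in>{i<..l}. smult (coeff H j) (Q' j)))
      + smult p (smult y E - monom z i - (\<Sum>j\<in>{i<..l}. smult (coeff H j) (E' j)))"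
    using H' unfolding Hs S1 by (simp add: algebra_simps smult_diff_right smult_add_right)
  have "smult y (monom v i + monom 1 (Suc i) * G + smult p E) - S \<in> W"
    by (intro diff_closed smult_closed m SW)
  then show ?case unfolding eq by blast
qed

text \<open>Nakayama: the error \<open>p^e E\<close> is removed by \<open>p^e\<close> times solutions modulo \<open>p\<close>, at the cost of an error
  \<open>p^(e+1)\<close>.\<close>
lemma nakayama_lift:
  fixes p :: int
  assumes base: "\<And>i. 1 \<le> i \<Longrightarrow> i \<le> l \<Longrightarrow> \<exists>Q E. monom 1 i + monom 1 (Suc l) * Q + smult p E \<in> W"
    and "1 \<le> i" "i \<le> l"
  shows "\<exists>Q E. monom 1 i + monom 1 (Suc l) * Q + smult (p ^ e) E \<in> W"
proof (induction e)
  case 0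
  have "monom 1 i + monom 1 (Suc l) * 0 + smult (p ^ 0) (- monom 1 i) \<in> W"
    using zero_mem by simp
  then show ?case by blast
next
  case (Suc e)
  then obtain Q E where QE: "monom 1 i + monom 1 (Suc l) * Q + smult (p ^ e) E \<in> W" by blast
  obtain E' where E': "E = (\<Sum>j\<le>l. monom (coeff E j) j) + monom 1 (Suc l) * E'"
    using poly_split_low by blast
  \<comment> \<open>The base case covers degrees from 1 on; the constant term of the error is
    removed by \<open>const_mem\<close>.\<close>
  have split: "(\<Sum>j\<le>l. monom (coeff E j) j) = [:coeff E 0:] + (\<Sum>j\<in>{1..l}. monom (coeff E j) j)"
    by (simp add: atMost_atLeast0 sum.atLeast_Suc_atMost monom_0)
  obtain Q1 E1 where QE1: "\<And>j. j \<in> {1..l} \<Longrightarrow> monom 1 j + monom 1 (Suc l) * Q1 j + smult p (E1 j) \<in> W"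
    using base by (metis atLeastAtMost_iff)
  define S where "S = (\<Sum>j\<in>{1..l}. smult (coeff E j) (monom 1 j + monom 1 (Suc l) * Q1 j + smult p (E1 j)))"
  have SW: "S \<in> W"
    unfolding S_def by (intro sum_closed smult_closed QE1)
  have S1: "S = (\<Sum>j\<in>{1..l}. monom (coeff E j) j) + monom 1 (Suc l) * (\<Sum>j\<in>{1..l}. smult (coeff E j) (Q1 j))
      + smult p (\<Sum>j\<in>{1..l}. smult (coeff E j) (E1 j))"
    unfolding S_def
    by (simp add: smult_add_right sum.distrib sum_distrib_left smult_monom smult_sum_right mult.commute)
  have ES: "E - [:coeff E 0:] - S = monom 1 (Suc l) * (E' - (\<Sum>j\<in>{1..l}. smult (coeff E j) (Q1 j)))
      - smult p (\<Sum>j\<in>{1..l}. smult (coeff E j) (E1 j))" 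
  proof -
    have "E = [:coeff E 0:] + (\<Sum>j\<in>{1..l}. monom (coeff E j) j) + monom 1 (Suc l) * E'"
      using E' unfolding split .
    then have "E - [:coeff E 0:] - S =
        [:coeff E 0:] + (\<Sum>j\<in>{1..l}. monom (coeff E j) j) + monom 1 (Suc l) * E' - [:coeff E 0:] - S"
      by (rule arg_cong)
    also have "\<dots> = (\<Sum>j\<in>{1..l}. monom (coeff E j) j) + monom 1 (Suc l) * E' - S"
      by (simp only: add_diff_cancel_left' add.assoc)
    finally show ?thesis unfolding S1 by (simp only: algebra_simps)
  qed
  have "monom 1 i + monom 1 (Suc l) * Q + smult (p ^ e) E - smult (p ^ e) ([:coeff E 0:] + S) =
      monom 1 i + monom 1 (Suc l) * Q + smult (p ^ e) (E - [:coeff E 0:] - S)"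
    by (simp add: smult_diff_right smult_add_right algebra_simps)
  also have "\<dots> = monom 1 i + monom 1 (Suc l) * (Q + smult (p ^ e) (E' - (\<Sum>j\<in>{1..l}. smult (coeff E j) (Q1 j))))
      + smult (p ^ Suc e) (- (\<Sum>j\<in>{1..l}. smult (coeff E j) (E1 j)))"
    unfolding ES by (simp add: smult_diff_right smult_add_right algebra_simps)
  finally have eq: "monom 1 i + monom 1 (Suc l) * Q + smult (p ^ e) E - smult (p ^ e) ([:coeff E 0:] + S) = \<dots>" .
  have "monom 1 i + monom 1 (Suc l) * Q + smult (p ^ e) E - smult (p ^ e) ([:coeff E 0:] + S) \<in> W"
    by (intro diff_closed smult_closed add_closed QE SW const_mem)
  then show ?case unfolding eq by blast
qed

end

text \<open>The combination is the antiderivative of \<open>k! t^(k-l) (t-\<tau>)^(i-1)\<close>, recentred at \<open>\<tau>\<close>.  It replaces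
  the computation of the Wronskian of \<open>t^(k-l+1), \<dots>, t^k\<close>.\<close>
lemma recentred_antiderivative:
  fixes p \<tau> :: int
  assumes p: "prime p" "int k < p" and \<tau>: "\<not> p dvd \<tau>" and l: "l \<le> k" and i: "1 \<le> i" "i \<le> l"
  shows "\<exists>c v e G. coprime v p \<and>
    (\<Sum>j\<in>{k-l+1..k}. smult (c j) ([:\<tau>, 1:] ^ j)) = [:e:] + monom v i + monom 1 (Suc i) * G"
proof -
  \<comment> \<open>\<open>q\<close> has no terms outside the degrees \<open>k-l\<close> to
    \<open>k-1\<close>, so its antiderivative without constant term uses only the powers
    \<open>k-l+1\<close> to \<open>k\<close>.\<close>
  define q :: "int poly" where "q = monom 1 (k - l) * [:- \<tau>, 1:] ^ (i - 1)"
  have degq: "degree q \<le> k - 1"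
  proof -
    have "degree q \<le> degree (monom (1::int) (k - l)) + degree ([:- \<tau>, 1:] ^ (i - 1))"
      unfolding q_def by (rule degree_mult_le)
    also have "\<dots> \<le> (k - l) + (i - 1)"
      by (simp add: degree_monom_eq degree_linear_power)
    also have "\<dots> \<le> k - 1" using i l by linarith
    finally show ?thesis .
  qed
  \<comment> \<open>Integration divides the coefficient of \<open>t^(j-1)\<close> by
    \<open>j\<close>. As \<open>j <= k\<close>, the factor \<open>k!\<close> keeps this integral,
    and \<open>k < p\<close> makes that factor a unit modulo \<open>p\<close>.\<close>
  define c where "c j = (fact k div int j) * coeff q (j - 1)" for j
  define f where "f = (\<Sum>j\<in>{k-l+1..k}. monom (c j) j)"
  have coef: "coeff f j = (if j \<in> {k-l+1..k} then c j else 0)" for j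
    unfolding f_def by (simp add: coeff_sum)
  have cj: "int j * c j = fact k * coeff q (j - 1)" if "j \<in> {k-l+1..k}" for j
  proof -
    have "j dvd fact k" using that by (intro dvd_fact) auto
    then have "int j dvd fact k" by (metis int_dvd_int_iff of_nat_fact)
    then show ?thesis unfolding c_def by simp
  qed
  have der: "pderiv f = smult (fact k) q"
  proof (rule poly_eqI)
    fix n
    show "coeff (pderiv f) n = coeff (smult (fact k) q) n"
    proof (cases "Suc n \<in> {k-l+1..k}")
      case True
      then show ?thesis using cj[of "Suc n"] coef by (simp add: coeff_pderiv)
    next
      case False
      have "coeff q n = 0"
      proof (cases "n < k - l")
        case True
        then show ?thesis by (simp add: q_def coeff_monom_mult)
      next
        case F: False
        then have "n > k - 1" using False i l by auto
        then show ?thesis using degq coeff_eq_0[of q n] by linarith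
      qed
      then show ?thesis using False coef by (auto simp add: coeff_pderiv)
    qed
  qed
  define g where "g = pcompose f [:\<tau>, 1:]"
  have g1: "g = (\<Sum>j\<in>{k-l+1..k}. smult (c j) ([:\<tau>, 1:] ^ j))"
    unfolding g_def f_def
    by (simp add: pcompose_sum monom_altdef pcompose_smult pcompose_power pcompose_pCons)
  have "pderiv g = pcompose (pderiv f) [:\<tau>, 1:]"
    unfolding g_def by (simp add: pderiv_pcompose pderiv_pCons)
  also have "\<dots> = smult (fact k) ([:\<tau>, 1:] ^ (k - l) * monom 1 (i - 1))"
    unfolding der q_def
    by (simp add: pcompose_smult pcompose_mult pcompose_power monom_altdef pcompose_pCons)
  finally have dg: "pderiv g = smult (fact k) ([:\<tau>, 1:] ^ (k - l) * monom 1 (i - 1))" .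
  have cg: "int (Suc n) * coeff g (Suc n) = fact k * (if n < i - 1 then 0 else coeff ([:\<tau>, 1:] ^ (k - l)) (n - (i - 1)))" for n
    using arg_cong[OF dg, of "\<lambda>h. coeff h n"] by (simp add: coeff_pderiv coeff_monom_mult mult.commute[of _ "monom _ _"])
  \<comment> \<open>\<open>pderiv g\<close> is divisible by \<open>t^(i-1)\<close>, so
    \<open>g\<close> starts in degree \<open>i\<close> apart from its constant term, which becomes
    \<open>e\<close>.\<close>
  have gz: "coeff g j = 0" if "1 \<le> j" "j < i" for j
    using cg[of "j - 1"] that by (simp split: if_splits)
  have "int i * coeff g i = fact k * \<tau> ^ (k - l)"
    using cg[of "i - 1"] i by (simp add: coeff_0_power)
  moreover have "coprime (fact k * \<tau> ^ (k - l)) p"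
  proof -
    have "coprime p (fact k)"
      using p by (intro prime_imp_coprime not_dvd_fact)
    moreover have "coprime p (\<tau> ^ (k - l))"
      using prime_imp_coprime[OF p(1) \<tau>] by (simp add: coprime_power_right_iff)
    ultimately show ?thesis by (simp add: coprime_commute)
  qed
  ultimately have cop: "coprime (coeff g i) p"
    by (metis coprime_mult_left_iff)
  obtain G where G: "g = (\<Sum>j\<le>i. monom (coeff g j) j) + monom 1 (Suc i) * G"
    using poly_split_low by blast
  have "(\<Sum>j\<le>i. monom (coeff g j) j) = [:coeff g 0:] + monom (coeff g i) i"
  proof -
    have "coeff g j = 0" if "j \<in> {..i} - {0, i}" for j
      using gz[of j] that by auto
    then have "(\<Sum>j\<le>i. monom (coeff g j) j) = (\<Sum>j\<in>{0,i}. monom (coeff g j) j)"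
      by (intro sum.mono_neutral_right) auto
    then show ?thesis using i by (simp add: monom_0)
  qed
  then have "(\<Sum>j\<in>{k-l+1..k}. smult (c j) ([:\<tau>, 1:] ^ j)) = [:coeff g 0:] + monom (coeff g i) i + monom 1 (Suc i) * G"
    using G g1 by simp
  then show ?thesis using cop by blast
qed

text \<open>In the application \<tau> is the difference of the two centres, so
  \<open>[:\<tau>, 1:] ^ j\<close> is the \<open>j\<close>-th power around \<open>eta\<close>
  written around \<open>xi\<close>. The top \<open>l\<close> powers yield each of
  \<open>t, ..., t^l\<close> up to terms of order \<open>l + 1\<close>. Lifting leaves an error
  divisible by \<open>p^M\<close>, which \<open>pM\<close> disposes of.\<close>

lemma (in poly_module) nondegenerate_at_unit:
  fixes p \<tau> :: int
  assumes p: "prime p" "int k < p" and \<tau>: "\<not> p dvd \<tau>" and l: "l \<le> k"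
    and mem: "\<And>j. j \<in> {k-l+1..k} \<Longrightarrow> [:\<tau>, 1:] ^ j + smult p (E j) \<in> W"
    and pM: "\<And>f. smult (p ^ M) f \<in> W"
    and i: "1 \<le> i" "i \<le> l"
  shows "\<exists>Q. monom 1 i + monom 1 (Suc l) * Q \<in> W"
proof -
  have "\<exists>v G E. coprime v p \<and> monom v i + monom 1 (Suc i) * G + smult p E \<in> W"
    if i: "1 \<le> i" "i \<le> l" for i
  proof -
    obtain c v e G where v: "coprime v p" and
      eq: "(\<Sum>j\<in>{k-l+1..k}. smult (c j) ([:\<tau>, 1:] ^ j)) = [:e:] + monom v i + monom 1 (Suc i) * G"
      using recentred_antiderivative[OF p \<tau> l i] by metis
    have "(\<Sum>j\<in>{k-l+1..k}. smult (c j) ([:\<tau>, 1:] ^ j + smult p (E j))) - [:e:] \<in> W"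
      by (intro diff_closed sum_closed smult_closed mem const_mem)
    also have "(\<Sum>j\<in>{k-l+1..k}. smult (c j) ([:\<tau>, 1:] ^ j + smult p (E j))) - [:e:] =
       monom v i + monom 1 (Suc i) * G + smult p (\<Sum>j\<in>{k-l+1..k}. smult (c j) (E j))"
      using eq by (simp add: smult_add_right sum.distrib smult_sum_right mult.commute)
    finally show ?thesis using v by blast
  qed
  from nakayama_lift[OF triangular_elimination[OF this] i, where e = M]
  obtain Q E where "monom 1 i + monom 1 (Suc l) * Q + smult (p ^ M) E \<in> W" by blast
  then have "monom 1 i + monom 1 (Suc l) * Q + smult (p ^ M) E - smult (p ^ M) E \<in> W"
    using pM by (intro diff_closed)
  then show ?thesis by auto
qed

section \<open>Correlations and nondegenerate systems\<close>

definition class_sum :: "int set \<Rightarrow> (int \<Rightarrow> 'a \<Rightarrow> complex) \<Rightarrow> int \<Rightarrow> int \<Rightarrow> 'a \<Rightarrow> complex" where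
  "class_sum T F q \<xi> x = (\<Sum>n | n \<in> T \<and> q dvd n - \<xi>. F n x)"

definition correlation :: "'a set \<Rightarrow> ('a \<Rightarrow> real) \<Rightarrow> (int \<Rightarrow> 'a \<Rightarrow> complex) \<Rightarrow> int list \<Rightarrow> int list \<Rightarrow> complex" where
  "correlation \<Omega> w F ns ms =
     (\<Sum>x\<in>\<Omega>. of_real (w x) * (\<Prod>n\<leftarrow>ns. F n x) * cnj (\<Prod>m\<leftarrow>ms. F m x))"

text \<open>The vanishing of correlations plays the role of the Fourier support condition in decoupling theory.\<close>

definition congruences :: "'a set \<Rightarrow> ('a \<Rightarrow> real) \<Rightarrow> int set \<Rightarrow> (int \<Rightarrow> 'a \<Rightarrow> complex) \<Rightarrow> nat \<Rightarrow> int \<Rightarrow> (int \<Rightarrow> int) set" where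
  "congruences \<Omega> w T F r M = {\<phi>. \<forall>ns ms. length ns = r \<longrightarrow> length ms = r \<longrightarrow> set ns \<subseteq> T \<longrightarrow> set ms \<subseteq> T \<longrightarrow>
     correlation \<Omega> w F ns ms \<noteq> 0 \<longrightarrow> M dvd (\<Sum>n\<leftarrow>ns. \<phi> n) - (\<Sum>m\<leftarrow>ms. \<phi> m)}"

lemma congruencesI:
  assumes "\<And>ns ms. length ns = r \<Longrightarrow> length ms = r \<Longrightarrow> set ns \<subseteq> T \<Longrightarrow> set ms \<subseteq> T \<Longrightarrow>
     correlation \<Omega> w F ns ms \<noteq> 0 \<Longrightarrow> M dvd (\<Sum>n\<leftarrow>ns. \<phi> n) - (\<Sum>m\<leftarrow>ms. \<phi> m)"
  shows "\<phi> \<in> congruences \<Omega> w T F r M"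
  using assms unfolding congruences_def by blast

lemma congruencesD:
  assumes "\<phi> \<in> congruences \<Omega> w T F r M" "correlation \<Omega> w F ns ms \<noteq> 0"
    "length ns = r" "length ms = r" "set ns \<subseteq> T" "set ms \<subseteq> T"
  shows "M dvd (\<Sum>n\<leftarrow>ns. \<phi> n) - (\<Sum>m\<leftarrow>ms. \<phi> m)"
  using assms unfolding congruences_def by blast

definition triangular :: "nat \<Rightarrow> nat" where
  "triangular k = k * (k + 1) div 2"

text \<open>Up to an error of order \<open>k + 1\<close> divisible by \<open>p\<close>, the system looks like the moment curve of degree \<open>k\<close>
  at every centre \<open>\<xi>\<close>.  Unlike the exact moment curve, this class of systems is stable under both
  rescaling and passage to lower degree.\<close>

definition nondegenerate :: "int \<Rightarrow> nat \<Rightarrow> nat \<Rightarrow> 'a set \<Rightarrow> ('a \<Rightarrow> real) \<Rightarrow> int set \<Rightarrow> (int \<Rightarrow> 'a \<Rightarrow> complex) \<Rightarrow> bool" where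
  "nondegenerate p k A \<Omega> w T F \<longleftrightarrow> (\<forall>\<xi>. \<forall>i\<in>{1..k}. \<exists>R :: int poly.
     (\<lambda>n. (n - \<xi>) ^ i + p * (n - \<xi>) ^ (k + 1) * poly R (n - \<xi>)) \<in> congruences \<Omega> w T F (triangular k) (p ^ (k * A)))"

definition dilate :: "int \<Rightarrow> int \<Rightarrow> int set \<Rightarrow> int set" where
  "dilate q \<eta> T = {u. \<eta> + q * u \<in> T}"

lemma two_triangular: "2 * triangular k = k * (k + 1)"
  unfolding triangular_def by (cases "even k") auto

section \<open>Rescaling to a residue class\<close>

lemma finite_dilate: "q \<noteq> 0 \<Longrightarrow> finite T \<Longrightarrow> finite (dilate q \<eta> T)"
  unfolding dilate_def
  by (rule finite_subset[OF _ finite_vimageI[of T "\<lambda>u. \<eta> + q * u"]]) (auto simp: inj_on_def)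

lemma class_sum_dilate:
  assumes "q \<noteq> 0"
  shows "class_sum (dilate q \<eta> T) (\<lambda>u. F (\<eta> + q * u)) q' u0 x = class_sum T F (q * q') (\<eta> + q * u0) x"
  unfolding class_sum_def
proof (rule sum.reindex_bij_betw)
  have eq: "\<eta> + q * u - (\<eta> + q * u0) = q * (u - u0)" for u by (simp add: algebra_simps)
  show "bij_betw (\<lambda>u. \<eta> + q * u) {n \<in> dilate q \<eta> T. q' dvd n - u0} {n \<in> T. q * q' dvd n - (\<eta> + q * u0)}"
  proof (rule bij_betwI')
    fix y assume y: "y \<in> {n \<in> T. q * q' dvd n - (\<eta> + q * u0)}"
    then obtain t where t: "y - (\<eta> + q * u0) = q * q' * t" by (auto elim: dvdE)
    then have "y = \<eta> + q * (u0 + q' * t)" by (simp add: algebra_simps)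
    then show "\<exists>u\<in>{n \<in> dilate q \<eta> T. q' dvd n - u0}. y = \<eta> + q * u"
      using y by (intro bexI[of _ "u0 + q' * t"]) (auto simp: dilate_def)
  qed (use assms eq in \<open>auto simp: dilate_def\<close>)
qed

lemma correlation_dilate:
  "correlation \<Omega> w (\<lambda>u. F (\<eta> + q * u)) ns ms = correlation \<Omega> w F (map (\<lambda>u. \<eta> + q * u) ns) (map (\<lambda>u. \<eta> + q * u) ms)"
  unfolding correlation_def by (simp add: o_def)

lemma congruences_dilate:
  assumes "\<phi> \<in> congruences \<Omega> w T F r M"
  shows "(\<lambda>u. \<phi> (\<eta> + q * u)) \<in> congruences \<Omega> w (dilate q \<eta> T) (\<lambda>u. F (\<eta> + q * u)) r M"
proof (rule congruencesI)
  fix ns ms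
  assume *: "length ns = r" "length ms = r" "set ns \<subseteq> dilate q \<eta> T" "set ms \<subseteq> dilate q \<eta> T"
    "correlation \<Omega> w (\<lambda>u. F (\<eta> + q * u)) ns ms \<noteq> 0"
  let ?h = "\<lambda>u. \<eta> + q * u"
  have "M dvd sum_list (map \<phi> (map ?h ns)) - sum_list (map \<phi> (map ?h ms))"
    using * unfolding correlation_dilate by (intro congruencesD[OF assms]) (auto simp: dilate_def)
  then show "M dvd (\<Sum>u\<leftarrow>ns. \<phi> (\<eta> + q * u)) - (\<Sum>u\<leftarrow>ms. \<phi> (\<eta> + q * u))"
    by (simp add: o_def)
qed

lemma congruences_cancel:
  assumes "(\<lambda>u. c * \<psi> u) \<in> congruences \<Omega> w T F r M" "c * N dvd M" "c \<noteq> 0"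
  shows "\<psi> \<in> congruences \<Omega> w T F r N"
  
proof (rule congruencesI)
  fix ns ms
  assume *: "length ns = r" "length ms = r" "set ns \<subseteq> T" "set ms \<subseteq> T" "correlation \<Omega> w F ns ms \<noteq> 0"
  have "M dvd (\<Sum>u\<leftarrow>ns. c * \<psi> u) - (\<Sum>u\<leftarrow>ms. c * \<psi> u)"
    by (rule congruencesD[OF assms(1) *(5,1-4)])
  then have "M dvd c * ((\<Sum>u\<leftarrow>ns. \<psi> u) - (\<Sum>u\<leftarrow>ms. \<psi> u))"
    by (simp add: sum_list_const_mult right_diff_distrib)
  then have "c * N dvd c * ((\<Sum>u\<leftarrow>ns. \<psi> u) - (\<Sum>u\<leftarrow>ms. \<psi> u))"
    using assms(2) dvd_trans by blast
  then show "N dvd (\<Sum>u\<leftarrow>ns. \<psi> u) - (\<Sum>u\<leftarrow>ms. \<psi> u)"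
    using assms(3) by simp
qed

text \<open>With \<open>q = p^b\<close> the substitution multiplies the main term by
  \<open>q^i\<close> and the error by \<open>q^(k+1)\<close>; after cancelling \<open>q^i\<close>
  the error keeps at least one factor \<open>q\<close>. The coefficient \<open>c\<close> covers two
  uses: \<open>c = p\<close> when the degree stays, \<open>c = 1\<close> when it has just been
  lowered and \<open>q\<close> itself must supply the factor \<open>p\<close>. The modulus loses
  \<open>p^(b i)\<close>, at most \<open>p^(b k)\<close>.\<close>

lemma nondegenerate_rescale:
  fixes p :: int
  assumes p: "p > 0" and b: "b \<le> A" and i: "i \<le> k" and c: "p dvd c * p ^ b"
    and mem: "(\<lambda>n. (n - (\<eta> + p ^ b * u0)) ^ i + c * (n - (\<eta> + p ^ b * u0)) ^ (k + 1) * poly Q (n - (\<eta> + p ^ b * u0)))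
        \<in> congruences \<Omega> w T F r (p ^ (k * A))"
  shows "\<exists>R. (\<lambda>u. (u - u0) ^ i + p * (u - u0) ^ (k + 1) * poly R (u - u0))
        \<in> congruences \<Omega> w (dilate (p ^ b) \<eta> T) (\<lambda>u. F (\<eta> + p ^ b * u)) r (p ^ (k * (A - b)))"
proof -
  define q where "q = p ^ b"
  have "p dvd c * q * q ^ (k - i)" using c unfolding q_def by (rule dvd_mult2)
  then obtain e where e: "c * q ^ (k + 1 - i) = p * e"
    using i by (auto simp: Suc_diff_le mult.assoc elim!: dvdE)
  define R where "R = smult e (pcompose Q [:0, q:])"
  have key: "(q * v) ^ i + c * (q * v) ^ (k + 1) * poly Q (q * v) = q ^ i * (v ^ i + p * v ^ (k + 1) * poly R v)" for v
  proof -
    have "q ^ (k + 1) = q ^ i * q ^ (k + 1 - i)" using i by (simp flip: power_add)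
    then have "c * (q * v) ^ (k + 1) = q ^ i * (c * q ^ (k + 1 - i)) * v ^ (k + 1)"
      by (simp add: power_mult_distrib ac_simps)
    also have "\<dots> = q ^ i * p * e * v ^ (k + 1)" unfolding e by (simp add: ac_simps)
    finally have 1: "c * (q * v) ^ (k + 1) = q ^ i * p * e * v ^ (k + 1)" .
    show ?thesis unfolding 1 R_def
      by (simp add: poly_pcompose power_mult_distrib algebra_simps)
  qed
  have sub: "\<eta> + q * u - (\<eta> + q * u0) = q * (u - u0)" for u by (simp add: algebra_simps)
  have mem': "(\<lambda>u. q ^ i * ((u - u0) ^ i + p * (u - u0) ^ (k + 1) * poly R (u - u0)))
        \<in> congruences \<Omega> w (dilate q \<eta> T) (\<lambda>u. F (\<eta> + q * u)) r (p ^ (k * A))"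
    using congruences_dilate[OF mem[folded q_def], of \<eta> q] unfolding sub key .
  have dv: "q ^ i * p ^ (k * (A - b)) dvd p ^ (k * A)"
  proof -
    have "b * i + k * (A - b) \<le> b * k + k * (A - b)" using i by simp
    also have "\<dots> = k * A" using b by (simp add: diff_mult_distrib2 mult.commute)
    finally have "p ^ (b * i + k * (A - b)) dvd p ^ (k * A)" by (rule le_imp_power_dvd)
    then show ?thesis unfolding q_def power_add power_mult[of p b i] .
  qed
  have "q ^ i \<noteq> 0" using p unfolding q_def by simp
  from congruences_cancel[OF mem' dv this] show ?thesis unfolding q_def by blast
qed

lemma nondegenerate_dilate:
  assumes "p > 0" "b \<le> A" "nondegenerate p k A \<Omega> w T F"
  shows "nondegenerate p k (A - b) \<Omega> w (dilate (p ^ b) \<eta> T) (\<lambda>u. F (\<eta> + p ^ b * u))"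
  unfolding nondegenerate_def
proof (intro allI ballI)
  fix u0 i assume i: "i \<in> {1..k}"
  then obtain R where "(\<lambda>n. (n - (\<eta> + p ^ b * u0)) ^ i + p * (n - (\<eta> + p ^ b * u0)) ^ (k + 1) * poly R (n - (\<eta> + p ^ b * u0)))
        \<in> congruences \<Omega> w T F (triangular k) (p ^ (k * A))"
    using assms(3) unfolding nondegenerate_def by blast
  then show "\<exists>R. (\<lambda>u. (u - u0) ^ i + p * (u - u0) ^ (k + 1) * poly R (u - u0))
        \<in> congruences \<Omega> w (dilate (p ^ b) \<eta> T) (\<lambda>u. F (\<eta> + p ^ b * u)) (triangular k) (p ^ (k * (A - b)))"
    using assms i by (intro nondegenerate_rescale) auto
qed

section \<open>Absorbing one class into the weight\<close>

text \<open>Each factor \<open>|sum F_v|^2\<close> expands into a double sum that adds one frequency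
  of \<open>S\<close> to either list, so a nonvanishing correlation for the new weight forces a
  nonvanishing longer one for \<open>w\<close>.\<close>

lemma correlation_weight:
  assumes "finite S"
  shows "correlation \<Omega> (\<lambda>x. w x * cmod (\<Sum>v\<in>S. F v x) ^ (2 * t)) F ns ms \<noteq> 0 \<Longrightarrow>
    \<exists>vs us. length vs = t \<and> length us = t \<and> set vs \<subseteq> S \<and> set us \<subseteq> S \<and> correlation \<Omega> w F (vs @ ns) (us @ ms) \<noteq> 0"
proof (induction t arbitrary: ns ms)
  case 0
  then show ?case by simp
next
  case (Suc t)
  let ?w = "\<lambda>x. w x * cmod (\<Sum>v\<in>S. F v x) ^ (2 * t)"
  have sq: "complex_of_real (w x * cmod (\<Sum>v\<in>S. F v x) ^ (2 * Suc t)) =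
      complex_of_real (?w x) * (\<Sum>v\<in>S. \<Sum>u\<in>S. F v x * cnj (F u x))" for x
  proof -
    have "(\<Sum>v\<in>S. \<Sum>u\<in>S. F v x * cnj (F u x)) = complex_of_real ((cmod (\<Sum>v\<in>S. F v x))\<^sup>2)"
      by (simp only: complex_norm_square cnj_sum sum_product)
    then show ?thesis by (simp add: power2_eq_square mult.assoc)
  qed
  have "correlation \<Omega> (\<lambda>x. w x * cmod (\<Sum>v\<in>S. F v x) ^ (2 * Suc t)) F ns ms
      = (\<Sum>x\<in>\<Omega>. \<Sum>v\<in>S. \<Sum>u\<in>S. of_real (?w x) * (F v x * (\<Prod>n\<leftarrow>ns. F n x)) * cnj (F u x * (\<Prod>m\<leftarrow>ms. F m x)))"
    unfolding correlation_def
  proof (rule sum.cong[OF refl])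
    fix x
    show "complex_of_real (w x * cmod (\<Sum>v\<in>S. F v x) ^ (2 * Suc t)) * (\<Prod>n\<leftarrow>ns. F n x) * cnj (\<Prod>m\<leftarrow>ms. F m x) =
      (\<Sum>v\<in>S. \<Sum>u\<in>S. of_real (?w x) * (F v x * (\<Prod>n\<leftarrow>ns. F n x)) * cnj (F u x * (\<Prod>m\<leftarrow>ms. F m x)))"
      unfolding sq sum_distrib_left sum_distrib_right
      by (intro sum.cong refl) (simp only: complex_cnj_mult ac_simps)
  qed
  also have "\<dots> = (\<Sum>v\<in>S. \<Sum>u\<in>S. correlation \<Omega> ?w F (v # ns) (u # ms))"
    unfolding correlation_def list.map prod_list.Cons
    by (subst sum.swap) (intro sum.cong refl sum.swap)
  finally have "(\<Sum>v\<in>S. \<Sum>u\<in>S. correlation \<Omega> ?w F (v # ns) (u # ms)) \<noteq> 0" using Suc.prems by simp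
  then obtain v u where vu: "v \<in> S" "u \<in> S" "correlation \<Omega> ?w F (v # ns) (u # ms) \<noteq> 0"
    by (meson sum.neutral)
  from Suc.IH[OF vu(3)] obtain vs us where "length vs = t" "length us = t" "set vs \<subseteq> S" "set us \<subseteq> S"
    "correlation \<Omega> w F (vs @ v # ns) (us @ u # ms) \<noteq> 0" by blast
  then show ?case using vu
    by (intro exI[of _ "vs @ [v]"] exI[of _ "us @ [u]"]) auto
qed

text \<open>Frequencies in \<open>S\<close> contribute multiples of \<open>M\<close> and can be
  deleted from the congruence. With \<open>t = s(k) - s(l)\<close> and \<open>r = s(l)\<close>,
  lists of the length belonging to degree \<open>k\<close> turn into lists of the length belonging
  to degree \<open>l\<close>.\<close>

lemma congruences_weight:
  assumes \<phi>: "\<phi> \<in> congruences \<Omega> w T F (t + r) M'" and M: "M dvd M'"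
    and S: "finite S" "S \<subseteq> T" "\<And>v. v \<in> S \<Longrightarrow> M dvd \<phi> v"
  shows "\<phi> \<in> congruences \<Omega> (\<lambda>x. w x * cmod (\<Sum>v\<in>S. F v x) ^ (2 * t)) T F r M"
  
proof (rule congruencesI)
  fix ns ms
  assume *: "length ns = r" "length ms = r" "set ns \<subseteq> T" "set ms \<subseteq> T"
    "correlation \<Omega> (\<lambda>x. w x * cmod (\<Sum>v\<in>S. F v x) ^ (2 * t)) F ns ms \<noteq> 0"
  from correlation_weight[OF S(1) *(5)] obtain vs us where vu: "length vs = t" "length us = t" "set vs \<subseteq> S" "set us \<subseteq> S"
    "correlation \<Omega> w F (vs @ ns) (us @ ms) \<noteq> 0" by blast
  have "M' dvd sum_list (map \<phi> (vs @ ns)) - sum_list (map \<phi> (us @ ms))"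
    by (rule congruencesD[OF \<phi> vu(5)]) (use vu * S(2) in auto)
  then have 1: "M dvd sum_list (map \<phi> (vs @ ns)) - sum_list (map \<phi> (us @ ms))" using M dvd_trans by blast
  have 2: "M dvd sum_list (map \<phi> xs)" if "set xs \<subseteq> S" for xs
    using that S(3) by (induction xs) auto
  have "M dvd (sum_list (map \<phi> (vs @ ns)) - sum_list (map \<phi> (us @ ms))) - (sum_list (map \<phi> vs) - sum_list (map \<phi> us))"
    by (intro dvd_diff[OF 1 dvd_diff[OF 2 2]]) (use vu in auto)
  then show "M dvd (\<Sum>n\<leftarrow>ns. \<phi> n) - (\<Sum>m\<leftarrow>ms. \<phi> m)"
    by (simp add: algebra_simps)
qed

lemma poly_module_congruences: "poly_module {f. (\<lambda>n. poly f (n - \<xi>)) \<in> congruences \<Omega> w T F r M}"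
proof
  fix f g c
  assume "f \<in> {f. (\<lambda>n. poly f (n - \<xi>)) \<in> congruences \<Omega> w T F r M}"
  then have f: "(\<lambda>n. poly f (n - \<xi>)) \<in> congruences \<Omega> w T F r M" by simp
  { assume "g \<in> {f. (\<lambda>n. poly f (n - \<xi>)) \<in> congruences \<Omega> w T F r M}"
    then have g: "(\<lambda>n. poly g (n - \<xi>)) \<in> congruences \<Omega> w T F r M" by simp
    have "(\<lambda>n. poly (f + g) (n - \<xi>)) \<in> congruences \<Omega> w T F r M"
      
    proof (rule congruencesI)
      fix ns ms
      assume *: "length ns = r" "length ms = r" "set ns \<subseteq> T" "set ms \<subseteq> T" "correlation \<Omega> w F ns ms \<noteq> 0"
      have "M dvd ((\<Sum>n\<leftarrow>ns. poly f (n - \<xi>)) - (\<Sum>m\<leftarrow>ms. poly f (m - \<xi>))) + ((\<Sum>n\<leftarrow>ns. poly g (n - \<xi>)) - (\<Sum>m\<leftarrow>ms. poly g (m - \<xi>)))"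
        by (intro dvd_add congruencesD[OF f *(5,1-4)] congruencesD[OF g *(5,1-4)])
      then show "M dvd (\<Sum>n\<leftarrow>ns. poly (f + g) (n - \<xi>)) - (\<Sum>m\<leftarrow>ms. poly (f + g) (m - \<xi>))"
        by (simp add: sum_list_addf algebra_simps)
    qed
    then show "f + g \<in> {f. (\<lambda>n. poly f (n - \<xi>)) \<in> congruences \<Omega> w T F r M}" by simp }
  have "(\<lambda>n. poly (smult c f) (n - \<xi>)) \<in> congruences \<Omega> w T F r M"
    
  proof (rule congruencesI)
    fix ns ms
    assume *: "length ns = r" "length ms = r" "set ns \<subseteq> T" "set ms \<subseteq> T" "correlation \<Omega> w F ns ms \<noteq> 0"
    have "M dvd c * ((\<Sum>n\<leftarrow>ns. poly f (n - \<xi>)) - (\<Sum>m\<leftarrow>ms. poly f (m - \<xi>)))"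
      by (intro dvd_mult congruencesD[OF f *(5,1-4)])
    then show "M dvd (\<Sum>n\<leftarrow>ns. poly (smult c f) (n - \<xi>)) - (\<Sum>m\<leftarrow>ms. poly (smult c f) (m - \<xi>))"
      by (simp add: sum_list_const_mult algebra_simps)
  qed
  then show "smult c f \<in> {f. (\<lambda>n. poly f (n - \<xi>)) \<in> congruences \<Omega> w T F r M}" by simp
next
  fix c :: int
  show "[:c:] \<in> {f. (\<lambda>n. poly f (n - \<xi>)) \<in> congruences \<Omega> w T F r M}"
    by (simp add: congruences_def sum_list_triv)
qed

text \<open>If \<open>v\<close> is close to \<open>\<eta>\<close> then the powers \<open>(v - \<eta>)^j\<close> of high degree drop out, and what remains
  is a nondegenerate system of degree \<open>l\<close> in a class away from \<open>\<eta>\<close>.\<close>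
lemma nondegenerate_lower_degree:
  fixes p :: int
  assumes p: "prime p" "int k < p" and T: "finite T" and nd: "nondegenerate p k A \<Omega> w T F"
    and l: "1 \<le> l" "l \<le> k" and sep: "\<not> p dvd \<xi> - \<eta>"
    and a: "1 \<le> a" "a \<le> a'" "a' \<le> A" and b: "1 \<le> b" and lb: "l * a' = (k - l + 1) * b"
  shows "nondegenerate p l (a' - a) \<Omega> (\<lambda>x. w x * cmod (class_sum T F (p ^ b) \<eta> x) ^ (2 * (triangular k - triangular l)))
     (dilate (p ^ a) \<xi> T) (\<lambda>u. F (\<xi> + p ^ a * u))"
proof -
  define w' where "w' = (\<lambda>x. w x * cmod (class_sum T F (p ^ b) \<eta> x) ^ (2 * (triangular k - triangular l)))"
  \<comment> \<open>By \<open>lb\<close> this is \<open>(k-l+1) * b\<close>, the exponent of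
    \<open>p\<close> guaranteed in \<open>(v - eta)^(k-l+1)\<close>, the lowest power that is
    kept.\<close>
  define M where "M = l * a'"
  have triangular: "triangular l \<le> triangular k" unfolding triangular_def using l by (intro div_le_mono mult_le_mono) auto
  have "\<forall>j\<in>{1..k}. \<exists>R. (\<lambda>n. (n - \<eta>) ^ j + p * (n - \<eta>) ^ (k + 1) * poly R (n - \<eta>)) \<in> congruences \<Omega> w T F (triangular k) (p ^ (k * A))"
    using nd unfolding nondegenerate_def by blast
  from bchoice[OF this] obtain R where
    R: "\<forall>j\<in>{1..k}. (\<lambda>n. (n - \<eta>) ^ j + p * (n - \<eta>) ^ (k + 1) * poly (R j) (n - \<eta>)) \<in> congruences \<Omega> w T F (triangular k) (p ^ (k * A))"
    by blast
  have phi: "(\<lambda>n. (n - \<eta>) ^ j + p * (n - \<eta>) ^ (k + 1) * poly (R j) (n - \<eta>)) \<in> congruences \<Omega> w' T F (triangular l) (p ^ M)"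
    if j: "j \<in> {k-l+1..k}" for j
    unfolding w'_def class_sum_def
  proof (rule congruences_weight)
    show "(\<lambda>n. (n - \<eta>) ^ j + p * (n - \<eta>) ^ (k + 1) * poly (R j) (n - \<eta>)) \<in> congruences \<Omega> w T F (triangular k - triangular l + triangular l) (p ^ (k * A))"
      using bspec[OF R, of j] j l triangular by simp
    show "p ^ M dvd p ^ (k * A)"
      unfolding M_def using l a by (intro le_imp_power_dvd mult_le_mono) auto
    fix v assume "v \<in> {n \<in> T. p ^ b dvd n - \<eta>}"
    then have v: "p ^ b dvd v - \<eta>" by simp
    have "M \<le> b * j"
      unfolding M_def lb using j by (subst mult.commute) (intro mult_le_mono, auto)
    then have "p ^ M dvd (p ^ b) ^ j"
      unfolding power_mult[symmetric] by (rule le_imp_power_dvd)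
    then have 1: "p ^ M dvd (v - \<eta>) ^ j" using dvd_power_same[OF v] by (rule dvd_trans)
    have "(v - \<eta>) ^ j dvd (v - \<eta>) ^ (k + 1)" using j by (intro le_imp_power_dvd) auto
    with 1 have "p ^ M dvd (v - \<eta>) ^ (k + 1)" by (rule dvd_trans)
    then show "p ^ M dvd (v - \<eta>) ^ j + p * (v - \<eta>) ^ (k + 1) * poly (R j) (v - \<eta>)"
      using 1 by (intro dvd_add dvd_mult2[OF dvd_mult])
  qed (use T in auto)
  have "\<exists>Ra. (\<lambda>u. (u - u0) ^ i + p * (u - u0) ^ (l + 1) * poly Ra (u - u0))
        \<in> congruences \<Omega> w' (dilate (p ^ a) \<xi> T) (\<lambda>u. F (\<xi> + p ^ a * u)) (triangular l) (p ^ (l * (a' - a)))"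
    if i: "i \<in> {1..l}" for u0 i
  proof -
    define \<xi>' where "\<xi>' = \<xi> + p ^ a * u0"
    define \<tau> where "\<tau> = \<xi>' - \<eta>"
    have \<tau>: "\<not> p dvd \<tau>"
    proof
      assume "p dvd \<tau>"
      moreover have "p dvd p ^ a * u0" using a by (simp add: dvd_power dvd_mult2)
      ultimately have "p dvd \<tau> - p ^ a * u0" by (rule dvd_diff)
      then show False using sep unfolding \<tau>_def \<xi>'_def by simp
    qed
    \<comment> \<open>Polynomials are now centred at \<open>\<xi>'\<close>, whose difference \<tau>
      from \<open>eta\<close> is a unit modulo \<open>p\<close>.\<close>
    interpret W: poly_module "{f. (\<lambda>n. poly f (n - \<xi>')) \<in> congruences \<Omega> w' T F (triangular l) (p ^ M)}"
      by (rule poly_module_congruences)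
    have "\<exists>Q. monom 1 i + monom 1 (Suc l) * Q \<in> {f. (\<lambda>n. poly f (n - \<xi>')) \<in> congruences \<Omega> w' T F (triangular l) (p ^ M)}"
    proof (rule W.nondegenerate_at_unit[OF p \<tau> l(2)])
      fix j assume j: "j \<in> {k-l+1..k}"
      have lin: "poly [:\<tau>, 1:] (n - \<xi>') = n - \<eta>" for n unfolding \<tau>_def by simp
      then show "[:\<tau>, 1:] ^ j + smult p ([:\<tau>, 1:] ^ (k + 1) * pcompose (R j) [:\<tau>, 1:]) \<in> {f. (\<lambda>n. poly f (n - \<xi>')) \<in> congruences \<Omega> w' T F (triangular l) (p ^ M)}"
        using phi[OF j]
        unfolding mem_Collect_eq poly_add poly_smult poly_mult poly_power poly_pcompose lin by (simp only: mult.assoc)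
    next
      fix f :: "int poly"
      have "p ^ M dvd (\<Sum>n\<leftarrow>ns. p ^ M * g n) - (\<Sum>n\<leftarrow>ms. p ^ M * g n)" for ns ms :: "int list" and g
        by (simp add: sum_list_const_mult)
      then show "smult (p ^ M) f \<in> {f. (\<lambda>n. poly f (n - \<xi>')) \<in> congruences \<Omega> w' T F (triangular l) (p ^ M)}"
        unfolding mem_Collect_eq poly_smult by (rule congruencesI)
    qed (use i in auto)
    then obtain Q where Q: "(\<lambda>n. poly (monom 1 i + monom 1 (Suc l) * Q) (n - \<xi>')) \<in> congruences \<Omega> w' T F (triangular l) (p ^ M)"
      by blast
    \<comment> \<open>The error has coefficient 1 here; the factor \<open>p\<close> that
      nondegeneracy demands comes from rescaling by \<open>p^a\<close> with
      \<open>a >= 1\<close>.\<close>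
    show ?thesis
    proof (rule nondegenerate_rescale)
      show "(\<lambda>n. (n - (\<xi> + p ^ a * u0)) ^ i + 1 * (n - (\<xi> + p ^ a * u0)) ^ (l + 1) * poly Q (n - (\<xi> + p ^ a * u0)))
        \<in> congruences \<Omega> w' T F (triangular l) (p ^ (l * a'))"
        using Q unfolding M_def \<xi>'_def by (simp add: poly_monom)
      show "p dvd 1 * p ^ a" using a by (simp add: dvd_power)
      show "0 < p" using p(1) by (simp add: prime_gt_0_int)
    qed (use a i in auto)
  qed
  then show ?thesis unfolding nondegenerate_def w'_def by blast
qed

section \<open>Bilinear moments\<close>

text \<open>Young's inequality pointwise, after division by \<open>P\<close> and \<open>Q\<close>.
  These bounds, not the sums themselves, are positive, so vanishing sums are no special case. The
  relation \<open>eq\<close> expresses \<open>Z = X^(u/r) Y^(1-u/r)\<close> by integer powers, the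
  form in which moments arise.\<close>

lemma weighted_holder:
  fixes w X Y Z :: "'a \<Rightarrow> real"
  assumes w: "\<And>x. x \<in> \<Omega> \<Longrightarrow> 0 \<le> w x"
    and nn: "\<And>x. x \<in> \<Omega> \<Longrightarrow> 0 \<le> X x" "\<And>x. x \<in> \<Omega> \<Longrightarrow> 0 \<le> Y x" "\<And>x. x \<in> \<Omega> \<Longrightarrow> 0 \<le> Z x"
    and eq: "\<And>x. x \<in> \<Omega> \<Longrightarrow> Z x ^ r = X x ^ u * Y x ^ (r - u)"
    and u: "0 < u" "u < r"
    and P: "(\<Sum>x\<in>\<Omega>. w x * X x) \<le> P" "0 < P" and Q: "(\<Sum>x\<in>\<Omega>. w x * Y x) \<le> Q" "0 < Q"
  shows "(\<Sum>x\<in>\<Omega>. w x * Z x) \<le> P powr (real u / real r) * Q powr (1 - real u / real r)"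
proof -
  define \<alpha> where "\<alpha> = real u / real r"
  have \<alpha>: "0 < \<alpha>" "\<alpha> < 1" using u by (auto simp: \<alpha>_def field_simps)
  define K where "K = P powr \<alpha> * Q powr (1 - \<alpha>)"
  have K: "0 < K" using P Q by (simp add: K_def)
  have pt: "Z x \<le> K * (\<alpha> / P * X x + (1 - \<alpha>) / Q * Y x)" if x: "x \<in> \<Omega>" for x
  proof (cases "X x = 0 \<or> Y x = 0")
    case True
    then have "Z x ^ r = 0" using eq[OF x] u by auto
    then have "Z x = 0" by simp
    then show ?thesis using nn[OF x] \<alpha> K P Q by (auto intro!: mult_nonneg_nonneg add_nonneg_nonneg)
  next
    case False
    then have X: "X x > 0" and Y: "Y x > 0" using nn[OF x] by auto
    have "Z x ^ r > 0" unfolding eq[OF x] using X Y by simp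
    then have Z: "Z x > 0" using nn(3)[OF x] u by (cases "Z x = 0") (auto simp: zero_power)
    have "real r * ln (Z x) = real u * ln (X x) + (real r - real u) * ln (Y x)"
      using arg_cong[OF eq[OF x], of ln] X Y Z u by (simp add: ln_mult ln_realpow of_nat_diff)
    then have "ln (Z x) = \<alpha> * ln (X x) + (1 - \<alpha>) * ln (Y x)"
      using u by (simp add: \<alpha>_def field_simps)
    then have "exp (ln (Z x)) = X x powr \<alpha> * Y x powr (1 - \<alpha>)"
      using X Y by (simp add: powr_def flip: exp_add)
    then have "Z x = X x powr \<alpha> * Y x powr (1 - \<alpha>)" using Z by simp
    also have "\<dots> = K * ((X x / P) powr \<alpha> * (Y x / Q) powr (1 - \<alpha>))"
      unfolding K_def using X Y P Q by (simp add: powr_divide field_simps)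
    also have "\<dots> \<le> K * (\<alpha> * (X x / P) + (1 - \<alpha>) * (Y x / Q))"
      using \<alpha> X Y P Q K by (intro mult_left_mono Youngs_inequality_0) auto
    finally show ?thesis by simp
  qed
  have "(\<Sum>x\<in>\<Omega>. w x * Z x) \<le> (\<Sum>x\<in>\<Omega>. w x * (K * (\<alpha> / P * X x + (1 - \<alpha>) / Q * Y x)))"
    by (intro sum_mono mult_left_mono pt w)
  also have "\<dots> = K * (\<alpha> / P * (\<Sum>x\<in>\<Omega>. w x * X x) + (1 - \<alpha>) / Q * (\<Sum>x\<in>\<Omega>. w x * Y x))"
    by (simp add: sum_distrib_left sum.distrib distrib_left ac_simps)
  also have "\<dots> \<le> K * (\<alpha> / P * P + (1 - \<alpha>) / Q * Q)"
    using \<alpha> K P Q by (intro mult_left_mono add_mono) auto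
  also have "\<dots> = K" using P Q by simp
  finally show ?thesis unfolding K_def \<alpha>_def .
qed

lemma powr_interpolate:
  fixes C q m :: real
  assumes "0 < C" "0 < q" "0 < m"
  shows "(C * q powr e1 * m) powr \<alpha> * (C * q powr e2 * m) powr (1 - \<alpha>) = C * q powr (\<alpha> * e1 + (1 - \<alpha>) * e2) * m"
proof -
  have "C powr \<alpha> * C powr (1 - \<alpha>) = C" "m powr \<alpha> * m powr (1 - \<alpha>) = m"
    using assms by (simp_all flip: powr_add)
  moreover have "(C * q powr e1 * m) powr \<alpha> * (C * q powr e2 * m) powr (1 - \<alpha>) =
      (C powr \<alpha> * C powr (1 - \<alpha>)) * (q powr (e1 * \<alpha>) * q powr (e2 * (1 - \<alpha>))) * (m powr \<alpha> * m powr (1 - \<alpha>))"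
    using assms by (simp add: powr_mult powr_powr)
  ultimately show ?thesis by (simp add: ac_simps flip: powr_add)
qed

lemma norm_sum_power_le:
  fixes z :: "'b \<Rightarrow> complex"
  assumes "finite S" "S \<noteq> {}"
  shows "cmod (\<Sum>i\<in>S. z i) ^ q \<le> real (card S) ^ q * (\<Sum>i\<in>S. cmod (z i) ^ q)"
proof -
  define M where "M = Max ((\<lambda>i. cmod (z i)) ` S)"
  have "M \<in> (\<lambda>i. cmod (z i)) ` S" unfolding M_def using assms by (intro Max_in) auto
  then obtain j where j: "j \<in> S" "M = cmod (z j)" by auto
  have le: "cmod (z i) \<le> M" if "i \<in> S" for i unfolding M_def using assms that by (intro Max_ge) auto
  have "cmod (\<Sum>i\<in>S. z i) \<le> real (card S) * M"
    using norm_sum[of z S] sum_bounded_above[of S "\<lambda>i. cmod (z i)" M] le by fastforce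
  then have "cmod (\<Sum>i\<in>S. z i) ^ q \<le> (real (card S) * M) ^ q"
    by (intro power_mono) auto
  also have "\<dots> = real (card S) ^ q * cmod (z j) ^ q" by (simp add: power_mult_distrib j)
  also have "cmod (z j) ^ q \<le> (\<Sum>i\<in>S. cmod (z i) ^ q)"
    using assms j by (intro member_le_sum) auto
  finally show ?thesis by (simp add: mult_left_mono)
qed

text \<open>Let \<open>z j\<close> be the largest term. If all others are at most \<open>1/p\<close>
  of it, the whole sum is at most twice \<open>|z j|\<close>, which gives the constant
  \<open>4^s\<close>, free of \<open>p\<close>. Otherwise some other \<open>z i\<close> is
  comparable to \<open>z j\<close> up to a factor \<open>p\<close>, and the mixed product dominates
  at the price of a power of \<open>p\<close>.\<close>

lemma broad_narrow:
  fixes z :: "int \<Rightarrow> complex"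
  assumes p: "p \<ge> (1::int)" and u: "u \<le> s"
  shows "cmod (\<Sum>i\<in>{0..<p}. z i) ^ (2 * s) \<le> 4 ^ s * (\<Sum>i\<in>{0..<p}. cmod (z i) ^ (2 * s))
    + real_of_int p ^ (4 * s) * (\<Sum>i\<in>{0..<p}. \<Sum>j\<in>{0..<p}-{i}. cmod (z i) ^ (2 * u) * cmod (z j) ^ (2 * (s - u)))"
proof -
  define S where "S = {0..<p}"
  have S: "finite S" "S \<noteq> {}" "real (card S) = p" using p by (auto simp: S_def)
  define M where "M = Max ((\<lambda>i. cmod (z i)) ` S)"
  have "M \<in> (\<lambda>i. cmod (z i)) ` S" unfolding M_def using S by (intro Max_in) auto
  then obtain j where j: "j \<in> S" "M = cmod (z j)" by auto
  have le: "cmod (z i) \<le> cmod (z j)" if "i \<in> S" for i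
    unfolding j(2)[symmetric] unfolding M_def using S that by (intro Max_ge) auto
  let ?B = "\<Sum>i\<in>S. \<Sum>j\<in>S-{i}. cmod (z i) ^ (2 * u) * cmod (z j) ^ (2 * (s - u))"
  have B0: "?B \<ge> 0" by (intro sum_nonneg) auto
  have N0: "(\<Sum>i\<in>S. cmod (z i) ^ (2 * s)) \<ge> 0" by (intro sum_nonneg) auto
  show ?thesis unfolding S_def[symmetric]
  proof (cases "\<forall>i\<in>S-{j}. p * cmod (z i) \<le> cmod (z j)")
    case True
    have "cmod (\<Sum>i\<in>S. z i) \<le> cmod (z j) + cmod (\<Sum>i\<in>S-{j}. z i)"
      using S j by (subst sum.remove[of _ j]) (auto intro: norm_triangle_ineq)
    also have "cmod (\<Sum>i\<in>S-{j}. z i) \<le> (\<Sum>i\<in>S-{j}. cmod (z j) / p)"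
      using True p by (intro sum_norm_le) (auto simp: field_simps)
    also have "\<dots> = (p - 1) * (cmod (z j) / p)" using S j by (simp add: card_Diff_singleton of_nat_diff card_gt_0_iff Suc_leI)
    also have "\<dots> \<le> cmod (z j)" using p by (simp add: field_simps)
    finally have "cmod (\<Sum>i\<in>S. z i) \<le> 2 * cmod (z j)" by simp
    then have "cmod (\<Sum>i\<in>S. z i) ^ (2 * s) \<le> (2 * cmod (z j)) ^ (2 * s)" by (intro power_mono) auto
    also have "\<dots> = 4 ^ s * cmod (z j) ^ (2 * s)" by (simp add: power_mult_distrib power_mult)
    also have "\<dots> \<le> 4 ^ s * (\<Sum>i\<in>S. cmod (z i) ^ (2 * s))"
      using S j by (intro mult_left_mono member_le_sum) auto
    finally show "cmod (\<Sum>i\<in>S. z i) ^ (2 * s) \<le> 4 ^ s * (\<Sum>i\<in>S. cmod (z i) ^ (2 * s)) + real_of_int p ^ (4 * s) * ?B"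
      using B0 p by (smt (verit) mult_nonneg_nonneg zero_le_power of_int_nonneg)
  next
    case False
    then obtain i where "i \<in> S - {j}" "\<not> p * cmod (z i) \<le> cmod (z j)" by blast
    then have i: "i \<in> S" "i \<noteq> j" "cmod (z j) < p * cmod (z i)" by auto
    have "cmod (\<Sum>i\<in>S. z i) \<le> p * cmod (z j)"
      using norm_sum[of z S] sum_bounded_above[of S "\<lambda>i. cmod (z i)" "cmod (z j)"] le S by auto
    then have "cmod (\<Sum>i\<in>S. z i) ^ (2 * s) \<le> (p * cmod (z j)) ^ (2 * s)" by (intro power_mono) auto
    also have "\<dots> = real_of_int p ^ (2 * s) * (cmod (z j) ^ (2 * u) * cmod (z j) ^ (2 * (s - u)))"
    proof -
      have "2 * s = 2 * u + 2 * (s - u)" using u by simp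
      then show ?thesis by (metis power_add power_mult_distrib)
    qed
    also have "\<dots> \<le> real_of_int p ^ (2 * s) * ((p * cmod (z i)) ^ (2 * u) * cmod (z j) ^ (2 * (s - u)))"
      using i p by (intro mult_left_mono mult_right_mono power_mono) auto
    also have "\<dots> = real_of_int p ^ (2 * s + 2 * u) * (cmod (z i) ^ (2 * u) * cmod (z j) ^ (2 * (s - u)))"
      by (simp add: power_mult_distrib power_add)
    also have "\<dots> \<le> real_of_int p ^ (4 * s) * (cmod (z i) ^ (2 * u) * cmod (z j) ^ (2 * (s - u)))"
      using p u by (intro mult_right_mono power_increasing) auto
    also have "cmod (z i) ^ (2 * u) * cmod (z j) ^ (2 * (s - u)) \<le> (\<Sum>j\<in>S-{i}. cmod (z i) ^ (2 * u) * cmod (z j) ^ (2 * (s - u)))"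
      using S i j by (intro member_le_sum[where f = "\<lambda>j. cmod (z i) ^ (2 * u) * cmod (z j) ^ (2 * (s - u))"]) auto
    also have "\<dots> \<le> ?B"
      using S i by (intro member_le_sum[where f = "\<lambda>i. \<Sum>j\<in>S-{i}. cmod (z i) ^ (2 * u) * cmod (z j) ^ (2 * (s - u))"]) (auto intro: sum_nonneg)
    finally have "cmod (\<Sum>i\<in>S. z i) ^ (2 * s) \<le> real_of_int p ^ (4 * s) * ?B"
      using p by (simp add: mult_left_mono)
    then show "cmod (\<Sum>i\<in>S. z i) ^ (2 * s) \<le> 4 ^ s * (\<Sum>i\<in>S. cmod (z i) ^ (2 * s)) + real_of_int p ^ (4 * s) * ?B"
      using N0 by (smt (verit) mult_nonneg_nonneg zero_le_power)
  qed
qed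

lemma class_sum_one: "class_sum T F 1 \<xi> x = (\<Sum>n\<in>T. F n x)"
  unfolding class_sum_def by simp

lemma class_sum_split:
  assumes T: "finite T" and q: "0 < q" "0 < q'"
  shows "class_sum T F q \<xi> x = (\<Sum>u\<in>{0..<q'}. class_sum T F (q * q') (\<xi> + q * u) x)"
proof -
  have eq: "{n \<in> T. q dvd n - \<xi>} = (\<Union>u\<in>{0..<q'}. {n \<in> T. q * q' dvd n - (\<xi> + q * u)})" (is "?L = ?R")
  proof (intro equalityI subsetI)
    fix n assume n: "n \<in> ?L"
    then obtain t where t: "n - \<xi> = q * t" by (auto elim: dvdE)
    have "n - (\<xi> + q * (t mod q')) = q * (t - t mod q')" using t by (simp add: algebra_simps)
    also have "\<dots> = q * q' * (t div q')" by (simp add: minus_mod_eq_mult_div)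
    finally have "q * q' dvd n - (\<xi> + q * (t mod q'))" by simp
    then show "n \<in> ?R" using n q by (intro UN_I[of "t mod q'"]) auto
  next
    fix n assume "n \<in> ?R"
    then obtain u where u: "n \<in> T" "q * q' dvd n - (\<xi> + q * u)" by auto
    then have "q dvd n - (\<xi> + q * u)" by (rule_tac dvd_mult_left) auto
    then have "q dvd (n - (\<xi> + q * u)) + q * u" by (intro dvd_add) auto
    then show "n \<in> ?L" using u by (simp add: algebra_simps)
  qed
  show ?thesis unfolding class_sum_def eq
  proof (rule sum.UNION_disjoint)
    show "\<forall>i\<in>{0..<q'}. \<forall>j\<in>{0..<q'}. i \<noteq> j \<longrightarrow>
      {n \<in> T. q * q' dvd n - (\<xi> + q * i)} \<inter> {n \<in> T. q * q' dvd n - (\<xi> + q * j)} = {}"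
    proof (intro ballI impI equals0I)
      fix i j n assume ij: "i \<in> {0..<q'}" "j \<in> {0..<q'}" "i \<noteq> j"
        and "n \<in> {n \<in> T. q * q' dvd n - (\<xi> + q * i)} \<inter> {n \<in> T. q * q' dvd n - (\<xi> + q * j)}"
      then have n: "q * q' dvd n - (\<xi> + q * j)" "q * q' dvd n - (\<xi> + q * i)" by auto
      have "q * q' dvd (n - (\<xi> + q * j)) - (n - (\<xi> + q * i))" by (rule dvd_diff[OF n])
      also have "(n - (\<xi> + q * j)) - (n - (\<xi> + q * i)) = q * (i - j)" by (simp add: algebra_simps)
      finally have "q' dvd i - j" using q by simp
      then have "i mod q' = j mod q'" by (simp add: mod_eq_dvd_iff)
      then show False using ij by simp
    qed
  qed (use T in auto)
qed

section \<open>Decoupling inequalities and mixed moments\<close>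

text \<open>\<open>m\<close> bounds the moments of the finest classes and stands on the right-hand
  side of every later bound; its positivity allows Hoelder's inequality to be normalised.\<close>

definition admissible where
  "admissible p k A \<Omega> w T F m \<longleftrightarrow> finite \<Omega> \<and> finite T \<and> (\<forall>x\<in>\<Omega>. (0::real) \<le> w x) \<and> nondegenerate p k A \<Omega> w T F \<and> (0::real) < m \<and>
    (\<forall>\<xi>. (\<Sum>x\<in>\<Omega>. w x * cmod (class_sum T F (p ^ A) \<xi> x) ^ (2 * triangular k)) \<le> m)"

text \<open>A decoupling inequality with the supremum over the residue classes modulo \<open>p^A\<close> on the right-hand side
  instead of an \<open>\<ell>\<^sup>2\<close> sum.  The exponent \<open>\<kappa>\<close> is the loss over square root cancellation.\<close>

definition decoupling_bound :: "'a itself \<Rightarrow> int \<Rightarrow> nat \<Rightarrow> real \<Rightarrow> real \<Rightarrow> nat \<Rightarrow> bool" where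
  "decoupling_bound tp p k \<kappa> C A \<longleftrightarrow> (\<forall>(\<Omega> :: 'a set) w T F m. admissible p k A \<Omega> w T F m \<longrightarrow>
     (\<Sum>x\<in>\<Omega>. w x * cmod (\<Sum>n\<in>T. F n x) ^ (2 * triangular k)) \<le> C * real_of_int p powr ((\<kappa> + real (triangular k)) * real A) * m)"

text \<open>The constant is uniform in the number \<open>A\<close> of levels and in the system. The
  type token fixes the type of the points of \<Omega>; it stays the same when the degree is lowered,
  since then only \<open>w\<close>, \<open>T\<close> and \<open>F\<close> change.\<close>

definition decouples :: "'a itself \<Rightarrow> int \<Rightarrow> nat \<Rightarrow> real \<Rightarrow> bool" where
  "decouples tp p k \<kappa> \<longleftrightarrow> (\<exists>C>0. \<forall>A. decoupling_bound tp p k \<kappa> C A)"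

lemma admissible_dilate:
  assumes "p > 0" "b \<le> A" "admissible p k A \<Omega> w T F m"
  shows "admissible p k (A - b) \<Omega> w (dilate (p ^ b) \<eta> T) (\<lambda>u. F (\<eta> + p ^ b * u)) m"
proof -
  have "p ^ b * p ^ (A - b) = p ^ A" using assms by (simp flip: power_add)
  then show ?thesis using assms unfolding admissible_def
    by (auto simp: class_sum_dilate intro: nondegenerate_dilate finite_dilate)
qed

text \<open>Affine invariance: the class of \<open>eta\<close> modulo \<open>p^b\<close> is a full
  system with \<open>A - b\<close> levels and the same finest classes, hence the same
  \<open>m\<close>.\<close>

lemma decoupling_bound_class_sum:
  assumes dec: "decoupling_bound TYPE('a) p k \<kappa> C (A - b)" and p: "p > 0" and b: "b \<le> A"
    and adm: "admissible p k A (\<Omega> :: 'a set) w T F m"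
  shows "(\<Sum>x\<in>\<Omega>. w x * cmod (class_sum T F (p ^ b) \<eta> x) ^ (2 * triangular k)) \<le> C * p powr ((\<kappa> + real (triangular k)) * (real A - b)) * m"
proof -
  have "class_sum T F (p ^ b) \<eta> x = (\<Sum>u\<in>dilate (p ^ b) \<eta> T. F (\<eta> + p ^ b * u) x)" for x
    using class_sum_dilate[of "p ^ b" \<eta> T F 1 0 x] p by (simp add: class_sum_one)
  then show ?thesis
    using dec[unfolded decoupling_bound_def, rule_format, OF admissible_dilate[OF p b adm, of \<eta>]] b
    by (simp add: of_nat_diff)
qed

definition bilinear where
  "bilinear p k \<Omega> w T F l a b \<xi> \<eta> = (\<Sum>x\<in>\<Omega>. w x *
     (cmod (class_sum T F (p ^ a) \<xi> x) ^ (2 * triangular l) * cmod (class_sum T F (p ^ b) \<eta> x) ^ (2 * (triangular k - triangular l))))"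

text \<open>\<open>E\<close> is the exponent of \<open>p\<close> beyond square root cancellation in both factors.\<close>

definition bilinear_bound where
  "bilinear_bound p k A \<Omega> w T F m l a b E C \<longleftrightarrow> (\<forall>\<xi> \<eta>. \<not> p dvd \<xi> - \<eta> \<longrightarrow>
     bilinear p k \<Omega> w T F l a b \<xi> \<eta> \<le>
       C * real_of_int p powr (E + triangular l * (real A - a) + (real (triangular k) - triangular l) * (real A - b)) * m)"

lemma bilinear_bound_mono:
  assumes "bilinear_bound p k A \<Omega> w T F m l a b E C" "E \<le> E'" "C \<le> C'" "p \<ge> 1" "0 \<le> C" "0 \<le> m"
  shows "bilinear_bound p k A \<Omega> w T F m l a b E' C'"
  unfolding bilinear_bound_def
proof (intro allI impI)
  fix \<xi> \<eta> assume "\<not> p dvd \<xi> - \<eta>"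
  then have "bilinear p k \<Omega> w T F l a b \<xi> \<eta> \<le>
       C * real_of_int p powr (E + triangular l * (real A - a) + (real (triangular k) - triangular l) * (real A - b)) * m"
    using assms(1) unfolding bilinear_bound_def by blast
  also have "\<dots> \<le> C' * real_of_int p powr (E' + triangular l * (real A - a) + (real (triangular k) - triangular l) * (real A - b)) * m"
    using assms by (intro mult_right_mono mult_mono powr_mono) auto
  finally show "bilinear p k \<Omega> w T F l a b \<xi> \<eta> \<le> \<dots>" .
qed

lemma triangular_mono: "l \<le> k \<Longrightarrow> triangular l \<le> triangular k"
  unfolding triangular_def by (intro div_le_mono mult_le_mono) auto

lemma triangular_strict: "l < k \<Longrightarrow> triangular l < triangular k"
proof -
  assume "l < k"
  then have "l * (l + 1) < k * (k + 1)" by (intro mult_strict_mono) auto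
  then have "2 * triangular l < 2 * triangular k" unfolding two_triangular .
  then show ?thesis by simp
qed

lemma triangular_pos: "1 \<le> l \<Longrightarrow> 0 < triangular l"
  using triangular_strict[of 0 l] by (simp add: triangular_def)

text \<open>Hoelder's inequality with weight \<open>s(l)/s(k)\<close> between the full moments of
  the two classes. The saving \<open>\<kappa> (\<alpha> a + (1 - \<alpha>) b)\<close> is discarded:
  the iteration starts from gain 0.\<close>

lemma bilinear_bound_trivial:
  assumes dec: "\<And>A. decoupling_bound TYPE('a) p k \<kappa> C A" and p: "p > 1" and C: "C > 0"
    and adm: "admissible p k A (\<Omega> :: 'a set) w T F m" and \<kappa>: "0 \<le> \<kappa>"
    and ab: "a \<le> A" "b \<le> A" and l: "1 \<le> l" "l < k"
  shows "bilinear_bound p k A \<Omega> w T F m l a b (\<kappa> * A) C"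
  unfolding bilinear_bound_def
proof (intro allI impI)
  fix \<xi> \<eta>
  have w: "\<And>x. x \<in> \<Omega> \<Longrightarrow> 0 \<le> w x" and m: "m > 0" using adm unfolding admissible_def by auto
  define \<alpha> where "\<alpha> = real (triangular l) / real (triangular k)"
  have tl: "0 < triangular l" "triangular l < triangular k" using l triangular_pos triangular_strict by auto
  have \<alpha>: "0 \<le> \<alpha>" "\<alpha> \<le> 1" "\<alpha> * triangular k = triangular l" using tl by (auto simp: \<alpha>_def field_simps)
  have "bilinear p k \<Omega> w T F l a b \<xi> \<eta> \<le> (C * p powr ((\<kappa> + real (triangular k)) * (real A - a)) * m) powr \<alpha>
      * (C * p powr ((\<kappa> + real (triangular k)) * (real A - b)) * m) powr (1 - \<alpha>)"
    unfolding bilinear_def \<alpha>_def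
  proof (rule weighted_holder)
    show "(\<Sum>x\<in>\<Omega>. w x * cmod (class_sum T F (p ^ a) \<xi> x) ^ (2 * triangular k)) \<le> C * p powr ((\<kappa> + real (triangular k)) * (real A - a)) * m"
      using decoupling_bound_class_sum[OF dec _ ab(1) adm] p by simp
    show "(\<Sum>x\<in>\<Omega>. w x * cmod (class_sum T F (p ^ b) \<eta> x) ^ (2 * triangular k)) \<le> C * p powr ((\<kappa> + real (triangular k)) * (real A - b)) * m"
      using decoupling_bound_class_sum[OF dec _ ab(2) adm] p by simp
    fix x
    show "(cmod (class_sum T F (p ^ a) \<xi> x) ^ (2 * triangular l) * cmod (class_sum T F (p ^ b) \<eta> x) ^ (2 * (triangular k - triangular l))) ^ triangular k =
      (cmod (class_sum T F (p ^ a) \<xi> x) ^ (2 * triangular k)) ^ triangular l * (cmod (class_sum T F (p ^ b) \<eta> x) ^ (2 * triangular k)) ^ (triangular k - triangular l)"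
      by (simp add: power_mult_distrib ac_simps flip: power_mult)
  qed (use w m C p tl in auto)
  also have "\<dots> = C * p powr (\<alpha> * ((\<kappa> + real (triangular k)) * (real A - a)) + (1 - \<alpha>) * ((\<kappa> + real (triangular k)) * (real A - b))) * m"
    using C p m by (intro powr_interpolate) auto
  also have "\<alpha> * ((\<kappa> + real (triangular k)) * (real A - a)) + (1 - \<alpha>) * ((\<kappa> + real (triangular k)) * (real A - b))
     = (\<kappa> * A - \<kappa> * (\<alpha> * a + (1 - \<alpha>) * b)) + (\<alpha> * triangular k) * (real A - a) + (triangular k - \<alpha> * triangular k) * (real A - b)"
    by (simp add: algebra_simps)
  also have "C * p powr \<dots> * m \<le> C * p powr (\<kappa> * A + triangular l * (real A - a) + (real (triangular k) - triangular l) * (real A - b)) * m"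
  proof -
    have "0 \<le> \<kappa> * (\<alpha> * a + (1 - \<alpha>) * b)" using \<alpha> \<kappa> by simp
    then show ?thesis unfolding \<alpha>(3) using C p m by (intro mult_right_mono mult_left_mono powr_mono) auto
  qed
  finally show "bilinear p k \<Omega> w T F l a b \<xi> \<eta> \<le> C * p powr (\<kappa> * A + triangular l * (real A - a) + (real (triangular k) - triangular l) * (real A - b)) * m" .
qed

text \<open>For \<open>l = 0\<close> the class of \<open>xi\<close> enters with exponent 0, and the
  full moment of a system with \<open>A - b\<close> levels remains. The saving
  \<open>\<kappa> b\<close> made here is the source of all gain in the iteration.\<close>

lemma bilinear_bound_zero:
  assumes dec: "\<And>A. decoupling_bound TYPE('a) p k \<kappa> C A" and p: "p > 0"
    and adm: "admissible p k A (\<Omega> :: 'a set) w T F m" and b: "b \<le> A"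
  shows "bilinear_bound p k A \<Omega> w T F m 0 a b (\<kappa> * (real A - b)) C"
  unfolding bilinear_bound_def bilinear_def
  using decoupling_bound_class_sum[OF dec p b adm] by (simp add: triangular_def algebra_simps)

text \<open>Hoelder's inequality with weights \<open>1/r\<close> and \<open>1 - 1/r\<close>, where
  \<open>r = k - l + 1\<close>. In the first moment the classes exchange roles, so that the other
  class can be refined next; the second lowers \<open>l\<close> and leads towards
  \<open>l = 0\<close>.\<close>

lemma bilinear_bound_swap:
  assumes p: "p > 1" and C: "C > 0" and m: "m > 0" and w: "\<And>x. x \<in> \<Omega> \<Longrightarrow> 0 \<le> w x"
    and 1: "bilinear_bound p k A \<Omega> w T F m (k - l) b a E1 C" and 2: "bilinear_bound p k A \<Omega> w T F m (l - 1) a b E2 C"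
    and l: "1 \<le> l" "l < k"
  shows "bilinear_bound p k A \<Omega> w T F m l a b (E1 / real (k - l + 1) + (1 - 1 / real (k - l + 1)) * E2) C"
  unfolding bilinear_bound_def
proof (intro allI impI)
  fix \<xi> \<eta> assume sep: "\<not> p dvd \<xi> - \<eta>"
  then have sep': "\<not> p dvd \<eta> - \<xi>" by (simp add: dvd_diff_commute)
  define r where "r = k - l + 1"
  define \<alpha> where "\<alpha> = real 1 / real r"
  have r: "1 < r" using l by (simp add: r_def)
  have tl: "triangular (k - l) \<le> triangular k" "triangular (l - 1) \<le> triangular k" "triangular l \<le> triangular k" by (rule triangular_mono, use l in simp)+
  obtain j i where ji: "l = Suc j" "k = l + i" using l by (metis Suc_le_D One_nat_def less_imp_add_positive)
  have tr: "real (triangular n) = real n * (real n + 1) / 2" for n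
  proof -
    have "real (2 * triangular n) = real n * (real n + 1)" unfolding two_triangular by (simp add: algebra_simps)
    then show ?thesis by simp
  qed
  \<comment> \<open>The exponents of the class of \<open>xi\<close> match: \<open>s(l)\<close> is
    the mean of \<open>s(k) - s(k-l)\<close> and \<open>s(l-1)\<close> with these weights. For
    \<open>eta\<close> they match as well, since the two exponents always add up to
    \<open>s(k)\<close>.\<close>
  have e: "real r * triangular l = (real (triangular k) - triangular (k - l)) + (real r - 1) * triangular (l - 1)"
    unfolding tr r_def ji by (simp add: field_simps)
  have e1: "triangular l * r = (triangular k - triangular (k - l)) + triangular (l - 1) * (r - 1)"
  proof -
    have "real (triangular l * r) = real ((triangular k - triangular (k - l)) + triangular (l - 1) * (r - 1))"
      using e tl r by (simp add: of_nat_diff left_diff_distrib right_diff_distrib mult.commute)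
    then show ?thesis by (simp only: of_nat_eq_iff)
  qed
  have e2: "(triangular k - triangular l) * r = triangular (k - l) + (triangular k - triangular (l - 1)) * (r - 1)"
  proof -
    have "real ((triangular k - triangular l) * r) = real (triangular (k - l) + (triangular k - triangular (l - 1)) * (r - 1))"
      using e tl r by (simp add: of_nat_diff left_diff_distrib right_diff_distrib mult.commute)
    then show ?thesis by (simp only: of_nat_eq_iff)
  qed
  let ?f = "\<lambda>x. cmod (class_sum T F (p ^ a) \<xi> x)" and ?g = "\<lambda>x. cmod (class_sum T F (p ^ b) \<eta> x)"
  let ?P = "E1 + triangular (k - l) * (real A - b) + (real (triangular k) - triangular (k - l)) * (real A - a)"
  let ?Q = "E2 + triangular (l - 1) * (real A - a) + (real (triangular k) - triangular (l - 1)) * (real A - b)"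
  have "bilinear p k \<Omega> w T F l a b \<xi> \<eta> \<le> (C * p powr ?P * m) powr \<alpha> * (C * p powr ?Q * m) powr (1 - \<alpha>)"
    unfolding bilinear_def \<alpha>_def
  proof (rule weighted_holder)
    show "(\<Sum>x\<in>\<Omega>. w x * (?g x ^ (2 * triangular (k - l)) * ?f x ^ (2 * (triangular k - triangular (k - l))))) \<le> C * p powr ?P * m"
      using 1 sep' unfolding bilinear_bound_def bilinear_def by blast
    show "(\<Sum>x\<in>\<Omega>. w x * (?f x ^ (2 * triangular (l - 1)) * ?g x ^ (2 * (triangular k - triangular (l - 1))))) \<le> C * p powr ?Q * m"
      using 2 sep unfolding bilinear_bound_def bilinear_def by blast
    fix x
    have "(?f x ^ (2 * triangular l) * ?g x ^ (2 * (triangular k - triangular l))) ^ r = ?f x ^ (2 * (triangular l * r)) * ?g x ^ (2 * ((triangular k - triangular l) * r))"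
      by (simp add: power_mult_distrib mult.assoc flip: power_mult)
    also have "\<dots> = (?g x ^ (2 * triangular (k - l)) * ?f x ^ (2 * (triangular k - triangular (k - l)))) ^ 1 *
        (?f x ^ (2 * triangular (l - 1)) * ?g x ^ (2 * (triangular k - triangular (l - 1)))) ^ (r - 1)"
      unfolding e1 e2 by (simp add: power_mult_distrib power_add distrib_left mult.assoc flip: power_mult)
    finally show "(?f x ^ (2 * triangular l) * ?g x ^ (2 * (triangular k - triangular l))) ^ r = \<dots>" .
  qed (use w C p m r in auto)
  also have "\<dots> = C * p powr (\<alpha> * ?P + (1 - \<alpha>) * ?Q) * m"
    using C p m by (intro powr_interpolate) auto
  also have "\<alpha> * ?P + (1 - \<alpha>) * ?Q = (E1 / real r + (1 - 1 / real r) * E2) + triangular l * (real A - a) + (real (triangular k) - triangular l) * (real A - b)"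
  proof -
    have "real (triangular l) = \<alpha> * (real (triangular k) - triangular (k - l)) + (1 - \<alpha>) * triangular (l - 1)"
    proof -
      have "real (triangular l) = ((real (triangular k) - triangular (k - l)) + (real r - 1) * triangular (l - 1)) * \<alpha>"
        unfolding e[symmetric] using r by (simp add: \<alpha>_def)
      also have "\<dots> = \<alpha> * (real (triangular k) - triangular (k - l)) + ((real r - 1) * \<alpha>) * triangular (l - 1)"
        by (simp add: algebra_simps)
      also have "(real r - 1) * \<alpha> = 1 - \<alpha>" using r by (simp add: \<alpha>_def field_simps)
      finally show ?thesis .
    qed
    note L = this
    have \<alpha>': "E1 / real r = \<alpha> * E1" "1 / real r = \<alpha>" by (simp_all add: \<alpha>_def)
    show ?thesis unfolding \<alpha>' L by (simp add: algebra_simps)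
  qed
  finally show "bilinear p k \<Omega> w T F l a b \<xi> \<eta> \<le> C * p powr ((E1 / real (k - l + 1) + (1 - 1 / real (k - l + 1)) * E2)
    + triangular l * (real A - a) + (real (triangular k) - triangular l) * (real A - b)) * m"
    unfolding r_def .
qed

text \<open>With the factor of \<open>eta\<close> in the weight, the rescaled class of
  \<open>xi\<close> is a system of degree \<open>l\<close> with \<open>a' - a\<close> levels. Its
  finest classes are classes modulo \<open>p^a'\<close>, still separated from \<open>eta\<close>, so
  \<open>bd\<close> provides the \<open>m\<close> of this system.\<close>

lemma bilinear_bound_lower_degree:
  assumes dec: "\<And>A. decoupling_bound TYPE('a) p l \<epsilon> C' A" and C: "0 < C" and p: "prime p" "int k < p"
    and adm: "admissible p k A (\<Omega> :: 'a set) w T F m"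
    and l: "1 \<le> l" "l < k"
    and a: "1 \<le> a" "a \<le> a'" "a' \<le> A" and b: "1 \<le> b" and lb: "l * a' = (k - l + 1) * b"
    and bd: "bilinear_bound p k A \<Omega> w T F m l a' b E C"
  shows "bilinear_bound p k A \<Omega> w T F m l a b (E + \<epsilon> * (real a' - a)) (C' * C)"
  unfolding bilinear_bound_def
proof (intro allI impI)
  fix \<xi> \<eta> assume sep: "\<not> p dvd \<xi> - \<eta>"
  have p1: "p > 1" using p(1) by (rule prime_gt_1_int)
  define w' where "w' = (\<lambda>x. w x * cmod (class_sum T F (p ^ b) \<eta> x) ^ (2 * (triangular k - triangular l)))"
  define m' where "m' = C * real_of_int p powr (E + triangular l * (real A - a') + (real (triangular k) - triangular l) * (real A - b)) * m"
  have m': "m' > 0" using C p1 adm by (simp add: m'_def admissible_def)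
  have pp: "p ^ a * p ^ (a' - a) = p ^ a'" using a by (simp flip: power_add)
  have "admissible p l (a' - a) \<Omega> w' (dilate (p ^ a) \<xi> T) (\<lambda>u. F (\<xi> + p ^ a * u)) m'"
    unfolding admissible_def
  proof (intro conjI allI)
    show "nondegenerate p l (a' - a) \<Omega> w' (dilate (p ^ a) \<xi> T) (\<lambda>u. F (\<xi> + p ^ a * u))"
      unfolding w'_def using adm l a b lb sep p
      by (intro nondegenerate_lower_degree[where A = A]) (auto simp: admissible_def)
    fix u0
    have "\<not> p dvd (\<xi> + p ^ a * u0) - \<eta>"
    proof
      assume "p dvd (\<xi> + p ^ a * u0) - \<eta>"
      moreover have "p dvd p ^ a * u0" using a by (simp add: dvd_power dvd_mult2)
      ultimately have "p dvd (\<xi> + p ^ a * u0) - \<eta> - p ^ a * u0" by (rule dvd_diff)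
      then show False using sep by simp
    qed
    then have "bilinear p k \<Omega> w T F l a' b (\<xi> + p ^ a * u0) \<eta> \<le> m'"
      using bd unfolding bilinear_bound_def m'_def by blast
    moreover have "class_sum (dilate (p ^ a) \<xi> T) (\<lambda>u. F (\<xi> + p ^ a * u)) (p ^ (a' - a)) u0 x = class_sum T F (p ^ a') (\<xi> + p ^ a * u0) x" for x
      using p1 by (simp add: class_sum_dilate pp)
    ultimately show "(\<Sum>x\<in>\<Omega>. w' x * cmod (class_sum (dilate (p ^ a) \<xi> T) (\<lambda>u. F (\<xi> + p ^ a * u)) (p ^ (a' - a)) u0 x) ^ (2 * triangular l)) \<le> m'"
      unfolding bilinear_def w'_def by (simp add: ac_simps)
  qed (use adm m' p1 in \<open>auto simp: admissible_def w'_def intro: finite_dilate\<close>)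
  from dec[unfolded decoupling_bound_def, rule_format, OF this]
  have "(\<Sum>x\<in>\<Omega>. w' x * cmod (\<Sum>u\<in>dilate (p ^ a) \<xi> T. F (\<xi> + p ^ a * u) x) ^ (2 * triangular l)) \<le>
      C' * p powr ((\<epsilon> + real (triangular l)) * (real a' - a)) * m'"
    using a by (simp add: of_nat_diff)
  moreover have "class_sum T F (p ^ a) \<xi> x = (\<Sum>u\<in>dilate (p ^ a) \<xi> T. F (\<xi> + p ^ a * u) x)" for x
    using class_sum_dilate[of "p ^ a" \<xi> T F 1 0 x] p1 by (simp add: class_sum_one)
  ultimately have "bilinear p k \<Omega> w T F l a b \<xi> \<eta> \<le> C' * p powr ((\<epsilon> + real (triangular l)) * (real a' - a)) * m'"
    unfolding bilinear_def w'_def by (simp add: ac_simps)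
  also have "\<dots> = C' * C * (p powr ((\<epsilon> + real (triangular l)) * (real a' - a)) *
      p powr (E + triangular l * (real A - a') + (real (triangular k) - triangular l) * (real A - b))) * m"
    unfolding m'_def by simp
  also have "\<dots> = C' * C * p powr (E + \<epsilon> * (real a' - a) + triangular l * (real A - a) + (real (triangular k) - triangular l) * (real A - b)) * m"
    by (simp add: algebra_simps flip: powr_add)
  finally show "bilinear p k \<Omega> w T F l a b \<xi> \<eta> \<le> \<dots>" .
qed

section \<open>Iteration\<close>

text \<open>After \<open>n\<close> rounds of lemma \<open>bilinear_iterate\<close> the exponent \<open>\<kappa> A\<close> is lowered by \<open>\<kappa> b\<close> times \<open>gain k n l\<close>.
  For \<open>l = 0\<close> only the class modulo \<open>p^b\<close> is left, whence \<open>gain k n 0 = 1\<close>.\<close>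

fun gain :: "nat \<Rightarrow> nat \<Rightarrow> nat \<Rightarrow> real" where
  "gain k 0 l = (if l = 0 then 1 else 0)"
| "gain k (Suc n) l = (if l = 0 then 1
     else gain k n (k - l) / real l + (1 - 1 / real (k - l + 1)) * gain k n (l - 1))"

lemma gain_0: "gain k n 0 = 1"
  by (cases n) auto

text \<open>Summing the recursion over \<open>l\<close>, each \<open>gain k n j\<close> with \<open>j \<ge> 1\<close> occurs with total coefficient
  \<open>1/(k-j) + (k-j-1)/(k-j) = 1\<close>; the increment comes from \<open>j = 0\<close>.\<close>
lemma sum_gain:
  assumes k: "1 \<le> k"
  shows "(\<Sum>l\<in>{1..<k}. gain k n l) = real n * (1 - 1 / real k)"
proof (induction n)
  case 0
  have "(\<Sum>l\<in>{1..<k}. gain k 0 l) = (\<Sum>l\<in>{1..<k}. 0)" by (rule sum.cong) auto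
  then show ?case by simp
next
  case (Suc n)
  have "(\<Sum>l\<in>{1..<k}. gain k (Suc n) l) = (\<Sum>l\<in>{1..<k}. gain k n (k - l) / real l)
      + (\<Sum>l\<in>{1..<k}. (1 - 1 / real (k - l + 1)) * gain k n (l - 1))"
    unfolding sum.distrib[symmetric] by (rule sum.cong) auto
  also have "(\<Sum>l\<in>{1..<k}. gain k n (k - l) / real l) = (\<Sum>j\<in>{1..<k}. gain k n j / real (k - j))"
    by (rule sum.reindex_bij_witness[where i = "\<lambda>j. k - j" and j = "\<lambda>j. k - j"]) auto
  also have "(\<Sum>l\<in>{1..<k}. (1 - 1 / real (k - l + 1)) * gain k n (l - 1))
      = (\<Sum>j\<in>{0..<k-1}. (1 - 1 / real (k - j)) * gain k n j)"
    by (rule sum.reindex_bij_witness[where i = "\<lambda>j. Suc j" and j = "\<lambda>l. l - 1"]) auto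
  also have "\<dots> = (\<Sum>j\<in>{0..<k}. (1 - 1 / real (k - j)) * gain k n j)"
    by (rule sum.mono_neutral_left) (auto simp: not_less intro: ccontr)
  also have "\<dots> = (1 - 1 / real k) + (\<Sum>j\<in>{1..<k}. (1 - 1 / real (k - j)) * gain k n j)"
    using k by (simp add: sum.atLeast_Suc_lessThan gain_0)
  also have "(\<Sum>j\<in>{1..<k}. gain k n j / real (k - j)) + ((1 - 1 / real k) + (\<Sum>j\<in>{1..<k}. (1 - 1 / real (k - j)) * gain k n j))
      = (1 - 1 / real k) + (\<Sum>j\<in>{1..<k}. gain k n j / real (k - j) + (1 - 1 / real (k - j)) * gain k n j)"
    by (simp add: sum.distrib)
  also have "(\<Sum>j\<in>{1..<k}. gain k n j / real (k - j) + (1 - 1 / real (k - j)) * gain k n j) = (\<Sum>j\<in>{1..<k}. gain k n j)"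
    by (rule sum.cong) (auto simp: algebra_simps)
  finally show ?case unfolding Suc by (simp add: algebra_simps add_divide_distrib)
qed

text \<open>By \<open>sum_gain\<close> the average over the \<open>k - 1\<close> indices is
  \<open>n / k\<close>. The index that reaches it may depend on \<open>n\<close>.\<close>

lemma exists_gain:
  assumes k: "2 \<le> k"
  shows "\<exists>l\<in>{1..<k}. real n / real k \<le> gain k n l"
proof (rule ccontr)
  assume "\<not> ?thesis"
  then have "gain k n l < real n / real k" if "l \<in> {1..<k}" for l using that by (meson not_le)
  then have "(\<Sum>l\<in>{1..<k}. gain k n l) < (\<Sum>l\<in>{1..<k}. real n / real k)"
    using k by (intro sum_strict_mono) auto
  also have "\<dots> = real n * (1 - 1 / real k)" using k by (simp add: of_nat_diff field_simps)
  finally show False using sum_gain[of k n] k by simp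
qed

text \<open>A round divides \<open>b\<close> by some \<open>l < k\<close>, hence the divisibility by
  \<open>fact (k - 1) ^ n\<close>, and produces exponents up to \<open>k * b\<close>, hence the room
  \<open>k ^ (n + 1) * b <= A\<close>. The condition \<open>l * a <= (k - l + 1) * b\<close> says
  that \<open>a\<close> has not passed the exponent to which it is to be refined.\<close>

lemma bilinear_iterate:
  assumes p: "prime p" "int k < p" and k: "2 \<le> k" and \<kappa>: "0 \<le> \<kappa>" and dec: "decouples TYPE('a) p k \<kappa>"
    and low: "\<And>l \<epsilon>. l \<in> {1..<k} \<Longrightarrow> 0 < \<epsilon> \<Longrightarrow> decouples TYPE('a) p l \<epsilon>"
  shows "0 < \<epsilon> \<Longrightarrow> \<exists>C>0. \<forall>A (\<Omega> :: 'a set) w T F m l a b. admissible p k A \<Omega> w T F m \<longrightarrow> l \<in> {1..<k} \<longrightarrow>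
     1 \<le> a \<longrightarrow> 1 \<le> b \<longrightarrow> fact (k - 1) ^ n dvd b \<longrightarrow> k ^ (n + 1) * b \<le> A \<longrightarrow> l * a \<le> (k - l + 1) * b \<longrightarrow>
     bilinear_bound p k A \<Omega> w T F m l a b (\<kappa> * (real A - gain k n l * real b) + \<epsilon> * real b) C"
proof (induction n arbitrary: \<epsilon>)
  case 0
  have p1: "p > 1" using p(1) by (rule prime_gt_1_int)
  obtain C where C: "C > 0" "\<And>A. decoupling_bound TYPE('a) p k \<kappa> C A" using dec unfolding decouples_def by blast
  show ?case
  proof (rule exI[of _ C], intro conjI allI impI)
    fix A and \<Omega> :: "'a set" and w T F m l a b
    assume adm: "admissible p k A \<Omega> w T F m" and l: "l \<in> {1..<k}" and ab: "1 \<le> a" "1 \<le> (b::nat)"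
      "fact (k - 1) ^ 0 dvd b" "k ^ (0 + 1) * b \<le> A" "l * a \<le> (k - l + 1) * b"
    have "a \<le> l * a" using l by simp
    also have "\<dots> \<le> (k - l + 1) * b" by fact
    also have "\<dots> \<le> k * b" using l by (intro mult_le_mono) auto
    finally have a: "a \<le> A" using ab by simp
    have b: "b \<le> A" using ab(4) k by (metis One_nat_def le_trans mult_le_mono1 nat_mult_1 plus_nat.add_0 power_one_right Suc_1 Suc_leD)
    have "bilinear_bound p k A \<Omega> w T F m l a b (\<kappa> * A) C"
      using l by (intro bilinear_bound_trivial[OF C(2) p1 C(1) adm \<kappa> a b]) auto
    then show "bilinear_bound p k A \<Omega> w T F m l a b (\<kappa> * (real A - gain k 0 l * real b) + \<epsilon> * real b) C"
      by (rule bilinear_bound_mono) (use l p1 C adm 0 in \<open>auto simp: admissible_def\<close>)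
  qed (use C in auto)
next
  case (Suc n)
  have p1: "p > 1" using p(1) by (rule prime_gt_1_int)
  \<comment> \<open>A round costs at most \<open>2 k b\<close> times \<open>\<epsilon>1\<close>: the
    losses inherited from the two moments are at most \<open>2 b\<close>, and decoupling in degree
    \<open>l\<close> adds at most \<open>a' <= k b\<close>.\<close>
  define \<epsilon>1 where "\<epsilon>1 = \<epsilon> / (2 * real k)"
  have \<epsilon>1: "\<epsilon>1 > 0" using Suc.prems k by (simp add: \<epsilon>1_def)
  obtain C0 where C0: "C0 > 0" "\<And>A. decoupling_bound TYPE('a) p k \<kappa> C0 A" using dec unfolding decouples_def by blast
  obtain C1 where C1: "C1 > 0" and IH: "\<And>A (\<Omega> :: 'a set) w T F m l a b. admissible p k A \<Omega> w T F m \<Longrightarrow> l \<in> {1..<k} \<Longrightarrow>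
     1 \<le> a \<Longrightarrow> 1 \<le> b \<Longrightarrow> fact (k - 1) ^ n dvd b \<Longrightarrow> k ^ (n + 1) * b \<le> A \<Longrightarrow> l * a \<le> (k - l + 1) * b \<Longrightarrow>
     bilinear_bound p k A \<Omega> w T F m l a b (\<kappa> * (real A - gain k n l * real b) + \<epsilon>1 * real b) C1"
    using Suc.IH[OF \<epsilon>1] by blast
  have "\<forall>l\<in>{1..<k}. \<exists>C>0. \<forall>A. decoupling_bound TYPE('a) p l \<epsilon>1 C A"
    using low[OF _ \<epsilon>1] unfolding decouples_def by blast
  from bchoice[OF this] obtain Cl where Cl: "\<forall>l\<in>{1..<k}. Cl l > 0 \<and> (\<forall>A. decoupling_bound TYPE('a) p l \<epsilon>1 (Cl l) A)" by blast
  define C2 where "C2 = (\<Sum>l\<in>{1..<k}. Cl l)"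
  \<comment> \<open>\<open>C0\<close> serves the case \<open>l = 1\<close>, where the second moment
    has \<open>l - 1 = 0\<close> and lies outside the induction hypothesis.\<close>
  define D where "D = C0 + C1"
  have D: "D > 0" using C0 C1 by (simp add: D_def)
  have Cl2: "Cl l \<le> C2" if "l \<in> {1..<k}" for l
    unfolding C2_def by (rule member_le_sum) (use that Cl in \<open>auto intro: less_imp_le\<close>)
  have C2: "C2 > 0" using Cl2[of 1] bspec[OF Cl, of 1] k by simp
  show ?case
  proof (rule exI[of _ "C2 * D"], intro conjI allI impI)
    fix A and \<Omega> :: "'a set" and w T F m l a b
    assume adm: "admissible p k A \<Omega> w T F m" and l: "l \<in> {1..<k}" and ab: "1 \<le> a" "1 \<le> (b::nat)"
      "fact (k - 1) ^ Suc n dvd b" "k ^ (Suc n + 1) * b \<le> A" "l * a \<le> (k - l + 1) * b"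
    have m: "0 < m" and w: "\<And>x. x \<in> \<Omega> \<Longrightarrow> 0 \<le> w x" using adm unfolding admissible_def by auto
    have l1: "1 \<le> l" "l < k" using l by auto
    define r where "r = k - l + 1"
    have r: "1 < r" "r \<le> k" using l1 by (auto simp: r_def)
    have "l dvd fact (k - 1)" using l1 by (intro dvd_fact) auto
    then obtain f where f: "fact (k - 1) = l * f" by (auto elim: dvdE)
    obtain c where c: "b = fact (k - 1) ^ Suc n * c" using ab(3) by (auto elim: dvdE)
    \<comment> \<open>\<open>e\<close> is \<open>b / l\<close> and still carries the factor
      \<open>fact (k - 1) ^ n\<close>, which \<open>a' = r * e\<close> and \<open>b\<close> need for
      the remaining rounds.\<close>
    define e where "e = fact (k - 1) ^ n * f * c"
    have be: "b = l * e" unfolding c e_def power_Suc f by (simp add: ac_simps)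
    define a' where "a' = r * e"
    have la': "l * a' = r * b" unfolding a'_def be by simp
    have dvd: "fact (k - 1) ^ n dvd a'" unfolding a'_def e_def by (simp add: dvd_mult dvd_mult2)
    have dvdb: "fact (k - 1) ^ n dvd b" unfolding be e_def by (simp add: dvd_mult dvd_mult2)
    have "l * a \<le> l * a'" using ab(5) unfolding la' r_def .
    then have aa': "a \<le> a'" using l1 by simp
    have a'1: "1 \<le> a'" using aa' ab by simp
    have e1: "e \<le> b" unfolding be using l1 by simp
    have a'b: "a' \<le> k * b" unfolding a'_def using r e1 by (intro mult_le_mono) auto
    have "k ^ (n + 1) * a' \<le> k ^ (n + 1) * (k * b)" using a'b by (rule mult_le_mono2)
    also have "\<dots> \<le> A" using ab(4) by (simp add: ac_simps)
    finally have A1: "k ^ (n + 1) * a' \<le> A" .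
    have "1 * a' \<le> k ^ (n + 1) * a'" using k by (intro mult_le_mono1) auto
    then have a'A: "a' \<le> A" using A1 by linarith
    have "k ^ (n + 1) * b \<le> k ^ (Suc n + 1) * b" using k by (intro mult_le_mono1 power_increasing) auto
    then have A2: "k ^ (n + 1) * b \<le> A" using ab(4) by (rule le_trans)
    have "1 * b \<le> k ^ (n + 1) * b" using k by (intro mult_le_mono1) auto
    then have bA: "b \<le> A" using A2 by linarith
    let ?E1 = "\<kappa> * (real A - gain k n (k - l) * real a') + \<epsilon>1 * real a'"
    let ?E2 = "\<kappa> * (real A - gain k n (l - 1) * real b) + \<epsilon>1 * real b"
    have bd1: "bilinear_bound p k A \<Omega> w T F m (k - l) b a' ?E1 D"
    proof (rule bilinear_bound_mono[where E = ?E1 and C = C1])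
      \<comment> \<open>The induction hypothesis is used with \<open>k - l\<close> for
        \<open>l\<close> and with \<open>b\<close>, \<open>a'\<close> for \<open>a\<close>,
        \<open>b\<close>; since \<open>k - (k - l) + 1 = l + 1\<close>, its size condition is
        \<open>(k - l) * b <= (l + 1) * a'\<close>.\<close>
      have "l * ((k - l) * b) = (l * (k - l)) * b" by simp
      also have "\<dots> \<le> ((l + 1) * r) * b" unfolding r_def by (intro mult_le_mono) auto
      also have "\<dots> = (l + 1) * (r * b)" by (simp only: mult.assoc)
      also have "\<dots> = l * ((l + 1) * a')" unfolding la'[symmetric] by (rule mult.left_commute)
      finally have "l * ((k - l) * b) \<le> l * ((l + 1) * a')" .
      then have "(k - l) * b \<le> (l + 1) * a'" using nat_mult_le_cancel1[of l] l1(1) by (metis less_le_trans zero_less_one)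
      then show "bilinear_bound p k A \<Omega> w T F m (k - l) b a' ?E1 C1"
        using l1 ab a'1 dvd A1 by (intro IH adm) auto
    qed (use C0 C1 p1 m in \<open>auto simp: D_def\<close>)
    have bd2: "bilinear_bound p k A \<Omega> w T F m (l - 1) a' b ?E2 D"
    proof (cases "l = 1")
      case True
      have "bilinear_bound p k A \<Omega> w T F m 0 a' b (\<kappa> * (real A - b)) C0"
        using p1 by (intro bilinear_bound_zero[OF C0(2) _ adm bA]) auto
      then have "bilinear_bound p k A \<Omega> w T F m 0 a' b ?E2 D"
        by (rule bilinear_bound_mono) (use True C0 C1 p1 m \<epsilon>1 in \<open>auto simp: D_def gain_0\<close>)
      then show ?thesis using True by simp
    next
      case False
      show ?thesis
      proof (rule bilinear_bound_mono[where E = ?E2 and C = C1])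
        have "(l - 1) * a' \<le> l * a'" by simp
        also have "\<dots> \<le> (k - (l - 1) + 1) * b" unfolding la' r_def by (intro mult_le_mono) auto
        finally show "bilinear_bound p k A \<Omega> w T F m (l - 1) a' b ?E2 C1"
          using l1 ab a'1 dvdb A2 False by (intro IH adm) auto
      qed (use C0 C1 p1 m in \<open>auto simp: D_def\<close>)
    qed
    let ?E = "?E1 / real r + (1 - 1 / real r) * ?E2"
    have "bilinear_bound p k A \<Omega> w T F m l a' b ?E D"
      using bilinear_bound_swap[OF p1 D m w bd1 bd2 l1] unfolding r_def .
    then have "bilinear_bound p k A \<Omega> w T F m l a b (?E + \<epsilon>1 * (real a' - real a)) (Cl l * D)"
      using Cl l la' by (intro bilinear_bound_lower_degree[OF _ D p adm l1 ab(1) aa' a'A ab(2)]) (auto simp: r_def)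
    moreover have "?E + \<epsilon>1 * (real a' - real a) \<le> \<kappa> * (real A - gain k (Suc n) l * real b) + \<epsilon> * real b"
    proof -
      \<comment> \<open>This ratio explains the coefficient \<open>1 / l\<close> in the recursion of
        \<open>gain\<close>: a saving proportional to \<open>a'\<close>, weighted by
        \<open>1 / r\<close>.\<close>
      have a'r: "real a' / real r = real b / real l"
        using la' l1 r by (simp add: field_simps flip: of_nat_mult)
      have "real b / real l = real e" using be l1 by simp
      then have bl: "real b / real l \<le> real b" using e1 by simp
      have g: "gain k (Suc n) l = gain k n (k - l) / real l + (1 - 1 / real r) * gain k n (l - 1)"
        using l1 by (simp add: r_def)
      have "?E = \<kappa> * real A - \<kappa> * (gain k n (k - l) * (real a' / real r) + (1 - 1 / real r) * (gain k n (l - 1) * real b))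
           + \<epsilon>1 * (real a' / real r + (1 - 1 / real r) * real b)"
        by (simp add: algebra_simps add_divide_distrib diff_divide_distrib)
      also have "\<dots> = \<kappa> * (real A - gain k (Suc n) l * real b) + \<epsilon>1 * (real b / real l + (1 - 1 / real r) * real b)"
        unfolding a'r g by (simp add: algebra_simps)
      finally have "?E + \<epsilon>1 * (real a' - real a) = \<kappa> * (real A - gain k (Suc n) l * real b)
          + \<epsilon>1 * (real b / real l + (1 - 1 / real r) * real b + real a' - real a)"
        by (simp add: algebra_simps)
      also have "\<dots> \<le> \<kappa> * (real A - gain k (Suc n) l * real b) + \<epsilon>1 * (2 * real k * real b)"
      proof -
        have "(1 - 1 / real r) * real b \<le> 1 * real b" using r by (intro mult_right_mono) auto
        moreover have "real a' \<le> real k * real b" using a'b by (simp flip: of_nat_mult)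
        moreover have "2 * real b \<le> real k * real b" using k by (intro mult_right_mono) auto
        ultimately have "real b / real l + (1 - 1 / real r) * real b + real a' - real a \<le> 2 * real k * real b"
          using bl by simp
        then show ?thesis using \<epsilon>1 by (intro add_left_mono mult_left_mono) auto
      qed
      also have "\<epsilon>1 * (2 * real k * real b) = \<epsilon> * real b" using k by (simp add: \<epsilon>1_def)
      finally show ?thesis .
    qed
    moreover have "Cl l * D \<le> C2 * D" using Cl2[OF l] D by simp
    ultimately show "bilinear_bound p k A \<Omega> w T F m l a b (\<kappa> * (real A - gain k (Suc n) l * real b) + \<epsilon> * real b) (C2 * D)"
      by (rule bilinear_bound_mono) (use p1 m D Cl l in \<open>auto intro!: mult_nonneg_nonneg less_imp_le[of 0]\<close>)
  qed (use C2 D in auto)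
qed

section \<open>Crude bounds and monotonicity in the exponent\<close>

text \<open>Power means over all \<open>p^A\<close> finest classes. This supplies a first exponent
  \<kappa> and handles bounded \<open>A\<close>.\<close>

lemma crude_bound:
  assumes p: "p > (1::int)" and adm: "admissible p k A \<Omega> w T F m"
  shows "(\<Sum>x\<in>\<Omega>. w x * cmod (\<Sum>n\<in>T. F n x) ^ (2 * triangular k)) \<le> real_of_int p powr ((2 * triangular k + 1) * A) * m"
proof -
  have T: "finite T" and w: "\<And>x. x \<in> \<Omega> \<Longrightarrow> 0 \<le> w x" and m: "m > 0"
    and bd: "\<And>\<xi>. (\<Sum>x\<in>\<Omega>. w x * cmod (class_sum T F (p ^ A) \<xi> x) ^ (2 * triangular k)) \<le> m"
    using adm unfolding admissible_def by auto
  define P where "P = p ^ A"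
  have P: "P > 0" using p by (simp add: P_def)
  have card: "real (card {0..<P}) = real_of_int P" using P by simp
  have "(\<Sum>x\<in>\<Omega>. w x * cmod (\<Sum>n\<in>T. F n x) ^ (2 * triangular k)) \<le>
      (\<Sum>x\<in>\<Omega>. w x * (P ^ (2 * triangular k) * (\<Sum>u\<in>{0..<P}. cmod (class_sum T F P u x) ^ (2 * triangular k))))"
  proof (intro sum_mono mult_left_mono w)
    fix x
    have "cmod (\<Sum>u\<in>{0..<P}. class_sum T F P u x) ^ (2 * triangular k) \<le> real (card {0..<P}) ^ (2 * triangular k) * (\<Sum>u\<in>{0..<P}. cmod (class_sum T F P u x) ^ (2 * triangular k))"
      using P by (intro norm_sum_power_le) auto
    moreover have "(\<Sum>n\<in>T. F n x) = (\<Sum>u\<in>{0..<P}. class_sum T F P u x)"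
      using class_sum_split[OF T, of 1 P F 0 x] P by (simp add: class_sum_one)
    ultimately show "cmod (\<Sum>n\<in>T. F n x) ^ (2 * triangular k) \<le> real_of_int (P ^ (2 * triangular k)) * (\<Sum>u\<in>{0..<P}. cmod (class_sum T F P u x) ^ (2 * triangular k))"
      unfolding card by simp
  qed
  also have "\<dots> = P ^ (2 * triangular k) * (\<Sum>u\<in>{0..<P}. \<Sum>x\<in>\<Omega>. w x * cmod (class_sum T F P u x) ^ (2 * triangular k))"
    by (subst sum.swap) (simp add: sum_distrib_left ac_simps)
  also have "\<dots> \<le> P ^ (2 * triangular k) * (\<Sum>u\<in>{0..<P}. m)"
    using bd P by (intro mult_left_mono sum_mono) (auto simp: P_def)
  also have "\<dots> = real_of_int P ^ (2 * triangular k + 1) * m" using card by simp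
  also have "real_of_int P ^ (2 * triangular k + 1) = real_of_int p ^ ((2 * triangular k + 1) * A)"
    unfolding P_def of_int_power power_mult[symmetric] by (simp add: mult.commute)
  also have "\<dots> = real_of_int p powr ((2 * triangular k + 1) * A)"
    using p by (subst powr_realpow[symmetric]) auto
  finally show ?thesis .
qed

lemma decouples_trivial:
  assumes "p > 1"
  shows "decouples TYPE('a) p k (real (triangular k) + 1)"
  unfolding decouples_def decoupling_bound_def
proof (intro exI[of _ 1] conjI allI impI)
  fix A and \<Omega> :: "'a set" and w T F m
  assume "admissible p k A \<Omega> w T F m"
  from crude_bound[OF assms this]
  show "(\<Sum>x\<in>\<Omega>. w x * cmod (\<Sum>n\<in>T. F n x) ^ (2 * triangular k)) \<le> 1 * real_of_int p powr ((real (triangular k) + 1 + real (triangular k)) * real A) * m"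
    by (simp add: algebra_simps)
qed simp

lemma decouples_mono:
  assumes "decouples TYPE('a) p k \<kappa>" "\<kappa> \<le> \<kappa>'" "p > 1"
  shows "decouples TYPE('a) p k \<kappa>'"
proof -
  obtain C where C: "C > 0" "\<And>A. decoupling_bound TYPE('a) p k \<kappa> C A" using assms unfolding decouples_def by blast
  have "decoupling_bound TYPE('a) p k \<kappa>' C A" for A
    unfolding decoupling_bound_def
  proof (intro allI impI)
    fix \<Omega> :: "'a set" and w T F m
    assume adm: "admissible p k A \<Omega> w T F m"
    have "(\<Sum>x\<in>\<Omega>. w x * cmod (\<Sum>n\<in>T. F n x) ^ (2 * triangular k)) \<le> C * real_of_int p powr ((\<kappa> + real (triangular k)) * real A) * m"
      using C(2)[of A] adm unfolding decoupling_bound_def by blast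
    also have "\<dots> \<le> C * real_of_int p powr ((\<kappa>' + real (triangular k)) * real A) * m"
      using assms C adm by (intro mult_right_mono mult_left_mono powr_mono) (auto simp: admissible_def)
    finally show "(\<Sum>x\<in>\<Omega>. w x * cmod (\<Sum>n\<in>T. F n x) ^ (2 * triangular k)) \<le> \<dots>" .
  qed
  then show ?thesis using C unfolding decouples_def by blast
qed

section \<open>Decoupling in every degree\<close>

text \<open>Only the second class is refined, and its subclasses stay separated from
  \<open>xi\<close>. The power-mean loss is linear in \<open>b\<close> with a coefficient
  independent of the number of rounds, so a large gain outweighs it.\<close>

lemma bilinear_refine:
  assumes p: "p > (1::int)" and T: "finite T" and w: "\<And>x. x \<in> \<Omega> \<Longrightarrow> 0 \<le> w x" and b: "1 \<le> b"
    and sep: "\<not> p dvd \<xi> - \<eta>" and K: "\<And>\<eta>'. \<not> p dvd \<xi> - \<eta>' \<Longrightarrow> bilinear p k \<Omega> w T F l 1 b \<xi> \<eta>' \<le> K"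
  shows "bilinear p k \<Omega> w T F l 1 1 \<xi> \<eta> \<le> real_of_int p ^ ((b - 1) * (2 * (triangular k - triangular l) + 1)) * K"
proof -
  define P where "P = p ^ (b - 1)"
  have P: "P > 0" using p by (simp add: P_def)
  have card: "real (card {0..<P}) = real_of_int P" using P by simp
  have pP: "p * P = p ^ b" unfolding P_def using b by (simp flip: power_Suc)
  define q where "q = 2 * (triangular k - triangular l)"
  let ?f = "\<lambda>x. cmod (class_sum T F (p ^ 1) \<xi> x) ^ (2 * triangular l)"
  have "bilinear p k \<Omega> w T F l 1 1 \<xi> \<eta> \<le>
      (\<Sum>x\<in>\<Omega>. w x * (?f x * (P ^ q * (\<Sum>u\<in>{0..<P}. cmod (class_sum T F (p ^ b) (\<eta> + p * u) x) ^ q))))"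
    unfolding bilinear_def q_def[symmetric]
  proof (intro sum_mono mult_left_mono w)
    fix x
    have "cmod (class_sum T F (p ^ 1) \<eta> x) ^ q = cmod (\<Sum>u\<in>{0..<P}. class_sum T F (p ^ b) (\<eta> + p * u) x) ^ q"
      using class_sum_split[OF T, of p P F \<eta> x] P p by (simp add: pP)
    also have "\<dots> \<le> real (card {0..<P}) ^ q * (\<Sum>u\<in>{0..<P}. cmod (class_sum T F (p ^ b) (\<eta> + p * u) x) ^ q)"
      using P by (intro norm_sum_power_le) auto
    finally show "cmod (class_sum T F (p ^ 1) \<eta> x) ^ q \<le> real_of_int (P ^ q) * (\<Sum>u\<in>{0..<P}. cmod (class_sum T F (p ^ b) (\<eta> + p * u) x) ^ q)"
      unfolding card by simp
  qed auto
  also have "\<dots> = P ^ q * (\<Sum>u\<in>{0..<P}. bilinear p k \<Omega> w T F l 1 b \<xi> (\<eta> + p * u))"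
    unfolding bilinear_def q_def[symmetric] by (subst sum.swap) (simp add: sum_distrib_left ac_simps)
  also have "\<dots> \<le> P ^ q * (\<Sum>u\<in>{0..<P}. K)"
  proof (intro mult_left_mono sum_mono K)
    fix u show "\<not> p dvd \<xi> - (\<eta> + p * u)"
    proof
      assume "p dvd \<xi> - (\<eta> + p * u)"
      then have "p dvd \<xi> - (\<eta> + p * u) + p * u" by (intro dvd_add) auto
      then show False using sep by simp
    qed
  qed (use P in auto)
  also have "\<dots> = real_of_int P ^ (q + 1) * K" using card by simp
  also have "real_of_int P ^ (q + 1) = real_of_int p ^ ((b - 1) * (q + 1))"
    unfolding P_def of_int_power power_mult ..
  finally show ?thesis unfolding q_def .
qed

text \<open>The decrement \<open>c\<close> does not depend on \<kappa>, so finitely many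
  applications bring any exponent down to \<kappa>0. The broad part of the moment is controlled by
  the iterated mixed moments, the narrow part by induction on \<open>A\<close>.\<close>

lemma decouples_improve:
  assumes p: "prime p" "int k < p" "64 \<le> p" and k: "2 \<le> k" and \<kappa>0: "0 < \<kappa>0"
    and low: "\<And>l \<epsilon>. l \<in> {1..<k} \<Longrightarrow> 0 < \<epsilon> \<Longrightarrow> decouples TYPE('a) p l \<epsilon>"
  shows "\<exists>c>0. \<forall>\<kappa>\<ge>\<kappa>0. decouples TYPE('a) p k \<kappa> \<longrightarrow> decouples TYPE('a) p k (\<kappa> - c)"
proof -
  have p1: "p > 1" using p(3) by simp
  define s where "s = triangular k"
  have s3: "3 \<le> s" using triangular_mono[OF k] by (simp add: s_def triangular_def)
  \<comment> \<open>A gain of \<open>(2 s + 3) / \<kappa>0\<close> pays, per unit of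
    \<open>b\<close>, for the passage from \<open>p\<close> to \<open>p^b\<close> and for the loss 1
    of the iteration, and leaves a surplus 1.\<close>
  obtain n :: nat where n: "real k * (2 * real s + 3) / \<kappa>0 \<le> real n" using real_arch_simple by blast
  obtain l where l: "l \<in> {1..<k}" "real n / real k \<le> gain k n l" using exists_gain[OF k] by blast
  have g: "2 * real s + 3 \<le> \<kappa>0 * gain k n l"
  proof -
    have "2 * real s + 3 \<le> \<kappa>0 * (real n / real k)" using n k \<kappa>0 by (simp add: field_simps)
    also have "\<dots> \<le> \<kappa>0 * gain k n l" using l \<kappa>0 by (intro mult_left_mono) auto
    finally show ?thesis .
  qed
  define B :: nat where "B = fact (k - 1) ^ n"
  have B: "B > 0" by (simp add: B_def)
  define N where "N = k ^ (n + 1) * B"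
  have N: "N > 0" using B k by (simp add: N_def)
  \<comment> \<open>For the \<open>b\<close> chosen below, \<open>b / A\<close> is at least
    \<open>1 / (2 k^(n+1))\<close>, so the surplus \<open>b\<close> is at least \<open>c A\<close>.
    The minimum with \<kappa>0 keeps \<open>\<kappa> - c\<close> nonnegative.\<close>
  define c where "c = min \<kappa>0 (1 / (2 * real k ^ (n + 1)))"
  have c: "c > 0" using \<kappa>0 k by (simp add: c_def)
  have tl: "triangular l \<le> s" unfolding s_def using l by (intro triangular_mono) auto
  show ?thesis
  proof (intro exI[of _ c] conjI allI impI c)
    fix \<kappa> assume \<kappa>: "\<kappa>0 \<le> \<kappa>" and dec: "decouples TYPE('a) p k \<kappa>"
    define \<kappa>' where "\<kappa>' = \<kappa> - c"
    have \<kappa>': "0 \<le> \<kappa>'" using \<kappa> by (simp add: \<kappa>'_def c_def)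
    have "\<exists>C>0. \<forall>A (\<Omega> :: 'a set) w T F m l a b. admissible p k A \<Omega> w T F m \<longrightarrow> l \<in> {1..<k} \<longrightarrow>
     1 \<le> a \<longrightarrow> 1 \<le> b \<longrightarrow> fact (k - 1) ^ n dvd b \<longrightarrow> k ^ (n + 1) * b \<le> A \<longrightarrow> l * a \<le> (k - l + 1) * b \<longrightarrow>
     bilinear_bound p k A \<Omega> w T F m l a b (\<kappa> * (real A - gain k n l * real b) + 1 * real b) C"
      using \<kappa> \<kappa>0 by (intro bilinear_iterate p k dec low) auto
    then obtain C where C: "C > 0" and bb: "\<And>A (\<Omega> :: 'a set) w T F m l a b. admissible p k A \<Omega> w T F m \<Longrightarrow> l \<in> {1..<k} \<Longrightarrow>
     1 \<le> a \<Longrightarrow> 1 \<le> b \<Longrightarrow> fact (k - 1) ^ n dvd b \<Longrightarrow> k ^ (n + 1) * b \<le> A \<Longrightarrow> l * a \<le> (k - l + 1) * b \<Longrightarrow>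
     bilinear_bound p k A \<Omega> w T F m l a b (\<kappa> * (real A - gain k n l * real b) + 1 * real b) C"
      by blast
    \<comment> \<open>\<open>A >= A0\<close> gives \<open>A div N >= k\<close>, hence
      \<open>l <= b\<close>, and the iteration may start from \<open>a = 1\<close>.\<close>
    define A0 where "A0 = N * k"
    have bil11: "bilinear p k \<Omega> w T F l 1 1 \<xi> \<eta> \<le> C * p powr ((\<kappa>' + real s) * real A) * m"
      if A: "A0 \<le> A" and adm: "admissible p k A (\<Omega> :: 'a set) w T F m" and sep: "\<not> p dvd \<xi> - \<eta>"
      for A \<Omega> w T F m \<xi> \<eta>
    proof -
      have m: "0 < m" and w: "\<And>x. x \<in> \<Omega> \<Longrightarrow> 0 \<le> w x" and T: "finite T" using adm unfolding admissible_def by auto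
      \<comment> \<open>\<open>B * t\<close> is the largest multiple of \<open>B\<close> for which
        \<open>k^(n+1) * b <= A\<close>.\<close>
      define t where "t = A div N"
      define b where "b = B * t"
      have t: "k \<le> t" unfolding t_def using A N by (simp add: A0_def less_eq_div_iff_mult_less_eq mult.commute)
      have bt: "t \<le> b" unfolding b_def using B by simp
      have b1: "1 \<le> b" "l \<le> b" using t bt k l by auto
      have kb: "k ^ (n + 1) * b \<le> A"
      proof -
        have "k ^ (n + 1) * b = N * (A div N)" by (simp add: N_def b_def t_def)
        also have "\<dots> \<le> A" by simp
        finally show ?thesis .
      qed
      have bA: "c * real A \<le> real b"
      proof -
        have "A < N * (t + 1)" unfolding t_def using N
          by (metis Suc_eq_plus1 dividend_less_times_div mult_Suc_right add.commute)
        also have "\<dots> \<le> N * (2 * t)" using t k by (intro mult_le_mono2) auto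
        also have "\<dots> = 2 * k ^ (n + 1) * b" by (simp add: N_def b_def)
        finally have "real A \<le> 2 * real k ^ (n + 1) * real b"
          by (metis less_imp_le of_nat_le_iff of_nat_mult of_nat_numeral of_nat_power)
        then have "(1 / (2 * real k ^ (n + 1))) * real A \<le> real b" using k by (simp add: field_simps)
        moreover have "c * real A \<le> (1 / (2 * real k ^ (n + 1))) * real A" by (intro mult_right_mono) (auto simp: c_def)
        ultimately show ?thesis by simp
      qed
      let ?E = "\<kappa> * (real A - gain k n l * real b) + 1 * real b + triangular l * (real A - real 1) + (real (triangular k) - triangular l) * (real A - b)"
      have "l * 1 \<le> (k - l + 1) * b" using b1 by (metis le_trans mult.right_neutral mult_le_mono1 nat_mult_1 le_add2)
      then have bd: "bilinear_bound p k A \<Omega> w T F m l 1 b (\<kappa> * (real A - gain k n l * real b) + 1 * real b) C"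
        using b1 kb l by (intro bb adm) (auto simp: b_def B_def)
      have "bilinear p k \<Omega> w T F l 1 1 \<xi> \<eta> \<le> real_of_int p ^ ((b - 1) * (2 * (triangular k - triangular l) + 1)) * (C * p powr ?E * m)"
        using bd by (intro bilinear_refine p1 T w b1 sep) (auto simp: bilinear_bound_def)
      also have "real_of_int p ^ ((b - 1) * (2 * (triangular k - triangular l) + 1)) = p powr ((b - 1) * (2 * (triangular k - triangular l) + 1))"
        using p1 by (subst powr_realpow[symmetric]) auto
      also have "real ((b - 1) * (2 * (triangular k - triangular l) + 1)) = (real b - 1) * (2 * (real s - triangular l) + 1)"
        
      proof -
        have "real (b - 1) = real b - 1" "real (triangular k - triangular l) = real s - triangular l"
          using b1 tl by (simp_all add: s_def of_nat_diff)
        then show ?thesis by (simp only: of_nat_mult of_nat_add of_nat_1 of_nat_numeral)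
      qed
      also have "p powr ((real b - 1) * (2 * (real s - triangular l) + 1)) * (C * p powr ?E * m)
          = C * p powr ((real b - 1) * (2 * (real s - triangular l) + 1) + ?E) * m"
        by (simp add: powr_add)
      also have "\<dots> \<le> C * p powr ((\<kappa>' + real s) * real A) * m"
      proof -
        define S L where "S = real s" and "L = real (triangular l)"
        have SL: "L \<le> S" "0 \<le> L" using tl by (auto simp: S_def L_def)
        have g': "(2 * S + 3) * real b \<le> \<kappa> * gain k n l * real b"
        proof -
          have "0 \<le> gain k n l" using l(2) by (rule order_trans[rotated]) simp
          then have "\<kappa>0 * gain k n l \<le> \<kappa> * gain k n l" using \<kappa> by (intro mult_right_mono)
          then show ?thesis using g unfolding S_def by (intro mult_right_mono) auto
        qed
        have "(real b - 1) * (2 * (S - L) + 1) + ?E \<le> \<kappa> * real A - real b + S * real A"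
        proof -
          have trS: "real (triangular k) = S" by (simp add: S_def s_def)
          have "(real b - 1) * (2 * (S - L) + 1) + ?E = (\<kappa> * real A + S * real A - real b) +
              (S * real b - L * real b + 3 * real b - 2 * S + L - 1 - \<kappa> * gain k n l * real b)"
            unfolding L_def[symmetric] trS by (simp add: algebra_simps)
          moreover have "2 * (S * real b) + 3 * real b \<le> \<kappa> * gain k n l * real b"
            using g' by (simp add: algebra_simps)
          moreover have "0 \<le> L * real b" "0 \<le> S * real b" using SL by auto
          ultimately show ?thesis using SL by linarith
        qed
        also have "\<dots> \<le> (\<kappa>' + S) * real A" using bA by (simp add: \<kappa>'_def algebra_simps)
        finally show ?thesis unfolding S_def L_def using C m p1 by (intro mult_right_mono mult_left_mono powr_mono) auto
      qed
      finally show ?thesis .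
    qed
    \<comment> \<open>The first term is the crude bound for \<open>A < A0\<close>. The second is
      twice the broad part, so that the broad and the narrow part take half of \<open>C'\<close>
      each.\<close>
    define C' where "C' = real_of_int p powr ((2 * real s + 1) * A0) + 2 * real_of_int p ^ (4 * s) * real_of_int p ^ 2 * C"
    have C'1: "real_of_int p powr ((2 * real s + 1) * A0) \<le> C'" using C p1 by (simp add: C'_def)
    have C'2: "real_of_int p ^ (4 * s) * real_of_int p ^ 2 * C \<le> C' / 2" by (simp add: C'_def)
    have C': "C' > 0" using C p1 by (simp add: C'_def add_pos_pos)
    have "decoupling_bound TYPE('a) p k \<kappa>' C' A" for A
    proof (induction A)
      case 0
      show ?case unfolding decoupling_bound_def
      proof (intro allI impI)
        fix \<Omega> :: "'a set" and w T F m
        assume adm: "admissible p k 0 \<Omega> w T F m"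
        then have m: "m > 0" by (simp add: admissible_def)
        have "1 \<le> real_of_int p powr ((2 * real s + 1) * A0)" using p1 by (intro ge_one_powr_ge_zero) auto
        then have "1 * m \<le> C' * m" using C'1 m by (intro mult_right_mono) auto
        then show "(\<Sum>x\<in>\<Omega>. w x * cmod (\<Sum>n\<in>T. F n x) ^ (2 * triangular k)) \<le> C' * p powr ((\<kappa>' + real (triangular k)) * real 0) * m"
          using crude_bound[OF p1 adm] p1 by simp
      qed
    next
      case (Suc A)
      show ?case unfolding decoupling_bound_def
      proof (intro allI impI)
        fix \<Omega> :: "'a set" and w T F m
        assume adm: "admissible p k (Suc A) \<Omega> w T F m"
        then have m: "m > 0" and T: "finite T" and w: "\<And>x. x \<in> \<Omega> \<Longrightarrow> 0 \<le> w x" by (auto simp: admissible_def)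
        define X where "X = real_of_int p powr ((\<kappa>' + real s) * real (Suc A)) * m"
        have X: "X > 0" using m p1 by (simp add: X_def)
        show "(\<Sum>x\<in>\<Omega>. w x * cmod (\<Sum>n\<in>T. F n x) ^ (2 * triangular k)) \<le> C' * p powr ((\<kappa>' + real (triangular k)) * real (Suc A)) * m"
        proof (cases "A0 \<le> Suc A")
          case False
          have "(\<Sum>x\<in>\<Omega>. w x * cmod (\<Sum>n\<in>T. F n x) ^ (2 * triangular k)) \<le> real_of_int p powr ((2 * real s + 1) * real (Suc A)) * m"
            using crude_bound[OF p1 adm] by (simp add: s_def algebra_simps)
          also have "\<dots> \<le> real_of_int p powr ((2 * real s + 1) * A0) * m"
            using False p1 m by (intro mult_right_mono powr_mono mult_left_mono) auto
          also have "\<dots> \<le> C' * m" using C'1 m by simp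
          also have "\<dots> \<le> C' * p powr ((\<kappa>' + real (triangular k)) * real (Suc A)) * m"
          proof -
            have "1 \<le> p powr ((\<kappa>' + real (triangular k)) * real (Suc A))" using p1 \<kappa>' by (intro ge_one_powr_ge_zero) auto
            then show ?thesis using C' m by (simp add: mult_right_mono)
          qed
          finally show ?thesis .
        next
          case True
          have cs: "(\<Sum>n\<in>T. F n x) = (\<Sum>i\<in>{0..<p}. class_sum T F p i x)" for x
            using class_sum_split[OF T, of 1 p F 0 x] p1 by (simp add: class_sum_one)
          have "(\<Sum>x\<in>\<Omega>. w x * cmod (\<Sum>n\<in>T. F n x) ^ (2 * triangular k)) \<le>
             (\<Sum>x\<in>\<Omega>. w x * (4 ^ s * (\<Sum>i\<in>{0..<p}. cmod (class_sum T F p i x) ^ (2 * s))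
                + real_of_int p ^ (4 * s) * (\<Sum>i\<in>{0..<p}. \<Sum>j\<in>{0..<p}-{i}. cmod (class_sum T F p i x) ^ (2 * triangular l) * cmod (class_sum T F p j x) ^ (2 * (s - triangular l)))))"
            unfolding cs s_def[symmetric] using p1 tl by (intro sum_mono mult_left_mono w broad_narrow) auto
          also have "\<dots> = (\<Sum>x\<in>\<Omega>. w x * (4 ^ s * (\<Sum>i\<in>{0..<p}. cmod (class_sum T F p i x) ^ (2 * s)))) +
             (\<Sum>x\<in>\<Omega>. w x * (real_of_int p ^ (4 * s) * (\<Sum>i\<in>{0..<p}. \<Sum>j\<in>{0..<p}-{i}. cmod (class_sum T F p i x) ^ (2 * triangular l) * cmod (class_sum T F p j x) ^ (2 * (s - triangular l)))))"
            by (simp only: distrib_left sum.distrib)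
          also have "(\<Sum>x\<in>\<Omega>. w x * (4 ^ s * (\<Sum>i\<in>{0..<p}. cmod (class_sum T F p i x) ^ (2 * s)))) = 4 ^ s * (\<Sum>i\<in>{0..<p}. \<Sum>x\<in>\<Omega>. w x * cmod (class_sum T F p i x) ^ (2 * s))"
            by (subst sum.swap) (simp add: sum_distrib_left ac_simps)
          also have "(\<Sum>x\<in>\<Omega>. w x * (real_of_int p ^ (4 * s) * (\<Sum>i\<in>{0..<p}. \<Sum>j\<in>{0..<p}-{i}. cmod (class_sum T F p i x) ^ (2 * triangular l) * cmod (class_sum T F p j x) ^ (2 * (s - triangular l)))))
             = real_of_int p ^ (4 * s) * (\<Sum>i\<in>{0..<p}. \<Sum>j\<in>{0..<p}-{i}. bilinear p k \<Omega> w T F l 1 1 i j)"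
          proof -
            have "(\<Sum>i\<in>{0..<p}. \<Sum>j\<in>{0..<p}-{i}. bilinear p k \<Omega> w T F l 1 1 i j) =
              (\<Sum>i\<in>{0..<p}. \<Sum>x\<in>\<Omega>. \<Sum>j\<in>{0..<p}-{i}. w x * (cmod (class_sum T F p i x) ^ (2 * triangular l) * cmod (class_sum T F p j x) ^ (2 * (s - triangular l))))"
              unfolding bilinear_def s_def power_one_right by (intro sum.cong refl sum.swap)
            also have "\<dots> = (\<Sum>x\<in>\<Omega>. \<Sum>i\<in>{0..<p}. \<Sum>j\<in>{0..<p}-{i}. w x * (cmod (class_sum T F p i x) ^ (2 * triangular l) * cmod (class_sum T F p j x) ^ (2 * (s - triangular l))))"
              by (rule sum.swap)
            finally show ?thesis by (simp only: sum_distrib_left ac_simps)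
          qed
          also have "4 ^ s * (\<Sum>i\<in>{0..<p}. \<Sum>x\<in>\<Omega>. w x * cmod (class_sum T F p i x) ^ (2 * s)) \<le> C' / 2 * X"
          proof -
            have "(\<Sum>x\<in>\<Omega>. w x * cmod (class_sum T F p i x) ^ (2 * s)) \<le> C' * (real_of_int p powr ((\<kappa>' + real s) * real A) * m)" for i
              using decoupling_bound_class_sum[of p k \<kappa>' C' "Suc A" 1, OF _ _ _ adm, of i] Suc.IH p1 by (simp add: s_def mult.assoc)
            then have "(\<Sum>i\<in>{0..<p}. \<Sum>x\<in>\<Omega>. w x * cmod (class_sum T F p i x) ^ (2 * s)) \<le> (\<Sum>i\<in>{0..<p}. C' * (real_of_int p powr ((\<kappa>' + real s) * real A) * m))"
              by (intro sum_mono)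
            also have "\<dots> = C' * (real_of_int p * real_of_int p powr ((\<kappa>' + real s) * real A)) * m"
              using p1 by simp
            also have "real_of_int p * real_of_int p powr ((\<kappa>' + real s) * real A) = real_of_int p powr (1 - \<kappa>' - real s) * real_of_int p powr ((\<kappa>' + real s) * real (Suc A))"
            proof -
              have "real_of_int p * real_of_int p powr ((\<kappa>' + real s) * real A) = real_of_int p powr (1 + (\<kappa>' + real s) * real A)"
                using p1 by (simp add: powr_add)
              then show ?thesis unfolding powr_add[symmetric] by (simp add: algebra_simps)
            qed
            finally have 1: "(\<Sum>i\<in>{0..<p}. \<Sum>x\<in>\<Omega>. w x * cmod (class_sum T F p i x) ^ (2 * s)) \<le> real_of_int p powr (1 - \<kappa>' - real s) * (C' * X)"
              unfolding X_def by (simp add: ac_simps)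
            \<comment> \<open>The narrow constant \<open>4^s\<close> is free of \<open>p\<close>,
              and \<open>p^(s-1) >= 64^(s-1) >= 2 * 4^s\<close>; hence the \<open>p\<close> classes
              with one level less use up at most half of the bound.\<close>
            have "4 ^ s * real_of_int p powr (1 - \<kappa>' - real s) \<le> 1 / 2"
            proof -
              have "real_of_int p powr (1 - \<kappa>' - real s) \<le> real_of_int p powr (- real (s - 1))"
                using p1 \<kappa>' s3 by (intro powr_mono) (auto simp: of_nat_diff)
              also have "\<dots> = 1 / real_of_int p ^ (s - 1)"
                using p1 by (simp add: powr_minus powr_realpow divide_inverse)
              also have "\<dots> \<le> 1 / 64 ^ (s - 1)"
                using p(3) by (intro divide_left_mono power_mono) auto
              finally have "4 ^ s * real_of_int p powr (1 - \<kappa>' - real s) \<le> 4 ^ s * (1 / 64 ^ (s - 1))" by (intro mult_left_mono) auto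
              also have "\<dots> \<le> 1 / 2"
              proof -
                have "(2::real) * 4 ^ s \<le> 4 ^ (s + 1)" by simp
                also have "\<dots> \<le> 4 ^ (3 * (s - 1))" using s3 by (intro power_increasing) auto
                also have "\<dots> = 64 ^ (s - 1)" by (simp add: power_mult)
                finally show ?thesis by (simp add: field_simps)
              qed
              finally show ?thesis .
            qed
            then have 2: "(4 ^ s * real_of_int p powr (1 - \<kappa>' - real s)) * (C' * X) \<le> 1 / 2 * (C' * X)"
              using C' X by (intro mult_right_mono) auto
            have "4 ^ s * (\<Sum>i\<in>{0..<p}. \<Sum>x\<in>\<Omega>. w x * cmod (class_sum T F p i x) ^ (2 * s)) \<le> 4 ^ s * (real_of_int p powr (1 - \<kappa>' - real s) * (C' * X))"
              using 1 by (intro mult_left_mono) auto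
            also have "\<dots> = (4 ^ s * real_of_int p powr (1 - \<kappa>' - real s)) * (C' * X)" by (simp only: mult.assoc)
            also note 2
            finally show ?thesis by simp
          qed
          also have "real_of_int p ^ (4 * s) * (\<Sum>i\<in>{0..<p}. \<Sum>j\<in>{0..<p}-{i}. bilinear p k \<Omega> w T F l 1 1 i j) \<le> C' / 2 * X"
          proof -
            have "bilinear p k \<Omega> w T F l 1 1 i j \<le> C * X" if ij: "i \<in> {0..<p}" "j \<in> {0..<p} - {i}" for i j
            proof -
              have "\<not> p dvd i - j"
              proof
                assume "p dvd i - j"
                then have "i mod p = j mod p" by (simp add: mod_eq_dvd_iff)
                then show False using ij by simp
              qed
              from bil11[OF True adm this] show ?thesis by (simp add: X_def mult.assoc)
            qed
            then have "(\<Sum>i\<in>{0..<p}. \<Sum>j\<in>{0..<p}-{i}. bilinear p k \<Omega> w T F l 1 1 i j) \<le> (\<Sum>i\<in>{0..<p}. \<Sum>j\<in>{0..<p}-{i}. C * X)"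
              by (intro sum_mono)
            also have "\<dots> \<le> (\<Sum>i\<in>{0..<p}. \<Sum>j\<in>{0..<p}. C * X)"
              using C X by (intro sum_mono sum_mono2) auto
            also have "\<dots> = real_of_int p ^ 2 * (C * X)" using p1 by (simp add: power2_eq_square)
            finally have "real_of_int p ^ (4 * s) * (\<Sum>i\<in>{0..<p}. \<Sum>j\<in>{0..<p}-{i}. bilinear p k \<Omega> w T F l 1 1 i j) \<le> real_of_int p ^ (4 * s) * (real_of_int p ^ 2 * (C * X))"
              using p1 by (intro mult_left_mono) auto
            also have "\<dots> = (real_of_int p ^ (4 * s) * real_of_int p ^ 2 * C) * X" by simp
            also have "\<dots> \<le> C' / 2 * X" using C'2 X by (intro mult_right_mono) auto
            finally show ?thesis .
          qed
          also have "C' / 2 * X + C' / 2 * X = C' * p powr ((\<kappa>' + real (triangular k)) * real (Suc A)) * m"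
            by (simp add: X_def s_def)
          finally show ?thesis by simp
        qed
      qed
    qed
    then show "decouples TYPE('a) p k (\<kappa> - c)" using C' unfolding decouples_def \<kappa>'_def by blast
  qed
qed

text \<open>Here \<open>triangular 1 = 1\<close> and orthogonality suffices: the congruence centred
  at \<open>n'\<close> says that \<open>p^A\<close> divides \<open>n - n'\<close> times a number
  that is 1 modulo \<open>p\<close>. Thus correlations across finest classes vanish, and the second
  moment is exactly the sum of those of the \<open>p^A\<close> classes.\<close>

lemma decouples_one:
  assumes p: "p > (1::int)" and \<kappa>: "0 \<le> \<kappa>"
  shows "decouples TYPE('a) p 1 \<kappa>"
  unfolding decouples_def decoupling_bound_def
proof (intro exI[of _ 1] conjI allI impI)
  fix A and \<Omega> :: "'a set" and w T F m
  assume adm: "admissible p 1 A \<Omega> w T F m"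
  have m: "m > 0" and T: "finite T" and nd: "nondegenerate p 1 A \<Omega> w T F" and
    bd: "\<And>\<xi>. (\<Sum>x\<in>\<Omega>. w x * cmod (class_sum T F (p ^ A) \<xi> x) ^ 2) \<le> m"
    using adm by (auto simp: admissible_def triangular_def)
  define P where "P = p ^ A"
  have P: "P > 0" using p by (simp add: P_def)
  have orth: "P dvd n - n'" if nn: "n \<in> T" "n' \<in> T" and c: "correlation \<Omega> w F [n] [n'] \<noteq> 0" for n n'
  proof -
    obtain R where R: "(\<lambda>n. (n - n') ^ 1 + p * (n - n') ^ (1 + 1) * poly R (n - n')) \<in> congruences \<Omega> w T F (triangular 1) (p ^ (1 * A))"
      using nd unfolding nondegenerate_def by (meson atLeastAtMost_iff order_refl)
    have "P dvd (n - n') * (1 + p * ((n - n') * poly R (n - n')))"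
      using congruencesD[OF R c] nn by (simp add: P_def triangular_def algebra_simps)
    moreover have "coprime P (1 + p * ((n - n') * poly R (n - n')))"
    proof -
      have "coprime p (1 + p * z)" for z
      proof (rule coprimeI)
        fix c assume c: "c dvd p" "c dvd 1 + p * z"
        have "c dvd (1 + p * z) - p * z" by (intro dvd_diff c dvd_mult2)
        then show "c dvd 1" by simp
      qed
      then show ?thesis unfolding P_def by simp
    qed
    ultimately show ?thesis by (simp add: coprime_dvd_mult_left_iff)
  qed
  have sq: "complex_of_real (\<Sum>x\<in>\<Omega>. w x * cmod (\<Sum>n\<in>S. F n x) ^ 2) = (\<Sum>n\<in>S. \<Sum>n'\<in>S. correlation \<Omega> w F [n] [n'])" for S
  proof -
    have "complex_of_real (\<Sum>x\<in>\<Omega>. w x * cmod (\<Sum>n\<in>S. F n x) ^ 2) = (\<Sum>x\<in>\<Omega>. \<Sum>n\<in>S. \<Sum>n'\<in>S. of_real (w x) * F n x * cnj (F n' x))"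
      unfolding of_real_sum of_real_mult complex_norm_square cnj_sum sum_product
      by (simp add: sum_distrib_left mult.assoc)
    also have "\<dots> = (\<Sum>n\<in>S. \<Sum>x\<in>\<Omega>. \<Sum>n'\<in>S. of_real (w x) * F n x * cnj (F n' x))" by (rule sum.swap)
    also have "\<dots> = (\<Sum>n\<in>S. \<Sum>n'\<in>S. correlation \<Omega> w F [n] [n'])"
      unfolding correlation_def by (intro sum.cong refl, subst sum.swap) simp
    finally show ?thesis .
  qed
  define cl where "cl u = {n \<in> T. P dvd n - u}" for u
  have "complex_of_real (\<Sum>x\<in>\<Omega>. w x * cmod (\<Sum>n\<in>T. F n x) ^ 2) = (\<Sum>n\<in>T. \<Sum>n'\<in>T. correlation \<Omega> w F [n] [n'])" by (rule sq)
  also have "\<dots> = (\<Sum>n\<in>T. \<Sum>n'\<in>cl n. correlation \<Omega> w F [n] [n'])"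
  proof (rule sum.cong[OF refl])
    fix n assume n: "n \<in> T"
    have "correlation \<Omega> w F [n] [n'] = 0" if n': "n' \<in> T - cl n" for n'
    proof -
      have "\<not> P dvd n - n'" using n' by (auto simp: cl_def dvd_diff_commute)
      then show ?thesis using orth n n' by blast
    qed
    then show "(\<Sum>n'\<in>T. correlation \<Omega> w F [n] [n']) = (\<Sum>n'\<in>cl n. correlation \<Omega> w F [n] [n'])"
      using T by (intro sum.mono_neutral_right) (auto simp: cl_def)
  qed
  also have "\<dots> = (\<Sum>u\<in>{0..<P}. \<Sum>n\<in>{n \<in> T. n mod P = u}. \<Sum>n'\<in>cl n. correlation \<Omega> w F [n] [n'])"
    using T P by (intro sum.group[symmetric]) auto
  also have "\<dots> = (\<Sum>u\<in>{0..<P}. \<Sum>n\<in>cl u. \<Sum>n'\<in>cl u. correlation \<Omega> w F [n] [n'])"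
  proof (intro sum.cong refl)
    fix u assume u: "u \<in> {0..<P}"
    have iff: "P dvd n - u \<longleftrightarrow> n mod P = u" for n
      using u by (simp add: mod_eq_dvd_iff[symmetric])
    show "{n \<in> T. n mod P = u} = cl u" by (auto simp: cl_def iff)
    fix n assume "n \<in> cl u"
    then have "P dvd n - u" by (simp add: cl_def)
    then have "P dvd n' - n \<longleftrightarrow> P dvd n' - u" for n'
      by (simp add: mod_eq_dvd_iff[symmetric])
    then show "cl n = cl u" by (simp add: cl_def)
  qed
  also have "\<dots> = complex_of_real (\<Sum>u\<in>{0..<P}. \<Sum>x\<in>\<Omega>. w x * cmod (class_sum T F P u x) ^ 2)"
    unfolding of_real_sum[of _ "{0..<P}"] class_sum_def cl_def sq ..
  finally have "(\<Sum>x\<in>\<Omega>. w x * cmod (\<Sum>n\<in>T. F n x) ^ 2) = (\<Sum>u\<in>{0..<P}. \<Sum>x\<in>\<Omega>. w x * cmod (class_sum T F P u x) ^ 2)"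
    by (simp only: of_real_eq_iff)
  also have "\<dots> \<le> (\<Sum>u\<in>{0..<P}. m)" using bd unfolding P_def by (intro sum_mono)
  also have "\<dots> = real_of_int p ^ A * m" using P by (simp add: P_def)
  also have "\<dots> = real_of_int p powr real A * m" using p by (simp add: powr_realpow)
  also have "\<dots> \<le> real_of_int p powr ((\<kappa> + 1) * real A) * m"
    using \<kappa> p m by (intro mult_right_mono powr_mono) (auto simp: algebra_simps)
  finally show "(\<Sum>x\<in>\<Omega>. w x * cmod (\<Sum>n\<in>T. F n x) ^ (2 * triangular 1)) \<le> 1 * real_of_int p powr ((\<kappa> + real (triangular 1)) * real A) * m"
    by (simp add: triangular_def)
qed simp

text \<open>Induction on the degree; within a degree, descent from the trivial exponent
  \<open>s(k) + 1\<close> in steps of \<open>c\<close> until \<epsilon> is reached.\<close>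

theorem decoupling:
  assumes p: "prime p" "64 \<le> p"
  shows "1 \<le> k \<Longrightarrow> int k < p \<Longrightarrow> 0 < \<epsilon> \<Longrightarrow> decouples TYPE('a) p k \<epsilon>"
proof (induction k arbitrary: \<epsilon> rule: less_induct)
  case (less k)
  have p1: "p > 1" using p by simp
  show ?case
  proof (cases "k = 1")
    case True
    then show ?thesis using decouples_one[OF p1, where 'a = 'a] less.prems by simp
  next
    case False
    then have k: "2 \<le> k" using less.prems by simp
    have low: "decouples TYPE('a) p l \<delta>" if "l \<in> {1..<k}" "0 < \<delta>" for l \<delta>
      using that less.prems by (intro less.IH) auto
    obtain c where c: "c > 0" "\<And>\<kappa>. \<epsilon> \<le> \<kappa> \<Longrightarrow> decouples TYPE('a) p k \<kappa> \<Longrightarrow> decouples TYPE('a) p k (\<kappa> - c)"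
      using decouples_improve[OF p(1) less.prems(2) p(2) k less.prems(3) low] by blast
    have step: "\<exists>\<kappa>. decouples TYPE('a) p k \<kappa> \<and> (\<kappa> \<le> \<epsilon> \<or> \<kappa> \<le> real (triangular k) + 1 - real n * c)" for n
    proof (induction n)
      case 0
      show ?case using decouples_trivial[OF p1] by (intro exI[of _ "real (triangular k) + 1"]) simp
    next
      case (Suc n)
      then obtain \<kappa> where \<kappa>: "decouples TYPE('a) p k \<kappa>" "\<kappa> \<le> \<epsilon> \<or> \<kappa> \<le> real (triangular k) + 1 - real n * c" by blast
      show ?case
      proof (cases "\<kappa> \<le> \<epsilon>")
        case True
        then show ?thesis using \<kappa> by blast
      next
        case False
        then have "decouples TYPE('a) p k (\<kappa> - c)" using c(2) \<kappa>(1) by simp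
        then show ?thesis using False \<kappa>(2) by (intro exI[of _ "\<kappa> - c"]) (auto simp: algebra_simps)
      qed
    qed
    obtain n :: nat where "real (triangular k) + 1 \<le> real n * c"
      using reals_Archimedean3[OF c(1), rule_format, of "real (triangular k) + 1"] by (auto intro: less_imp_le)
    then obtain \<kappa> where "decouples TYPE('a) p k \<kappa>" "\<kappa> \<le> \<epsilon>"
      using step[of n] less.prems by fastforce
    then show ?thesis using decouples_mono p1 by blast
  qed
qed

section \<open>Vinogradov's mean value theorem\<close>

lemma ee_add: "ee (x + y) = ee x * ee y"
  unfolding ee_def by (simp add: distrib_left flip: exp_add)

lemma ee_0: "ee 0 = 1"
  by (simp add: ee_def)

lemma ee_sum: "ee (\<Sum>i\<in>I. f i) = (\<Prod>i\<in>I. ee (f i))"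
  by (induction I rule: infinite_finite_induct) (auto simp: ee_add ee_0)

lemma ee_sum_list: "ee (\<Sum>n\<leftarrow>ns. f n) = (\<Prod>n\<leftarrow>ns. ee (f n))"
  by (induction ns) (auto simp: ee_add ee_0)

lemma norm_ee [simp]: "cmod (ee x) = 1"
  by (simp add: ee_def norm_exp_eq_Re)

lemma cnj_ee: "cnj (ee x) = ee (- x)"
  by (simp add: ee_def exp_cnj)

lemma ee_eq_1_iff: "ee x = 1 \<longleftrightarrow> x \<in> \<int>"
proof -
  have "ee x = 1 \<longleftrightarrow> (\<exists>n::int. 2 * pi * x = of_int (2 * n) * pi)"
    unfolding ee_def exp_eq_1 by simp
  also have "\<dots> \<longleftrightarrow> (\<exists>n::int. x = of_int n)" by (intro ex_cong1) auto
  finally show ?thesis by (auto elim!: Ints_cases)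
qed

lemma ee_power: "ee x ^ n = ee (of_nat n * x)"
  by (induction n) (auto simp: ee_0 ee_add distrib_right)

lemma sum_power_lists:
  fixes f :: "'b \<Rightarrow> 'c :: comm_semiring_1"
  assumes "finite T"
  shows "(\<Sum>n\<in>T. f n) ^ s = (\<Sum>ns\<in>{ns. set ns \<subseteq> T \<and> length ns = s}. \<Prod>n\<leftarrow>ns. f n)"
proof (induction s)
  case 0
  have "{ns. set ns \<subseteq> T \<and> length ns = 0} = {[]}" by auto
  then show ?case by simp
next
  case (Suc s)
  let ?L = "{ns. set ns \<subseteq> T \<and> length ns = s}"
  have "(\<Sum>ns\<in>{ns. set ns \<subseteq> T \<and> length ns = Suc s}. \<Prod>n\<leftarrow>ns. f n) =
      (\<Sum>z\<in>?L \<times> T. f (snd z) * (\<Prod>n\<leftarrow>fst z. f n))"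
    unfolding lists_length_Suc_eq
    by (subst sum.reindex) (auto simp: inj_on_def case_prod_beta)
  also have "\<dots> = (\<Sum>ns\<in>?L. \<Sum>n\<in>T. f n * (\<Prod>n\<leftarrow>ns. f n))"
    by (subst sum.cartesian_product) (simp add: case_prod_beta)
  also have "\<dots> = (\<Sum>n\<in>T. f n) * (\<Sum>ns\<in>?L. \<Prod>n\<leftarrow>ns. f n)"
    by (simp add: sum_distrib_left sum_distrib_right)
  finally show ?case using Suc by simp
qed

lemma norm_power_lists:
  assumes "finite T"
  shows "complex_of_real (cmod (\<Sum>n\<in>T. f n) ^ (2 * s)) =
    (\<Sum>(ns, ms)\<in>{ns. set ns \<subseteq> T \<and> length ns = s} \<times> {ns. set ns \<subseteq> T \<and> length ns = s}.
       (\<Prod>n\<leftarrow>ns. f n) * cnj (\<Prod>n\<leftarrow>ms. f n))"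
proof -
  have "complex_of_real (cmod (\<Sum>n\<in>T. f n) ^ (2 * s)) = ((\<Sum>n\<in>T. f n) * cnj (\<Sum>n\<in>T. f n)) ^ s"
    by (simp only: complex_norm_square[symmetric] of_real_power power_mult)
  also have "\<dots> = (\<Sum>n\<in>T. f n) ^ s * cnj ((\<Sum>n\<in>T. f n) ^ s)" by (simp add: power_mult_distrib)
  also have "\<dots> = (\<Sum>ns | set ns \<subseteq> T \<and> length ns = s. \<Sum>ms | set ms \<subseteq> T \<and> length ms = s.
       (\<Prod>n\<leftarrow>ns. f n) * cnj (\<Prod>n\<leftarrow>ms. f n))"
    unfolding sum_power_lists[OF assms] cnj_sum sum_product ..
  finally show ?thesis by (simp add: sum.cartesian_product)
qed

definition power_diff :: "int list \<Rightarrow> int list \<Rightarrow> nat \<Rightarrow> int" where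
  "power_diff ns ms i = (\<Sum>n\<leftarrow>ns. n ^ i) - (\<Sum>m\<leftarrow>ms. m ^ i)"

lemma monomial_correlation:
  fixes x :: "nat \<Rightarrow> real"
  shows "(\<Prod>n\<leftarrow>ns. ee (\<Sum>i=1..d. x i * of_int n ^ i)) * cnj (\<Prod>n\<leftarrow>ms. ee (\<Sum>i=1..d. x i * of_int n ^ i))
    = ee (\<Sum>i=1..d. x i * of_int (power_diff ns ms i))"
proof -
  have l: "(\<Sum>n\<leftarrow>ns. \<Sum>i=1..d. x i * of_int n ^ i) = (\<Sum>i=1..d. x i * of_int (\<Sum>n\<leftarrow>ns. n ^ i))" for ns :: "int list"
    by (induction ns) (auto simp: sum.distrib distrib_left)
  have "(\<Prod>n\<leftarrow>ns. ee (\<Sum>i=1..d. x i * of_int n ^ i)) * cnj (\<Prod>n\<leftarrow>ms. ee (\<Sum>i=1..d. x i * of_int n ^ i))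
      = ee ((\<Sum>i=1..d. x i * of_int (\<Sum>n\<leftarrow>ns. n ^ i)) + - (\<Sum>i=1..d. x i * of_int (\<Sum>n\<leftarrow>ms. n ^ i)))"
    unfolding ee_sum_list[symmetric] l cnj_ee ee_add[symmetric] ..
  also have "(\<Sum>i=1..d. x i * of_int (\<Sum>n\<leftarrow>ns. n ^ i)) + - (\<Sum>i=1..d. x i * of_int (\<Sum>n\<leftarrow>ms. n ^ i))
     = (\<Sum>i=1..d. x i * of_int (power_diff ns ms i))"
    by (simp add: power_diff_def sum_subtractf right_diff_distrib)
  finally show ?thesis .
qed

lemma character_sum:
  fixes Q h :: int
  assumes Q: "0 < Q"
  shows "(\<Sum>y\<in>{0..<Q}. ee (of_int y / of_int Q * of_int h)) = (if Q dvd h then of_int Q else 0)"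
proof -
  define z where "z = ee (of_int h / of_int Q)"
  have "(\<Sum>y\<in>{0..<Q}. ee (of_int y / of_int Q * of_int h)) = (\<Sum>j<nat Q. z ^ j)"
    by (rule sum.reindex_bij_witness[where i = int and j = nat])
       (use Q in \<open>auto simp: z_def ee_power mult.commute\<close>)
  moreover have "z = 1 \<longleftrightarrow> Q dvd h"
  proof -
    have "of_int h / of_int Q \<in> (\<int> :: real set) \<longleftrightarrow> Q dvd h"
    proof
      assume "of_int h / of_int Q \<in> (\<int> :: real set)"
      then obtain k where "of_int h / of_int Q = (of_int k :: real)" by (auto elim: Ints_cases)
      then have "(of_int h :: real) = of_int (Q * k)" using Q by (simp add: field_simps)
      then show "Q dvd h" by (simp only: of_int_eq_iff) simp
    next
      assume "Q dvd h"
      then show "of_int h / of_int Q \<in> (\<int> :: real set)" using Q by (auto elim!: dvdE)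
    qed
    then show ?thesis unfolding z_def ee_eq_1_iff .
  qed
  moreover have "z ^ nat Q = 1" unfolding z_def ee_power ee_eq_1_iff using Q by simp
  ultimately show ?thesis using Q by (auto simp: geometric_sum)
qed

lemma grid_character_sum:
  fixes Q :: int and h :: "nat \<Rightarrow> int"
  assumes Q: "0 < Q"
  shows "(\<Sum>x\<in>PiE {1..d} (\<lambda>_. {0..<Q}). ee (\<Sum>i=1..d. of_int (x i) / of_int Q * of_int (h i)))
    = (if \<forall>i\<in>{1..d}. Q dvd h i then of_nat (card (PiE {1..d} (\<lambda>_. {0..<Q}))) else 0)"
proof -
  have "(\<Sum>x\<in>PiE {1..d} (\<lambda>_. {0..<Q}). ee (\<Sum>i=1..d. of_int (x i) / of_int Q * of_int (h i)))
     = (\<Prod>i=1..d. \<Sum>y\<in>{0..<Q}. ee (of_int y / of_int Q * of_int (h i)))"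
    unfolding ee_sum by (rule prod_sum_PiE[symmetric]) auto
  also have "\<dots> = (\<Prod>i=1..d. if Q dvd h i then of_int Q else 0)"
    unfolding character_sum[OF Q] ..
  also have "\<dots> = (if \<forall>i\<in>{1..d}. Q dvd h i then of_nat (card (PiE {1..d} (\<lambda>_. {0..<Q}))) else 0)"
    using Q by (auto simp: card_PiE)
  finally show ?thesis .
qed

text \<open>On the grid of denominators \<open>p^(d A)\<close> the correlations detect the congruences between power sums.\<close>
lemma nondegenerate_moment_curve:
  fixes p :: int and d A :: nat
  assumes p: "0 < p"
  defines "Q \<equiv> p ^ (d * A)"
  shows "nondegenerate p d A (PiE {1..d} (\<lambda>_. {0..<Q})) (\<lambda>_. 1) T
     (\<lambda>n x. ee (\<Sum>i=1..d. of_int (x i) / of_int Q * of_int n ^ i))"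
proof -
  let ?\<Omega> = "PiE {1..d} (\<lambda>_. {0..<Q})" and ?F = "\<lambda>n x. ee (\<Sum>i=1..d. of_int (x i) / of_int Q * of_int n ^ i)"
  have Q: "0 < Q" using p by (simp add: Q_def)
  let ?C = "congruences ?\<Omega> (\<lambda>_. 1) T ?F (triangular d) Q"
  interpret W: poly_module "{f. (\<lambda>n. poly f (n - 0)) \<in> ?C}" by (rule poly_module_congruences)
  have mono: "monom 1 j \<in> {f. (\<lambda>n. poly f (n - 0)) \<in> ?C}" if j: "j \<le> d" for j
  proof (cases "j = 0")
    case True
    then show ?thesis using W.const_mem[of 1] by (simp add: monom_0)
  next
    case False
    have "(\<lambda>n. n ^ j) \<in> ?C"
    proof (rule congruencesI)
      fix ns ms assume c: "correlation ?\<Omega> (\<lambda>_. 1) ?F ns ms \<noteq> 0"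
      have "correlation ?\<Omega> (\<lambda>_. 1) ?F ns ms = (\<Sum>x\<in>?\<Omega>. ee (\<Sum>i=1..d. of_int (x i) / of_int Q * of_int (power_diff ns ms i)))"
        unfolding correlation_def by (simp only: of_real_1 mult_1_left monomial_correlation)
      then have "\<forall>i\<in>{1..d}. Q dvd power_diff ns ms i"
        using c unfolding grid_character_sum[OF Q] by (auto split: if_splits)
      then show "Q dvd (\<Sum>n\<leftarrow>ns. n ^ j) - (\<Sum>m\<leftarrow>ms. m ^ j)"
        using j False by (auto simp: power_diff_def)
    qed
    moreover have "poly (monom 1 j) (n - 0) = n ^ j" for n :: int by (simp add: poly_monom)
    ultimately show ?thesis unfolding mem_Collect_eq by (simp only:)
  qed
  show ?thesis unfolding nondegenerate_def Q_def[symmetric]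
  proof (intro allI ballI exI)
    fix \<xi> :: int and i assume i: "i \<in> {1..d}"
    \<comment> \<open>Translation invariance: \<open>(n - \<xi>)^i\<close> is an integer combination
      of the powers of \<open>n\<close> up to \<open>i\<close>.\<close>
    define f where "f = [:- \<xi>, 1:] ^ i"
    have "degree f = i" unfolding f_def by (simp add: degree_linear_power)
    then have "(\<Sum>j\<le>i. smult (coeff f j) (monom 1 j)) = f"
      using poly_as_sum_of_monoms[of f] by (simp add: smult_monom)
    moreover have "(\<Sum>j\<le>i. smult (coeff f j) (monom 1 j)) \<in> {f. (\<lambda>n. poly f (n - 0)) \<in> ?C}"
      by (intro W.sum_closed W.smult_closed mono) (use i in auto)
    ultimately have "(\<lambda>n. poly f (n - 0)) \<in> ?C" by simp
    moreover have "poly f (n - 0) = (n - \<xi>) ^ i" for n unfolding f_def by (simp add: poly_power)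
    ultimately have "(\<lambda>n. (n - \<xi>) ^ i) \<in> ?C" by (simp only:)
    then show "(\<lambda>n. (n - \<xi>) ^ i + p * (n - \<xi>) ^ (d + 1) * poly 0 (n - \<xi>)) \<in> ?C"
      by simp
  qed
qed

text \<open>The solutions of the inhomogeneous Vinogradov system with the critical number
  \<open>s(d)\<close> of variables on each side. Arbitrary \<open>h\<close> occur because the moment
  is later grouped by the value of \<open>h\<close>.\<close>

definition reps :: "nat \<Rightarrow> nat \<Rightarrow> (nat \<Rightarrow> int) \<Rightarrow> (int list \<times> int list) set" where
  "reps d N h = {(ns, ms). set ns \<subseteq> {1..int N} \<and> length ns = triangular d \<and> set ms \<subseteq> {1..int N} \<and> length ms = triangular d \<and>
     (\<forall>i\<in>{1..d}. power_diff ns ms i = h i)}"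

text \<open>As \<open>N <= p^A\<close>, a finest class contains at most one integer of
  \<open>{1..N}\<close>, so the number of grid points serves as \<open>m\<close>. The grid detects
  the equations only modulo \<open>Q\<close>; counting the congruences \<open>G\<close> instead can
  only increase the number. The twist by \<open>h\<close> disappears on taking absolute
  values.\<close>

lemma reps_bound_prime_power:
  fixes p :: int
  assumes p: "1 < p" and N: "int N \<le> p ^ A" and dec: "decoupling_bound TYPE(nat \<Rightarrow> int) p d \<epsilon> C A"
  shows "real (card (reps d N h)) \<le> C * real_of_int p powr ((\<epsilon> + real (triangular d)) * real A)"
proof -
  define Q where "Q = p ^ (d * A)"
  define \<Omega> where "\<Omega> = PiE {1..d} (\<lambda>_. {0..<Q})"
  define F where "F = (\<lambda>n x. ee (\<Sum>i=1..d. of_int (x i) / of_int Q * of_int n ^ i))"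
  define T where "T = {1..int N}"
  define s where "s = triangular d"
  have Q: "0 < Q" using p by (simp add: Q_def)
  have fin: "finite \<Omega>" unfolding \<Omega>_def by (intro finite_PiE) auto
  have "(\<lambda>i\<in>{1..d}. 0) \<in> \<Omega>" using Q by (simp add: \<Omega>_def)
  then have m: "0 < real (card \<Omega>)" using fin by (auto simp: card_gt_0_iff)
  have nF: "cmod (F n x) = 1" for n x by (simp add: F_def)
  have small: "cmod (class_sum T F (p ^ A) \<xi> x) \<le> 1" for \<xi> x
  proof -
    let ?S = "{n \<in> T. p ^ A dvd n - \<xi>}"
    have eq: "n = n'" if n: "n \<in> ?S" "n' \<in> ?S" for n n'
    proof -
      have "p ^ A dvd n - \<xi>" "p ^ A dvd n' - \<xi>" using n by auto
      then have "p ^ A dvd (n - \<xi>) - (n' - \<xi>)" by (rule dvd_diff)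
      then have "p ^ A dvd n - n'" by simp
      moreover have "\<bar>n - n'\<bar> < p ^ A" using n N by (auto simp: T_def)
      ultimately show "n = n'" using dvd_imp_le_int[of "n - n'" "p ^ A"] p by fastforce
    qed
    have "finite ?S" by (rule finite_subset[of _ T]) (auto simp: T_def)
    then have c: "card ?S \<le> Suc 0" using card_le_Suc0_iff_eq eq by blast
    have "cmod (class_sum T F (p ^ A) \<xi> x) \<le> (\<Sum>n\<in>?S. cmod (F n x))" unfolding class_sum_def by (rule norm_sum)
    also have "\<dots> = real (card ?S)" by (simp add: nF)
    finally show ?thesis using c by simp
  qed
  have "admissible p d A \<Omega> (\<lambda>_. 1) T F (real (card \<Omega>))"
    unfolding admissible_def
  proof (intro conjI allI)
    show "nondegenerate p d A \<Omega> (\<lambda>_. 1) T F"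
      unfolding \<Omega>_def F_def Q_def using p by (intro nondegenerate_moment_curve) auto
    fix \<xi>
    have "(\<Sum>x\<in>\<Omega>. 1 * cmod (class_sum T F (p ^ A) \<xi> x) ^ (2 * triangular d)) \<le> (\<Sum>x\<in>\<Omega>. 1)"
      by (intro sum_mono) (use small in \<open>auto intro: power_le_one\<close>)
    then show "(\<Sum>x\<in>\<Omega>. 1 * cmod (class_sum T F (p ^ A) \<xi> x) ^ (2 * triangular d)) \<le> real (card \<Omega>)" by simp
  qed (use fin m in \<open>auto simp: T_def\<close>)
  from dec[unfolded decoupling_bound_def, rule_format, OF this]
  have dec': "(\<Sum>x\<in>\<Omega>. cmod (\<Sum>n\<in>T. F n x) ^ (2 * s)) \<le> C * real_of_int p powr ((\<epsilon> + real (triangular d)) * real A) * card \<Omega>"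
    by (simp add: s_def)
  define L where "L = {ns. set ns \<subseteq> T \<and> length ns = s}"
  have L: "finite L" unfolding L_def by (rule finite_lists_length_eq) (simp add: T_def)
  define G where "G = {z \<in> L \<times> L. \<forall>i\<in>{1..d}. Q dvd power_diff (fst z) (snd z) i - h i}"
  have "(\<Sum>x\<in>\<Omega>. of_real (cmod (\<Sum>n\<in>T. F n x) ^ (2 * s)) * ee (\<Sum>i=1..d. of_int (x i) / of_int Q * of_int (- h i)))
     = (\<Sum>x\<in>\<Omega>. \<Sum>z\<in>L \<times> L. ee (\<Sum>i=1..d. of_int (x i) / of_int Q * of_int (power_diff (fst z) (snd z) i - h i)))"
  proof (rule sum.cong[OF refl])
    fix x
    have T: "finite T" by (simp add: T_def)
    have 1: "(\<Prod>n\<leftarrow>ns. F n x) * cnj (\<Prod>n\<leftarrow>ms. F n x) = ee (\<Sum>i=1..d. of_int (x i) / of_int Q * of_int (power_diff ns ms i))" for ns ms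
      unfolding F_def by (rule monomial_correlation)
    have 2: "ee (\<Sum>i=1..d. of_int (x i) / of_int Q * of_int (power_diff ns ms i)) * ee (\<Sum>i=1..d. of_int (x i) / of_int Q * of_int (- h i))
      = ee (\<Sum>i=1..d. of_int (x i) / of_int Q * of_int (power_diff ns ms i - h i))" for ns ms
      unfolding ee_add[symmetric] sum.distrib[symmetric] by (simp add: right_diff_distrib)
    show "of_real (cmod (\<Sum>n\<in>T. F n x) ^ (2 * s)) * ee (\<Sum>i=1..d. of_int (x i) / of_int Q * of_int (- h i)) =
      (\<Sum>z\<in>L \<times> L. ee (\<Sum>i=1..d. of_int (x i) / of_int Q * of_int (power_diff (fst z) (snd z) i - h i)))"
      unfolding norm_power_lists[OF T] L_def[symmetric] sum_distrib_right case_prod_beta 1 2 ..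
  qed
  also have "\<dots> = (\<Sum>z\<in>L \<times> L. if z \<in> G then of_nat (card \<Omega>) else 0)"
    unfolding \<Omega>_def by (subst sum.swap, subst grid_character_sum[OF Q]) (rule sum.cong, auto simp: G_def)
  also have "\<dots> = of_nat (card G * card \<Omega>)"
  proof -
    have "(L \<times> L) \<inter> {z. z \<in> G} = G" by (auto simp: G_def)
    then show ?thesis using L by (simp add: sum.If_cases)
  qed
  finally have eq: "(\<Sum>x\<in>\<Omega>. of_real (cmod (\<Sum>n\<in>T. F n x) ^ (2 * s)) * ee (\<Sum>i=1..d. of_int (x i) / of_int Q * of_int (- h i))) = of_nat (card G * card \<Omega>)" .
  have "real (card G * card \<Omega>) = cmod (of_nat (card G * card \<Omega>))" by (simp only: norm_of_nat)
  also have "\<dots> \<le> (\<Sum>x\<in>\<Omega>. cmod (\<Sum>n\<in>T. F n x) ^ (2 * s))"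
    unfolding eq[symmetric] by (rule sum_norm_le) (simp add: norm_mult norm_power)
  also note dec'
  finally have "real (card G) \<le> C * real_of_int p powr ((\<epsilon> + real (triangular d)) * real A)" using m by simp
  moreover have "card (reps d N h) \<le> card G"
    using L by (intro card_mono) (auto simp: G_def reps_def L_def T_def s_def)
  ultimately show ?thesis by linarith
qed

theorem vinogradov_mean_value:
  assumes d: "1 \<le> d" and \<epsilon>: "0 < \<epsilon>"
  shows "\<exists>C>0. \<forall>N\<ge>1. \<forall>h. real (card (reps d N h)) \<le> C * real N powr (real (triangular d) + \<epsilon>)"
proof -
  \<comment> \<open>The prime depends on \<open>d\<close> alone, so fixed powers of it may enter the
    constant.\<close>
  obtain q :: nat where q: "prime q" "max 64 d < q" using bigger_prime by blast
  define p where "p = int q"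
  have p: "prime p" "64 \<le> p" "int d < p" using q by (auto simp: p_def)
  have p1: "1 < p" using p by simp
  have "decouples TYPE(nat \<Rightarrow> int) p d \<epsilon>" by (rule decoupling[OF p(1,2) d p(3) \<epsilon>])
  then obtain C where C: "C > 0" "\<And>A. decoupling_bound TYPE(nat \<Rightarrow> int) p d \<epsilon> C A" unfolding decouples_def by blast
  define e where "e = real (triangular d) + \<epsilon>"
  have e: "0 \<le> e" using \<epsilon> by (simp add: e_def)
  show ?thesis
  proof (intro exI[of _ "C * real_of_int p powr e"] conjI allI impI)
    fix N h assume N: "1 \<le> (N::nat)"
    have "N < 2 ^ N" by (rule less_exp)
    also have "2 ^ N \<le> q ^ N" using q(2) by (intro power_mono) auto
    finally have "N \<le> q ^ N" by simp
    then have ex: "\<exists>A. N \<le> q ^ A" by blast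
    \<comment> \<open>Rounding \<open>N\<close> up to a power of \<open>q\<close> costs at most a
      factor \<open>q\<close>.\<close>
    define A where "A = (LEAST A. N \<le> q ^ A)"
    have A: "N \<le> q ^ A" unfolding A_def by (rule LeastI_ex[OF ex])
    have up: "real q ^ A \<le> real q * real N"
    proof (cases A)
      case 0
      have "1 * 1 \<le> real q * real N" using N q by (intro mult_mono) auto
      then show ?thesis using 0 by simp
    next
      case (Suc B)
      have "\<not> N \<le> q ^ B" unfolding A_def[symmetric] using Suc not_less_Least[of B "\<lambda>A. N \<le> q ^ A"] by (simp add: A_def)
      then have "real (q ^ B) \<le> real N" by (simp only: of_nat_le_iff)
      then show ?thesis using Suc by (simp add: mult_left_mono)
    qed
    have "int N \<le> p ^ A" using A unfolding p_def by (metis of_nat_le_iff of_nat_power)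
    then have "real (card (reps d N h)) \<le> C * real_of_int p powr ((\<epsilon> + real (triangular d)) * real A)"
      by (rule reps_bound_prime_power[OF p1 _ C(2)])
    also have "real_of_int p powr ((\<epsilon> + real (triangular d)) * real A) = (real q ^ A) powr e"
      using q by (simp add: p_def e_def powr_powr add.commute mult.commute flip: powr_realpow)
    also have "\<dots> \<le> (real q * real N) powr e" using up e by (intro powr_mono2) auto
    also have "\<dots> = real_of_int p powr e * real N powr e" using N q by (simp add: p_def powr_mult)
    finally show "real (card (reps d N h)) \<le> C * real_of_int p powr e * real N powr (real (triangular d) + \<epsilon>)"
      using C by (simp add: e_def mult.assoc)
  qed (use C p in auto)
qed

section \<open>Moments with respect to measures of given Fourier decay\<close>

lemma sum_inverse_le_ln: "(\<Sum>j\<le>M. 1 / (1 + real j)) \<le> 1 + ln (1 + real M)"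
proof (induction M)
  case 0
  then show ?case by simp
next
  case (Suc M)
  have "ln ((1 + real M) / (2 + real M)) \<le> (1 + real M) / (2 + real M) - 1"
    by (intro ln_le_minus_one) auto
  then have "1 / (2 + real M) \<le> ln (2 + real M) - ln (1 + real M)"
    by (simp add: ln_div field_simps)
  then show ?case using Suc by (simp add: add_ac)
qed

text \<open>Splitting off \<open>(1 + |y|)^(1-\<beta>) <= (1 + M)^(1-\<beta>)\<close>, which uses
  \<open>\<beta> <= 1\<close>, leaves a harmonic sum; its logarithm is absorbed by \<delta>. The end
  point \<open>\<beta> = 1\<close> is thus included.\<close>

lemma one_dim_sum_bound:
  assumes \<delta>: "0 < \<delta>" and \<beta>: "0 \<le> \<beta>" "\<beta> \<le> 1"
  shows "(\<Sum>y\<in>{- int M..int M}. (1 + \<bar>real_of_int y\<bar>) powr (- \<beta>)) \<le> (2 + 2 / \<delta>) * (1 + real M) powr (1 - \<beta> + \<delta>)"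
proof -
  define g where "g = (\<lambda>y::int. (1 + \<bar>real_of_int y\<bar>) powr (- \<beta>))"
  have g0: "0 \<le> g y" for y by (simp add: g_def)
  have gj: "g y \<le> (1 + real M) powr (1 - \<beta>) * (1 / (1 + real j))" if y: "\<bar>y\<bar> = int j" and j: "j \<le> M" for y j
  proof -
    have a: "\<bar>real_of_int y\<bar> = real j" using y by (metis of_int_abs of_int_of_nat_eq)
    have "g y = (1 + real j) powr (1 - \<beta>) * (1 + real j) powr (- 1)"
      unfolding g_def a powr_add[symmetric] by simp
    also have "\<dots> \<le> (1 + real M) powr (1 - \<beta>) * (1 + real j) powr (- 1)"
      using j \<beta> by (intro mult_right_mono powr_mono2) auto
    finally show ?thesis by (simp add: powr_minus divide_inverse)
  qed
  have "{- int M..int M} \<subseteq> int ` {..M} \<union> (\<lambda>j. - int j) ` {..M}"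
  proof
    fix y assume y: "y \<in> {- int M..int M}"
    show "y \<in> int ` {..M} \<union> (\<lambda>j. - int j) ` {..M}"
    proof (cases "0 \<le> y")
      case True
      then show ?thesis using y by (intro UnI1 image_eqI[of _ _ "nat y"]) auto
    next
      case False
      then show ?thesis using y by (intro UnI2 image_eqI[of _ _ "nat (- y)"]) auto
    qed
  qed
  then have "(\<Sum>y\<in>{- int M..int M}. g y) \<le> (\<Sum>y\<in>int ` {..M} \<union> (\<lambda>j. - int j) ` {..M}. g y)"
    by (intro sum_mono2) (auto simp: g0)
  also have "\<dots> \<le> (\<Sum>y\<in>int ` {..M}. g y) + (\<Sum>y\<in>(\<lambda>j. - int j) ` {..M}. g y)"
    using sum.union_inter[of "int ` {..M}" "(\<lambda>j. - int j) ` {..M}" g] sum_nonneg[of "int ` {..M} \<inter> (\<lambda>j. - int j) ` {..M}" g]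
    by (simp add: g0)
  also have "\<dots> = (\<Sum>j\<le>M. g (int j)) + (\<Sum>j\<le>M. g (- int j))"
    by (simp add: sum.reindex inj_on_def)
  also have "\<dots> \<le> (\<Sum>j\<le>M. (1 + real M) powr (1 - \<beta>) * (1 / (1 + real j))) + (\<Sum>j\<le>M. (1 + real M) powr (1 - \<beta>) * (1 / (1 + real j)))"
    by (intro add_mono sum_mono gj) auto
  also have "\<dots> = 2 * (1 + real M) powr (1 - \<beta>) * (\<Sum>j\<le>M. 1 / (1 + real j))"
    by (simp add: sum_distrib_left)
  also have "\<dots> \<le> 2 * (1 + real M) powr (1 - \<beta>) * ((1 + 1 / \<delta>) * (1 + real M) powr \<delta>)"
  proof (intro mult_left_mono)
    have "ln (1 + real M) \<le> (1 + real M) powr \<delta> / \<delta>" using \<delta> by (intro ln_powr_bound) auto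
    moreover have "1 \<le> (1 + real M) powr \<delta>" using \<delta> by (intro ge_one_powr_ge_zero) auto
    ultimately show "(\<Sum>j\<le>M. 1 / (1 + real j)) \<le> (1 + 1 / \<delta>) * (1 + real M) powr \<delta>"
      using sum_inverse_le_ln[of M] by (simp add: distrib_right)
  qed auto
  also have "\<dots> = (2 + 2 / \<delta>) * (1 + real M) powr (1 - \<beta> + \<delta>)"
    by (simp only: powr_add) (simp add: algebra_simps)
  finally show ?thesis unfolding g_def .
qed

text \<open>Since \<open>1 + \<parallel>h\<parallel> \<ge> 1 + |h\<^sub>i|\<close>, the decay can be distributed over the coordinates: exponent \<open>1\<close> for
  \<open>i > l\<close>, the remainder \<open>\<sigma> - (d - l)\<close> for \<open>i = l\<close>, and none for \<open>i < l\<close>.\<close>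
definition decay_weight :: "nat \<Rightarrow> nat \<Rightarrow> real \<Rightarrow> nat \<Rightarrow> real" where
  "decay_weight d l \<sigma> i = (if i < l then 0 else if i = l then \<sigma> - (real d - real l) else 1)"

lemma sum_decay_weight:
  assumes "1 \<le> l" "l \<le> d"
  shows "(\<Sum>i=1..d. decay_weight d l \<sigma> i) = \<sigma>"
proof -
  have "(\<Sum>i=1..d. decay_weight d l \<sigma> i) = decay_weight d l \<sigma> l + (\<Sum>i\<in>{1..d}-{l}. decay_weight d l \<sigma> i)"
    using assms by (intro sum.remove) auto
  also have "(\<Sum>i\<in>{1..d}-{l}. decay_weight d l \<sigma> i) = (\<Sum>i\<in>{l<..d}. decay_weight d l \<sigma> i)"
    using assms by (intro sum.mono_neutral_right) (auto simp: decay_weight_def)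
  also have "\<dots> = (\<Sum>i\<in>{l<..d}. 1)" by (rule sum.cong) (auto simp: decay_weight_def)
  finally show ?thesis using assms by (simp add: decay_weight_def of_nat_diff)
qed

text \<open>The coordinate \<open>i\<close> has range about \<open>N^i\<close> and contributes
  \<open>N^(i (1 - \<beta>))\<close> for its decay exponent \<beta>, so this is the exponent of
  \<open>N\<close> in the box sum. Coordinates above \<open>l\<close> contribute nothing, those
  below their full range.\<close>

lemma sum_scaled_decay_weight:
  assumes "1 \<le> l" "l \<le> d"
  shows "(\<Sum>i=1..d. real i * (1 - decay_weight d l \<sigma> i)) = ss (real l) + real l * (real d - \<sigma> - real l)"
proof -
  let ?f = "\<lambda>i. real i * (1 - decay_weight d l \<sigma> i)"
  have "(\<Sum>i=1..d. ?f i) = (\<Sum>i\<in>{1..l}. ?f i)"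
    using assms by (intro sum.mono_neutral_right) (auto simp: decay_weight_def)
  also have "\<dots> = ?f l + (\<Sum>i\<in>{1..l}-{l}. ?f i)" using assms by (intro sum.remove) auto
  also have "(\<Sum>i\<in>{1..l}-{l}. ?f i) = (\<Sum>i\<in>{1..l}-{l}. real i)"
    by (rule sum.cong) (auto simp: decay_weight_def)
  also have "\<dots> = (\<Sum>i\<in>{1..l}. real i) - real l" using assms by (subst sum_diff1) auto
  also have "(\<Sum>i\<in>{1..l}. real i) = real l * (real l + 1) / 2"
    by (induction l) (auto simp: field_simps)
  finally have sum: "(\<Sum>i=1..d. ?f i) = ?f l + (real l * (real l + 1) / 2 - real l)" .
  have fl: "?f l = real l * (1 - \<sigma> + real d - real l)" by (simp add: decay_weight_def algebra_simps)
  show ?thesis unfolding sum fl ss_def by (simp add: field_simps)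
qed

lemma decay_le_prod:
  assumes l: "1 \<le> l" "l \<le> d" and \<beta>: "0 \<le> \<sigma> - (real d - real l)"
  shows "(1 + L2_set h {1..d}) powr (- \<sigma>) \<le> (\<Prod>i=1..d. (1 + \<bar>h i\<bar>) powr (- decay_weight d l \<sigma> i))"
proof -
  have L: "\<bar>h i\<bar> \<le> L2_set h {1..d}" if "i \<in> {1..d}" for i
  proof -
    have "\<bar>h i\<bar> \<le> L2_set (\<lambda>i. \<bar>h i\<bar>) {1..d}" using that by (intro member_le_L2_set) auto
    then show ?thesis by (simp add: L2_set_def)
  qed
  have "(1 + L2_set h {1..d}) powr (- \<sigma>) = (\<Prod>i=1..d. (1 + L2_set h {1..d}) powr (- decay_weight d l \<sigma> i))"
  proof -
    have "1 + L2_set h {1..d} > 0" using L2_set_nonneg[of h "{1..d}"] by linarith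
    then have "(\<Prod>i=1..d. (1 + L2_set h {1..d}) powr (- decay_weight d l \<sigma> i)) = (1 + L2_set h {1..d}) powr (\<Sum>i=1..d. - decay_weight d l \<sigma> i)"
      by (subst powr_sum) auto
    then show ?thesis using sum_decay_weight[OF l, of \<sigma>] by (simp add: sum_negf)
  qed
  also have "\<dots> \<le> (\<Prod>i=1..d. (1 + \<bar>h i\<bar>) powr (- decay_weight d l \<sigma> i))"
  proof (intro prod_mono conjI)
    fix i assume i: "i \<in> {1..d}"
    show "(1 + L2_set h {1..d}) powr (- decay_weight d l \<sigma> i) \<le> (1 + \<bar>h i\<bar>) powr (- decay_weight d l \<sigma> i)"
      using L[OF i] \<beta> by (intro powr_mono2') (auto simp: decay_weight_def)
  qed auto
  finally show ?thesis .
qed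

lemma box_sum_bound:
  assumes l: "1 \<le> l" "l \<le> d" and \<beta>: "0 \<le> \<sigma> - (real d - real l)" "\<sigma> - (real d - real l) \<le> 1" and \<delta>: "0 < \<delta>"
  shows "\<exists>C>0. \<forall>N\<ge>1. (\<Sum>h\<in>PiE {1..d} (\<lambda>i. {- int (s * N ^ i)..int (s * N ^ i)}).
       (1 + L2_set (\<lambda>i. real_of_int (h i)) {1..d}) powr (- \<sigma>))
     \<le> C * real N powr (ss (real l) + real l * (real d - \<sigma> - real l) + \<delta>)"
proof -
  \<comment> \<open>A loss \<eta> in coordinate \<open>i\<close> costs \<open>N^(i \<eta>)\<close>;
    together these cost \<open>N^\<delta>\<close>.\<close>
  define \<eta> where "\<eta> = \<delta> / (\<Sum>i=1..d. real i)"
  have S: "0 < (\<Sum>i=1..d. real i)"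
    using l by (intro sum_pos2[of _ 1]) auto
  have \<eta>: "0 < \<eta>" using \<delta> S by (simp add: \<eta>_def)
  define b where "b = decay_weight d l \<sigma>"
  have b: "0 \<le> b i" "b i \<le> 1" for i using \<beta> by (auto simp: b_def decay_weight_def)
  define c where "c i = (2 + 2 / \<eta>) * (1 + real s) powr (1 - b i + \<eta>)" for i
  have c: "c i > 0" for i using \<eta> by (simp add: c_def add_pos_pos)
  show ?thesis
  proof (intro exI[of _ "\<Prod>i=1..d. c i"] conjI allI impI)
    show "0 < (\<Prod>i=1..d. c i)" by (intro prod_pos) (use c in auto)
    fix N :: nat assume N: "1 \<le> N"
    let ?I = "\<lambda>i. {- int (s * N ^ i)..int (s * N ^ i)}"
    have "(\<Sum>h\<in>PiE {1..d} ?I. (1 + L2_set (\<lambda>i. real_of_int (h i)) {1..d}) powr (- \<sigma>)) \<le>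
       (\<Sum>h\<in>PiE {1..d} ?I. \<Prod>i=1..d. (1 + \<bar>real_of_int (h i)\<bar>) powr (- b i))"
      unfolding b_def using decay_le_prod[OF l \<beta>(1)] by (intro sum_mono) blast
    also have "\<dots> = (\<Prod>i=1..d. \<Sum>y\<in>?I i. (1 + \<bar>real_of_int y\<bar>) powr (- b i))"
      by (rule prod_sum_PiE[symmetric]) auto
    also have "\<dots> \<le> (\<Prod>i=1..d. c i * real N powr (real i * (1 - b i) + real i * \<eta>))"
    proof (intro prod_mono conjI sum_nonneg)
      fix i assume "i \<in> {1..d}"
      have e: "0 \<le> 1 - b i + \<eta>" using b[of i] \<eta> by simp
      have "(\<Sum>y\<in>?I i. (1 + \<bar>real_of_int y\<bar>) powr (- b i)) \<le> (2 + 2 / \<eta>) * (1 + real (s * N ^ i)) powr (1 - b i + \<eta>)"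
        by (rule one_dim_sum_bound[OF \<eta> b])
      also have "\<dots> \<le> (2 + 2 / \<eta>) * ((1 + real s) * real N ^ i) powr (1 - b i + \<eta>)"
      proof (intro mult_left_mono powr_mono2 e)
        have "1 \<le> real N ^ i" using N by simp
        then show "1 + real (s * N ^ i) \<le> (1 + real s) * real N ^ i" by (simp add: distrib_right)
      qed (use \<eta> in auto)
      also have "\<dots> = c i * (real N ^ i) powr (1 - b i + \<eta>)" using N by (simp add: c_def powr_mult)
      also have "(real N ^ i) powr (1 - b i + \<eta>) = real N powr (real i * (1 - b i) + real i * \<eta>)"
        using N by (simp add: powr_powr distrib_left flip: powr_realpow)
      finally show "(\<Sum>y\<in>?I i. (1 + \<bar>real_of_int y\<bar>) powr (- b i)) \<le> c i * real N powr (real i * (1 - b i) + real i * \<eta>)" .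
    qed auto
    also have "\<dots> = (\<Prod>i=1..d. c i) * real N powr (\<Sum>i=1..d. real i * (1 - b i) + real i * \<eta>)"
      using N by (simp add: prod.distrib powr_sum)
    also have "(\<Sum>i=1..d. real i * (1 - b i) + real i * \<eta>) = ss (real l) + real l * (real d - \<sigma> - real l) + \<delta>"
    proof -
      have "(\<Sum>i=1..d. real i * \<eta>) = (\<Sum>i=1..d. real i) * \<eta>" by (rule sum_distrib_right[symmetric])
      also have "\<dots> = \<delta>" using S by (simp add: \<eta>_def)
      finally have "(\<Sum>i=1..d. real i * \<eta>) = \<delta>" .
      then show ?thesis unfolding sum.distrib b_def sum_scaled_decay_weight[OF l] by simp
    qed
    finally show "(\<Sum>h\<in>PiE {1..d} ?I. (1 + L2_set (\<lambda>i. real_of_int (h i)) {1..d}) powr (- \<sigma>))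
     \<le> (\<Prod>i=1..d. c i) * real N powr (ss (real l) + real l * (real d - \<sigma> - real l) + \<delta>)" .
  qed
qed

section \<open>From moments to Fourier coefficients\<close>

lemma subpolynomial_bound:
  fixes a :: "nat \<Rightarrow> complex"
  assumes "\<forall>\<^sub>F n in sequentially. cmod (a n) \<le> real n powr \<delta>" and \<delta>: "0 < \<delta>"
  shows "\<exists>K>0. \<forall>n\<ge>1. cmod (a n) \<le> K * real n powr \<delta>"
proof -
  obtain n0 where n0: "\<And>n. n0 \<le> n \<Longrightarrow> cmod (a n) \<le> real n powr \<delta>"
    using assms(1) unfolding eventually_sequentially by blast
  define K where "K = 1 + (\<Sum>n<n0. cmod (a n))"
  have K1: "1 \<le> K" unfolding K_def by (simp add: sum_nonneg)
  show ?thesis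
  proof (intro exI[of _ K] conjI allI impI)
    fix n :: nat assume n: "1 \<le> n"
    have n1: "1 \<le> real n powr \<delta>" using n \<delta> by (intro ge_one_powr_ge_zero) auto
    show "cmod (a n) \<le> K * real n powr \<delta>"
    proof (cases "n < n0")
      case True
      then have "cmod (a n) \<le> (\<Sum>n<n0. cmod (a n))" by (intro member_le_sum) auto
      also have "\<dots> \<le> K * 1" by (simp add: K_def)
      also have "\<dots> \<le> K * real n powr \<delta>" using n1 K1 by (intro mult_left_mono) auto
      finally show ?thesis .
    next
      case False
      then have "cmod (a n) \<le> 1 * real n powr \<delta>" using n0 by simp
      also have "\<dots> \<le> K * real n powr \<delta>" using K1 by (intro mult_right_mono) auto
      finally show ?thesis .
    qed
  qed (use K1 in simp)
qed

lemma weyl_sum_int: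
  "weyl_sum a d x N = (\<Sum>n\<in>{1..int N}. a (nat n) * ee (\<Sum>i=1..d. x i * of_int n ^ i))"
  unfolding weyl_sum_def
  by (rule sum.reindex_bij_witness[where i = nat and j = int]) auto

lemma power_diff_bound:
  assumes "set ns \<subseteq> {1..int N}" "set ms \<subseteq> {1..int N}" "length ns = s" "length ms = s"
  shows "power_diff ns ms i \<in> {- int (s * N ^ i)..int (s * N ^ i)}"
proof -
  have "0 \<le> (\<Sum>n\<leftarrow>ns. n ^ i) \<and> (\<Sum>n\<leftarrow>ns. n ^ i) \<le> int (length ns * N ^ i)" if "set ns \<subseteq> {1..int N}" for ns
    using that
  proof (induction ns)
    case (Cons n ns)
    then have "0 \<le> n ^ i" "n ^ i \<le> int N ^ i" by (auto intro: power_mono)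
    then show ?case using Cons by (auto simp: algebra_simps)
  qed simp
  from this[OF assms(1)] this[OF assms(2)] show ?thesis
    unfolding power_diff_def assms(3,4) by auto
qed

text \<open>Absolute values are taken after integrating term by term, so each product of
  \<open>2 s\<close> coefficients costs only \<open>B ^ (2 * s)\<close>, a factor
  \<open>N^o(1)\<close> in the application.\<close>

lemma moment_le_fourier_sum:
  assumes \<mu>: "radon_measure_on_torus d \<mu>" and B: "\<And>n. 1 \<le> n \<Longrightarrow> n \<le> N \<Longrightarrow> cmod (a n) \<le> B" "0 \<le> B"
  shows "(\<integral>x. cmod (weyl_sum a d x N) ^ (2 * s) \<partial>\<mu>) \<le>
    (\<Sum>z\<in>{ns. set ns \<subseteq> {1..int N} \<and> length ns = s} \<times> {ns. set ns \<subseteq> {1..int N} \<and> length ns = s}.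
       B ^ (2 * s) * cmod (fourier_transform d \<mu> (\<lambda>i. - real_of_int (power_diff (fst z) (snd z) i))))"
proof -
  interpret finite_measure \<mu> using \<mu> by (intro finite_measureI) (auto simp: radon_measure_on_torus_def)
  define T where "T = {1..int N}"
  define L where "L = {ns. set ns \<subseteq> T \<and> length ns = s}"
  have T: "finite T" by (simp add: T_def)
  have L: "finite L" unfolding L_def by (rule finite_lists_length_eq[OF T])
  have meas_i: "(\<lambda>x. x i) \<in> borel_measurable \<mu>" if "i \<in> {1..d}" for i
  proof -
    have "(\<lambda>x. x i) \<in> torus_borel d \<rightarrow>\<^sub>M restrict_space borel {0..<1::real}"
      unfolding torus_borel_def using that by (rule measurable_component_singleton)
    then have "(\<lambda>x. x i) \<in> borel_measurable (torus_borel d)"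
      unfolding measurable_restrict_space2_iff by simp
    moreover have "sets \<mu> = sets (torus_borel d)" using \<mu> by (simp add: radon_measure_on_torus_def)
    ultimately show ?thesis by (simp cong: measurable_cong_sets)
  qed
  have ee_meas: "ee \<in> borel_measurable borel" unfolding ee_def by (intro borel_measurable_continuous_onI continuous_intros)
  have int_e: "integrable \<mu> (\<lambda>x. ee (\<Sum>i=1..d. x i * c i))" for c
  proof (rule integrable_const_bound[where B = 1])
    have "(\<lambda>x. \<Sum>i=1..d. x i * c i) \<in> borel_measurable \<mu>"
      by (intro borel_measurable_sum borel_measurable_times meas_i borel_measurable_const)
    then show "(\<lambda>x. ee (\<Sum>i=1..d. x i * c i)) \<in> borel_measurable \<mu>"
      by (rule measurable_compose[OF _ ee_meas])
  qed simp
  define co where "co z = (\<Prod>n\<leftarrow>fst z. a (nat n)) * cnj (\<Prod>n\<leftarrow>snd z. a (nat n))" for z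
  have prod_split: "(\<Prod>n\<leftarrow>ns. a (nat n) * g n) = (\<Prod>n\<leftarrow>ns. a (nat n)) * (\<Prod>n\<leftarrow>ns. g n)" for ns and g :: "int \<Rightarrow> complex"
    by (induction ns) auto
  have expand: "complex_of_real (cmod (weyl_sum a d x N) ^ (2 * s)) =
      (\<Sum>z\<in>L \<times> L. co z * ee (\<Sum>i=1..d. x i * of_int (power_diff (fst z) (snd z) i)))" for x
  proof -
    have "complex_of_real (cmod (weyl_sum a d x N) ^ (2 * s)) = (\<Sum>z\<in>L \<times> L.
       (\<Prod>n\<leftarrow>fst z. a (nat n) * ee (\<Sum>i=1..d. x i * of_int n ^ i)) * cnj (\<Prod>n\<leftarrow>snd z. a (nat n) * ee (\<Sum>i=1..d. x i * of_int n ^ i)))"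
      unfolding weyl_sum_int T_def[symmetric] norm_power_lists[OF T] L_def[symmetric] case_prod_beta ..
    also have "\<dots> = (\<Sum>z\<in>L \<times> L. co z * ee (\<Sum>i=1..d. x i * of_int (power_diff (fst z) (snd z) i)))"
    proof (rule sum.cong[OF refl])
      fix z
      show "(\<Prod>n\<leftarrow>fst z. a (nat n) * ee (\<Sum>i=1..d. x i * of_int n ^ i)) * cnj (\<Prod>n\<leftarrow>snd z. a (nat n) * ee (\<Sum>i=1..d. x i * of_int n ^ i))
        = co z * ee (\<Sum>i=1..d. x i * of_int (power_diff (fst z) (snd z) i))"
        unfolding prod_split co_def monomial_correlation[symmetric] by (simp only: complex_cnj_mult ac_simps)
    qed
    finally show ?thesis .
  qed
  \<comment> \<open>The minus sign compensates the one in the kernel \<open>e(-x . xi)\<close> of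
    the transform.\<close>
  have ft: "(\<integral>x. ee (\<Sum>i=1..d. x i * of_int (h i)) \<partial>\<mu>) = fourier_transform d \<mu> (\<lambda>i. - real_of_int (h i))" for h
    unfolding fourier_transform_def by (simp add: sum_negf)
  have co_le: "cmod (co z) \<le> B ^ (2 * s)" if "z \<in> L \<times> L" for z
  proof -
    have pl: "cmod (\<Prod>n\<leftarrow>ns. a (nat n)) \<le> B ^ length ns" if "set ns \<subseteq> T" for ns
      using that
    proof (induction ns)
      case (Cons n ns)
      have "cmod (a (nat n)) \<le> B" using Cons.prems by (intro B) (auto simp: T_def)
      then show ?case using Cons B(2) by (auto simp: norm_mult intro!: mult_mono)
    qed simp
    have "cmod (co z) = cmod (\<Prod>n\<leftarrow>fst z. a (nat n)) * cmod (\<Prod>n\<leftarrow>snd z. a (nat n))"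
      by (simp only: co_def norm_mult complex_mod_cnj)
    also have "\<dots> \<le> B ^ s * B ^ s"
      using that pl[of "fst z"] pl[of "snd z"] B(2) by (intro mult_mono) (auto simp: L_def)
    finally show ?thesis by (simp add: mult_2 power_add)
  qed
  have "complex_of_real (\<integral>x. cmod (weyl_sum a d x N) ^ (2 * s) \<partial>\<mu>) =
      (\<integral>x. (\<Sum>z\<in>L \<times> L. co z * ee (\<Sum>i=1..d. x i * of_int (power_diff (fst z) (snd z) i))) \<partial>\<mu>)"
    unfolding integral_complex_of_real[symmetric] expand ..
  also have "\<dots> = (\<Sum>z\<in>L \<times> L. co z * fourier_transform d \<mu> (\<lambda>i. - real_of_int (power_diff (fst z) (snd z) i)))"
    by (subst Bochner_Integration.integral_sum)
       (intro integrable_mult_right int_e, simp only: integral_mult_right_zero ft)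
  finally have eq: "complex_of_real (\<integral>x. cmod (weyl_sum a d x N) ^ (2 * s) \<partial>\<mu>) = \<dots>" .
  have "(\<integral>x. cmod (weyl_sum a d x N) ^ (2 * s) \<partial>\<mu>) \<le> cmod (complex_of_real (\<integral>x. cmod (weyl_sum a d x N) ^ (2 * s) \<partial>\<mu>))"
    by simp
  also have "\<dots> \<le> (\<Sum>z\<in>L \<times> L. B ^ (2 * s) * cmod (fourier_transform d \<mu> (\<lambda>i. - real_of_int (power_diff (fst z) (snd z) i))))"
    unfolding eq by (rule sum_norm_le) (auto simp: norm_mult intro!: mult_right_mono co_le)
  finally show ?thesis unfolding L_def T_def .
qed

theorem theorem2p2:
  fixes d :: nat and \<mu> :: "(nat \<Rightarrow> real) measure" and \<sigma> :: real
    and a :: "nat \<Rightarrow> complex" and l :: int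
  assumes "d \<ge> 2"
    and "radon_measure_on_torus d \<mu>"
    and "0 < \<sigma>" and "\<sigma> \<le> real d"
    and "\<exists>c>0. \<forall>\<xi> :: nat \<Rightarrow> real.
           cmod (fourier_transform d \<mu> \<xi>) \<le> c * (1 + L2_set \<xi> {1..d}) powr (- \<sigma>)"
    and "\<forall>\<epsilon>>0. \<forall>\<^sub>F n in sequentially. cmod (a n) \<le> real n powr \<epsilon>"
    and "l = round (real d - \<sigma> + 1 / 2)"
  shows "\<forall>\<epsilon>>0. \<forall>\<^sub>F N in sequentially.
           (\<integral>x. cmod (weyl_sum a d x N) powr (2 * ss (real d)) \<partial>\<mu>)
             \<le> real N powr (ss (real d) + ss (of_int l) + of_int l * (real d - \<sigma> - of_int l) + \<epsilon>)"
proof (intro allI impI)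
  fix \<epsilon> :: real assume \<epsilon>: "0 < \<epsilon>"
  \<comment> \<open>Rounding adds another \<open>1/2\<close>, so \<open>l\<close> is the floor of
    \<open>d - \<sigma>\<close> plus 1. Equivalently \<open>\<sigma> - (d - l)\<close> lies in
    \<open>(0, 1]\<close>, the range in which the decay can be distributed;
    \<open>\<sigma> <= d\<close> gives \<open>l >= 1\<close> and \<open>\<sigma> > 0\<close> gives
    \<open>l <= d\<close>.\<close>
  have l_fl: "l = \<lfloor>real d - \<sigma> + 1\<rfloor>" using assms(7) by (simp add: round_def)
  have l1: "real_of_int l \<le> real d - \<sigma> + 1" "real d - \<sigma> + 1 < real_of_int l + 1"
    unfolding l_fl by linarith+
  have "0 < real_of_int l" using l1 assms(4) by linarith
  then have lpos: "0 < l" by simp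
  define k where "k = nat l"
  have lk: "l = int k" using lpos by (simp add: k_def)
  have "real k < real d + 1" using l1 assms(3) by (simp add: lk)
  then have k: "1 \<le> k" "k \<le> d" using lpos lk by auto
  have \<beta>: "0 \<le> \<sigma> - (real d - real k)" "\<sigma> - (real d - real k) \<le> 1" using l1 by (auto simp: lk)
  define s where "s = triangular d"
  have s: "real s = ss (real d)"
  proof -
    have "real (2 * triangular d) = real d * (real d + 1)" unfolding two_triangular by (simp add: algebra_simps)
    then show ?thesis by (simp add: s_def ss_def)
  qed
  define E where "E = ss (real k) + real k * (real d - \<sigma> - real k)"
  \<comment> \<open>The coefficients lose \<open>2 s \<delta>\<close>, the mean value and the box
    sum \<delta> each: half of \<epsilon> in total. The other half absorbs the constant
    \<open>C\<close> for large \<open>N\<close>.\<close>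
  define \<delta> where "\<delta> = \<epsilon> / (2 * (2 * real s + 2))"
  have \<delta>: "0 < \<delta>" using \<epsilon> by (simp add: \<delta>_def)
  obtain c where c: "0 < c" "\<And>\<xi> :: nat \<Rightarrow> real. cmod (fourier_transform d \<mu> \<xi>) \<le> c * (1 + L2_set \<xi> {1..d}) powr (- \<sigma>)"
    using assms(5) by blast
  obtain K where K: "0 < K" "\<And>n. 1 \<le> n \<Longrightarrow> cmod (a n) \<le> K * real n powr \<delta>"
    using subpolynomial_bound[OF assms(6)[rule_format, OF \<delta>] \<delta>] by blast
  obtain C1 where C1: "0 < C1" "\<And>N h. 1 \<le> N \<Longrightarrow> real (card (reps d N h)) \<le> C1 * real N powr (real s + \<delta>)"
    using vinogradov_mean_value[of d \<delta>] assms(1) \<delta> unfolding s_def by auto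
  obtain C2 where C2: "0 < C2" "\<And>N. 1 \<le> N \<Longrightarrow> (\<Sum>h\<in>PiE {1..d} (\<lambda>i. {- int (s * N ^ i)..int (s * N ^ i)}).
       (1 + L2_set (\<lambda>i. real_of_int (h i)) {1..d}) powr (- \<sigma>)) \<le> C2 * real N powr (E + \<delta>)"
    using box_sum_bound[OF k \<beta> \<delta>] unfolding E_def by blast
  define C where "C = K ^ (2 * s) * c * C1 * C2"
  have C: "0 < C" using K c C1 C2 by (simp add: C_def)
  have main: "(\<integral>x. cmod (weyl_sum a d x N) powr (2 * ss (real d)) \<partial>\<mu>) \<le> C * real N powr (real s + E + \<epsilon> / 2)"
    if N: "1 \<le> N" for N
  proof -
    define T where "T = {1..int N}"
    define L where "L = {ns. set ns \<subseteq> T \<and> length ns = s}"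
    define H where "H = PiE {1..d} (\<lambda>i. {- int (s * N ^ i)..int (s * N ^ i)})"
    define B where "B = K * real N powr \<delta>"
    have L: "finite L" unfolding L_def by (rule finite_lists_length_eq) (simp add: T_def)
    have H: "finite H" unfolding H_def by (intro finite_PiE) auto
    have B: "cmod (a n) \<le> B" if "1 \<le> n" "n \<le> N" for n
    proof -
      have "cmod (a n) \<le> K * real n powr \<delta>" by (rule K(2)[OF that(1)])
      also have "\<dots> \<le> B" unfolding B_def using that K \<delta> by (intro mult_left_mono powr_mono2) auto
      finally show ?thesis .
    qed
    have B0: "0 \<le> B" using K by (simp add: B_def)
    \<comment> \<open>The restriction makes the vector of differences extensional, so that it is an
      element of the \<open>PiE\<close> box.\<close>
    define hv where "hv z = restrict (power_diff (fst z) (snd z)) {1..d}" for z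
    define G where "G h = (1 + L2_set (\<lambda>i. real_of_int (h i)) {1..d}) powr (- \<sigma>)" for h :: "nat \<Rightarrow> int"
    have hvH: "hv z \<in> H" if "z \<in> L \<times> L" for z
      using that power_diff_bound[of "fst z" N "snd z" s] unfolding hv_def H_def L_def T_def
      by (intro PiE_I) auto
    have ftG: "cmod (fourier_transform d \<mu> (\<lambda>i. - real_of_int (power_diff (fst z) (snd z) i))) \<le> c * G (hv z)" for z
    proof -
      have "L2_set (\<lambda>i. - real_of_int (power_diff (fst z) (snd z) i)) {1..d} = L2_set (\<lambda>i. real_of_int (hv z i)) {1..d}"
        unfolding L2_set_def by (intro arg_cong[where f = sqrt] sum.cong) (auto simp: hv_def)
      then show ?thesis using c(2)[of "\<lambda>i. - real_of_int (power_diff (fst z) (snd z) i)"] by (simp add: G_def)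
    qed
    \<comment> \<open>Where the Weyl sum vanishes, \<open>0 powr 0 = 0\<close> differs from
      \<open>0 ^ 0 = 1\<close>; the two kinds of power agree because \<open>s\<close> is
      positive.\<close>
    have "cmod (weyl_sum a d x N) powr (2 * ss (real d)) = cmod (weyl_sum a d x N) ^ (2 * s)" for x
    proof -
      have e: "2 * ss (real d) = real (2 * s)" using s by simp
      have "0 < s" unfolding s_def using assms(1) by (intro triangular_pos) auto
      then show ?thesis unfolding e by (intro powr_realpow') auto
    qed
    then have "(\<integral>x. cmod (weyl_sum a d x N) powr (2 * ss (real d)) \<partial>\<mu>) = (\<integral>x. cmod (weyl_sum a d x N) ^ (2 * s) \<partial>\<mu>)" by simp
    also have "\<dots> \<le> (\<Sum>z\<in>L \<times> L. B ^ (2 * s) * cmod (fourier_transform d \<mu> (\<lambda>i. - real_of_int (power_diff (fst z) (snd z) i))))"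
      unfolding L_def T_def by (rule moment_le_fourier_sum[OF assms(2) B B0])
    also have "\<dots> \<le> (\<Sum>z\<in>L \<times> L. B ^ (2 * s) * (c * G (hv z)))"
      using B0 by (intro sum_mono mult_left_mono ftG) auto
    also have "\<dots> = B ^ (2 * s) * c * (\<Sum>z\<in>L \<times> L. G (hv z))"
      by (simp add: sum_distrib_left mult.assoc)
    \<comment> \<open>Grouping by the value of the differences turns the multiplicities into numbers
      of solutions, bounded uniformly in \<open>h\<close> by the mean value theorem.\<close>
    also have "(\<Sum>z\<in>L \<times> L. G (hv z)) = (\<Sum>h\<in>H. \<Sum>z\<in>{z \<in> L \<times> L. hv z = h}. G (hv z))"
      using L H hvH by (intro sum.group[symmetric]) auto
    also have "\<dots> = (\<Sum>h\<in>H. real (card {z \<in> L \<times> L. hv z = h}) * G h)"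
      by (intro sum.cong refl) simp
    also have "\<dots> \<le> (\<Sum>h\<in>H. C1 * real N powr (real s + \<delta>) * G h)"
    proof (intro sum_mono mult_right_mono)
      fix h assume "h \<in> H"
      have sub: "{z \<in> L \<times> L. hv z = h} \<subseteq> reps d N h"
        by (auto simp: reps_def L_def T_def s_def hv_def)
      have "reps d N h \<subseteq> L \<times> L" by (auto simp: reps_def L_def T_def s_def)
      then have "finite (reps d N h)" using L by (meson finite_SigmaI finite_subset)
      then have "card {z \<in> L \<times> L. hv z = h} \<le> card (reps d N h)" using sub by (intro card_mono)
      then show "real (card {z \<in> L \<times> L. hv z = h}) \<le> C1 * real N powr (real s + \<delta>)"
        using C1(2)[OF N, of h] by linarith
    qed (simp add: G_def)
    also have "\<dots> = C1 * real N powr (real s + \<delta>) * (\<Sum>h\<in>H. G h)" by (simp add: sum_distrib_left)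
    also have "\<dots> \<le> C1 * real N powr (real s + \<delta>) * (C2 * real N powr (E + \<delta>))"
      unfolding H_def G_def using C1 C2(2)[OF N] by (intro mult_left_mono) auto
    finally have "(\<integral>x. cmod (weyl_sum a d x N) powr (2 * ss (real d)) \<partial>\<mu>) \<le>
       B ^ (2 * s) * c * (C1 * real N powr (real s + \<delta>) * (C2 * real N powr (E + \<delta>)))"
      using B0 c by (simp add: mult_left_mono)
    also have "\<dots> = C * (real N powr (\<delta> * real (2 * s)) * real N powr (real s + \<delta>) * real N powr (E + \<delta>))"
    proof -
      have "(real N powr \<delta>) ^ (2 * s) = real N powr (\<delta> * real (2 * s))"
        using N by (simp add: powr_powr flip: powr_realpow)
      then show ?thesis unfolding B_def C_def power_mult_distrib by simp
    qed
    also have "\<dots> = C * real N powr (real s + E + \<delta> * (2 * real s + 2))"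
      by (simp add: algebra_simps flip: powr_add)
    also have "\<delta> * (2 * real s + 2) = \<epsilon> / 2"
    proof -
      have "2 * real s + 2 \<noteq> 0" by (simp add: add_nonneg_eq_0_iff)
      then show ?thesis unfolding \<delta>_def by (simp add: field_simps)
    qed
    finally show ?thesis .
  qed
  have "\<forall>\<^sub>F N in sequentially. C powr (2 / \<epsilon>) \<le> real N"
    using filterlim_real_sequentially by (simp add: filterlim_at_top)
  then have "\<forall>\<^sub>F N in sequentially. C \<le> real N powr (\<epsilon> / 2)"
  proof eventually_elim
    case (elim N)
    then have "(C powr (2 / \<epsilon>)) powr (\<epsilon> / 2) \<le> real N powr (\<epsilon> / 2)" using \<epsilon> by (intro powr_mono2) auto
    then show ?case using \<epsilon> C by (simp add: powr_powr)
  qed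
  then show "\<forall>\<^sub>F N in sequentially. (\<integral>x. cmod (weyl_sum a d x N) powr (2 * ss (real d)) \<partial>\<mu>)
             \<le> real N powr (ss (real d) + ss (of_int l) + of_int l * (real d - \<sigma> - of_int l) + \<epsilon>)"
    using eventually_ge_at_top[of 1]
  proof eventually_elim
    case (elim N)
    have "(\<integral>x. cmod (weyl_sum a d x N) powr (2 * ss (real d)) \<partial>\<mu>) \<le> C * real N powr (real s + E + \<epsilon> / 2)"
      using main elim by simp
    also have "\<dots> \<le> real N powr (\<epsilon> / 2) * real N powr (real s + E + \<epsilon> / 2)"
      using elim by (intro mult_right_mono) auto
    also have "\<dots> = real N powr (ss (real d) + ss (of_int l) + of_int l * (real d - \<sigma> - of_int l) + \<epsilon>)"
      unfolding powr_add[symmetric] lk E_def s by (simp add: algebra_simps)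
    finally show ?case .
  qed
qed

end
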